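(* For every $d\ge2$, every marked $(d+1)$-ended ribbon tree $\mathcal{T}$ is realizable.
   Context: For a finite tree, ends ($\epsilon(\mathcal{T})$) are vertices whose removal leaves it connected, branch points ($\beta(\mathcal{T})$) are vertices whose removal leaves $\ge3$ components, $\mathrm{Int}(\mathcal{T})=\mathcal{T}\setminus\epsilon(\mathcal{T})$; a ribbon structure is a planar embedding up to isotopy. A marked $(d+1)$-ended ribbon tree is a finite ribbon tree with vertex set $\beta(\mathcal{T})\cup\epsilon(\mathcal{T})$, exactly $d+1$ ends, and one marked end. $\mathcal{B}^-_d=\{\bar z\prod_{i=1}^{d-1}\frac{\bar z-a_i}{1-\overline{a_iz}}:|a_i|<1\}$; with $\mathbb{S}^1=\mathbb{R}/\mathbb{Z}$, $m_{-d}(t)=-dt$, $\eta_f$ is the unique quasisymmetric conjugacy with $\eta_f\circ m_{-d}=f\circ\eta_f$, continuous in $f$, $\eta_{m_{-d}}=\mathrm{id}$; $\mathcal{B}^-_d(K)$ is the set of $f$ with $\log|\partial_{\bar z}f(\eta_f(x))|\le K$ at every fixed point $x$ of $m_{-d}$. $F(f)$ denotes the repelling fixed points of $f$ on $\mathbb{S}^1$, marked point $\eta_f(1)$. $\mathcal{T}$ is realizable if there exist $K>0$, a sequence $f_n\in\mathcal{B}^-_d(K)$, a constant $K'>0$ and proper injective maps $\phi_n:\mathrm{Int}(\mathcal{T})\to\mathbb{D}$ such that: $\phi_n$ extends continuously to $\mathcal{T}\to\overline{\mathbb{D}}$ with $\epsilon(\mathcal{T})\to F(f_n)$ a bijection respecting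 markings; $d_{\mathbb{D}}(\phi_n(v),\phi_n(w))\to\infty$ for distinct $v,w\in\beta(\mathcal{T})$; each edge is mapped to the hyperbolic geodesic joining the images of its endpoints; for each $v\in\beta(\mathcal{T})$ exactly $\mathrm{val}(v)-2$ critical points of $f_n$ (with multiplicity) lie within uniformly bounded hyperbolic distance of $\phi_n(v)$; and $d_{\mathbb{D}}(f_n(\phi_n(x)),\phi_n(x))\le K'$ for all $x\in\mathrm{Int}(\mathcal{T})$ and all $n$. *)

theory Defs
  imports "HOL-Complex_Analysis.Complex_Analysis"
begin

section \<open>Finite trees (combinatorial), ends, branch points\<close>

text \<open>A finite tree is given by a finite vertex set V and a set E of 2-element edges.
  A graph is a tree iff it is connected and has card V - 1 edges.\<close>

definition adj_rel :: "'v set set \<Rightarrow> ('v \<times> 'v) set" where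
  "adj_rel E = {(x, y). {x, y} \<in> E \<and> x \<noteq> y}"

definition is_finite_tree :: "'v set \<Rightarrow> 'v set set \<Rightarrow> bool" where
  "is_finite_tree V E \<longleftrightarrow> finite V \<and> V \<noteq> {} \<and>
     (\<forall>e\<in>E. \<exists>x y. x \<in> V \<and> y \<in> V \<and> x \<noteq> y \<and> e = {x, y}) \<and>
     (\<forall>x\<in>V. \<forall>y\<in>V. (x, y) \<in> (adj_rel E)\<^sup>*) \<and>
     card E + 1 = card V"

definition valence :: "'v set set \<Rightarrow> 'v \<Rightarrow> nat" where
  "valence E v = card {e \<in> E. v \<in> e}"

text \<open>Ends: removal leaves the tree connected, i.e. valence 1 (trees with at least 2 vertices).
  Branch points: removal leaves at least 3 components, i.e. valence at least 3.\<close>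

definition tree_ends :: "'v set \<Rightarrow> 'v set set \<Rightarrow> 'v set" where
  "tree_ends V E = {v \<in> V. valence E v = 1}"

definition tree_branch :: "'v set \<Rightarrow> 'v set set \<Rightarrow> 'v set" where
  "tree_branch V E = {v \<in> V. valence E v \<ge> 3}"

text \<open>Ends on the side of x after deleting edge e.\<close>
definition ends_side :: "'v set \<Rightarrow> 'v set set \<Rightarrow> 'v set \<Rightarrow> 'v \<Rightarrow> 'v set" where
  "ends_side V E e x = {v \<in> tree_ends V E. (x, v) \<in> (adj_rel (E - {e}))\<^sup>*}"

text \<open>Ribbon structure encoding: the ends are labelled 0..d in the counterclockwise order in
  which they occur along the boundary of the planar embedding, label 0 being the marked end.
  Such a labelling comes from a planar embedding iff every edge splits the ends into two cyclic
  intervals; for trees without valence-2 vertices the cyclic order of the ends determines the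
  ribbon structure.\<close>

definition cyclic_interval :: "nat \<Rightarrow> nat set \<Rightarrow> bool" where
  "cyclic_interval m S \<longleftrightarrow> (\<exists>a k. S = {(a + i) mod m | i. i < k})"

definition marked_ribbon_tree :: "nat \<Rightarrow> 'v set \<Rightarrow> 'v set set \<Rightarrow> ('v \<Rightarrow> nat) \<Rightarrow> bool" where
  "marked_ribbon_tree d V E lab \<longleftrightarrow>
     is_finite_tree V E \<and>
     V = tree_ends V E \<union> tree_branch V E \<and>
     bij_betw lab (tree_ends V E) {..d} \<and>
     (\<forall>x y. {x, y} \<in> E \<longrightarrow> cyclic_interval (d + 1) (lab ` ends_side V E {x, y} x))"

section \<open>Hyperbolic geometry of the unit disk\<close>

definition hdist :: "complex \<Rightarrow> complex \<Rightarrow> real" where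
  "hdist z w = (let r = norm (z - w) / norm (1 - cnj w * z) in ln ((1 + r) / (1 - r)))"

definition moeb :: "complex \<Rightarrow> complex \<Rightarrow> complex" where
  "moeb p z = (z + p) / (1 + cnj p * z)"

text \<open>Open hyperbolic geodesic segment (or ray, if q is on the unit circle) from p (in the disk)
  to q, endpoints excluded: the image under the isometry moeb p of the radial segment.\<close>
definition geo_open :: "complex \<Rightarrow> complex \<Rightarrow> complex set" where
  "geo_open p q = {moeb p (complex_of_real s * ((q - p) / (1 - cnj p * q))) | s. 0 < s \<and> s < 1}"

section \<open>Anti-Blaschke products and the circle\<close>

definition Bminus :: "nat \<Rightarrow> (complex \<Rightarrow> complex) set" where
  "Bminus d = {f. \<exists>a :: nat \<Rightarrow> complex. (\<forall>i < d - 1. norm (a i) < 1) \<and>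
      f = (\<lambda>z. cnj z * (\<Prod>i < d - 1. (cnj z - a i) / (1 - cnj (a i * z))))}"

text \<open>S^1 = R/Z, embedded in C by t \<mapsto> exp(2 pi i t).\<close>
definition circ :: "real \<Rightarrow> complex" where
  "circ t = cis (2 * pi * t)"

text \<open>Wirtinger derivative d/d(zbar) = (d/dx + i d/dy)/2.\<close>
definition dzbar :: "(complex \<Rightarrow> complex) \<Rightarrow> complex \<Rightarrow> complex" where
  "dzbar f z = (frechet_derivative f (at z) 1 + \<i> * frechet_derivative f (at z) \<i>) / 2"

text \<open>Quasisymmetry of a circle homeomorphism, expressed on its lift R \<rightarrow> R.\<close>
definition quasisymmetric_lift :: "(real \<Rightarrow> real) \<Rightarrow> bool" where
  "quasisymmetric_lift h \<longleftrightarrow> (\<exists>M \<ge> 1. \<forall>x s. s > 0 \<longrightarrow>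
      h (x + s) - h x \<le> M * (h x - h (x - s)) \<and> h x - h (x - s) \<le> M * (h (x + s) - h x))"

text \<open>eta f is the lift of the conjugacy eta_f (eta_f(t) = circ (eta f t)):
  an increasing degree-one quasisymmetric circle homeomorphism with
  eta_f o m_{-d} = f o eta_f, depending continuously on f (uniform convergence),
  with eta_{m_{-d}} = id (m_{-d} corresponds to z \<mapsto> conj z ^ d).\<close>
definition conjugacy_family :: "nat \<Rightarrow> ((complex \<Rightarrow> complex) \<Rightarrow> real \<Rightarrow> real) \<Rightarrow> bool" where
  "conjugacy_family d eta \<longleftrightarrow>
     (\<forall>f \<in> Bminus d. continuous_on UNIV (eta f) \<and> strict_mono (eta f) \<and>
        (\<forall>t. eta f (t + 1) = eta f t + 1) \<and> quasisymmetric_lift (eta f) \<and>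
        (\<forall>t. circ (eta f (- real d * t)) = f (circ (eta f t)))) \<and>
     eta (\<lambda>z. cnj z ^ d) = id \<and>
     (\<forall>fs f. (\<forall>n. fs n \<in> Bminus d) \<and> f \<in> Bminus d \<and>
        uniform_limit (sphere 0 1) fs f sequentially \<longrightarrow>
        uniform_limit UNIV (\<lambda>n. eta (fs n)) (eta f) sequentially)"

definition BminusK :: "nat \<Rightarrow> ((complex \<Rightarrow> complex) \<Rightarrow> real \<Rightarrow> real) \<Rightarrow> real \<Rightarrow> (complex \<Rightarrow> complex) set" where
  "BminusK d eta K = {f \<in> Bminus d. \<forall>x :: real. (- real d * x - x) \<in> \<int> \<longrightarrow>
      ln (norm (dzbar f (circ (eta f x)))) \<le> K}"

text \<open>Repelling fixed points on the unit circle (anti-holomorphic map: |d f/d zbar| > 1).\<close>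
definition rep_fix :: "(complex \<Rightarrow> complex) \<Rightarrow> complex set" where
  "rep_fix f = {z. norm z = 1 \<and> f z = z \<and> norm (dzbar f z) > 1}"

text \<open>Critical points in the disk of an anti-holomorphic f(z) = g(conj z), with multiplicity
  the order of vanishing of g' at conj c.\<close>
definition crit_pts :: "(complex \<Rightarrow> complex) \<Rightarrow> complex set" where
  "crit_pts f = {c \<in> ball 0 1. deriv (\<lambda>w. f (cnj w)) (cnj c) = 0}"

definition crit_mult :: "(complex \<Rightarrow> complex) \<Rightarrow> complex \<Rightarrow> nat" where
  "crit_mult f c = nat (zorder (deriv (\<lambda>w. f (cnj w))) (cnj c))"

definition crit_count_near :: "(complex \<Rightarrow> complex) \<Rightarrow> complex \<Rightarrow> real \<Rightarrow> nat" where
  "crit_count_near f p R = (\<Sum>c \<in> {c \<in> crit_pts f. hdist c p \<le> R}. crit_mult f c)"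

section \<open>Realizability\<close>

text \<open>Image of the (open) edge e under the map determined by vertex positions phi:
  the hyperbolic geodesic joining the images of its endpoints.\<close>
definition edge_img :: "'v set \<Rightarrow> 'v set set \<Rightarrow> ('v \<Rightarrow> complex) \<Rightarrow> 'v set \<Rightarrow> complex set" where
  "edge_img V E phi e = \<Union>{geo_open (phi x) (phi y) | x y. e = {x, y} \<and> x \<in> tree_branch V E}"

definition int_img :: "'v set \<Rightarrow> 'v set set \<Rightarrow> ('v \<Rightarrow> complex) \<Rightarrow> complex set" where
  "int_img V E phi = phi ` tree_branch V E \<union> \<Union>(edge_img V E phi ` E)"

definition realizable ::
  "nat \<Rightarrow> ((complex \<Rightarrow> complex) \<Rightarrow> real \<Rightarrow> real) \<Rightarrow> 'v set \<Rightarrow> 'v set set \<Rightarrow> ('v \<Rightarrow> nat) \<Rightarrow> bool" where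
  "realizable d eta V E lab \<longleftrightarrow>
    (\<exists>K > 0. \<exists>fs :: nat \<Rightarrow> complex \<Rightarrow> complex. (\<forall>n. fs n \<in> BminusK d eta K) \<and>
     (\<exists>K' > 0. \<exists>phi :: nat \<Rightarrow> 'v \<Rightarrow> complex.
       (\<forall>n. \<forall>v \<in> tree_branch V E. phi n v \<in> ball 0 1) \<and>
       (\<forall>n. bij_betw (phi n) (tree_ends V E) (rep_fix (fs n))) \<and>
       (\<forall>n. \<forall>v \<in> tree_ends V E. lab v = 0 \<longrightarrow> phi n v = circ (eta (fs n) 0)) \<and>
       (\<forall>n. \<exists>\<theta> :: nat \<Rightarrow> real. strict_mono_on {..d} \<theta> \<and> \<theta> d < \<theta> 0 + 1 \<and>
             (\<forall>v \<in> tree_ends V E. phi n v = circ (\<theta> (lab v)))) \<and>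
       (\<forall>n. inj_on (phi n) V \<and>
             (\<forall>e \<in> E. \<forall>e' \<in> E. e \<noteq> e' \<longrightarrow> edge_img V E (phi n) e \<inter> edge_img V E (phi n) e' = {}) \<and>
             (\<forall>v \<in> tree_branch V E. \<forall>e \<in> E. phi n v \<notin> edge_img V E (phi n) e)) \<and>
       (\<forall>v \<in> tree_branch V E. \<forall>w \<in> tree_branch V E. v \<noteq> w \<longrightarrow>
             filterlim (\<lambda>n. hdist (phi n v) (phi n w)) at_top sequentially) \<and>
       (\<forall>v \<in> tree_branch V E. \<exists>R. \<forall>n.
             crit_count_near (fs n) (phi n v) R = valence E v - 2) \<and>
       (\<forall>n. \<forall>z \<in> int_img V E (phi n). hdist (fs n z) z \<le> K')))"

end

theory Submission
  imports Defs "HOL-Computational_Algebra.Fundamental_Theorem_Algebra"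
begin

text \<open>Write \<open>f z = cnj (G z)\<close>. On the circle \<open>f z = z\<close> means \<open>z G z = 1\<close>, so the Herglotz formula
  turns anti-Blaschke products with \<open>f 0 = 0\<close> into configurations of weighted points on the circle
  with barycentre 0, the weight of a fixed point of multiplier \<open>\<lambda>\<close> being \<open>1 / (1 + \<lambda>)\<close>. With
  equal weights \<open>1 / (d + 1)\<close> all multipliers are \<open>d\<close>. Any \<open>d + 1\<close> points can be moved
  to barycentre 0 by a Moebius map (conformal barycentre), and a rotation by a root of unity puts the
  marked point at the right place. The hyperbolic displacement of \<open>f\<close> at \<open>z\<close> depends only on the
  Euclidean barycentre of the fixed points as seen from \<open>z\<close>; it is bounded wherever two of them are
  seen at a definite angle.

  In the upper half-plane, put the marked end at infinity and the other ends on the real line, with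
  gaps \<open>\<epsilon> ^ k\<close> where \<open>k\<close> is the height of the last common ancestor, and put a branch point of
  height \<open>k\<close> at height \<open>\<epsilon> ^ k\<close> above the first end below it. The geodesic edges then stay in Stolz
  angles at the ends. Rescaled at a branch point \<open>v\<close>, the ends converge to \<open>val v\<close> distinct
  points, and the limiting map has \<open>val v - 2\<close> critical points; Rouche's theorem transfers this
  count to small \<open>\<epsilon>\<close>.\<close>

section \<open>Rooted trees\<close>

text \<open>Equal weights settle the multipliers in advance: the constant \<open>K\<close> is
  \<open>ln d\<close> for every configuration, and the tree is encoded only in the relative position
  of the fixed points. The normal form of \<open>Bminus\<close> uses up the remaining freedom.
  Barycentre 0 leaves rotations, the absence of a unimodular constant prescribes the product of the
  fixed points, and the \<open>d + 1\<close> rotations that respect this product are just enough to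
  move the marking.

  The marking is the delicate point, because \<open>eta\<close> is known only through its axioms:
  nothing says directly which fixed point \<open>eta f 0\<close> is. Only continuity in
  \<open>f\<close> and the value at \<open>cnj z ^ d\<close> can decide it, so an integer invariant
  of fixed points is needed that can be followed along a path.

  Disjointness of the edges is obtained from convexity and not from estimates along curves: each
  branch point owns a hyperbolic half-plane that contains the vertices of its subtree and no others,
  and a geodesic with both ends on one side stays on that side. Heights grow away from the marked
  end, so a single small parameter separates all scales at once.\<close>

locale rooted_tree =
  fixes V :: "'v set" and r :: 'v and p :: "'v \<Rightarrow> 'v" and h :: "'v \<Rightarrow> nat"
  assumes finite_V: "finite V" and root_in: "r \<in> V" and parent_root: "p r = r"
    and parent_in: "v \<in> V \<Longrightarrow> p v \<in> V"
    and height_parent: "v \<in> V \<Longrightarrow> v \<noteq> r \<Longrightarrow> h v = Suc (h (p v))"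
begin

definition desc :: "'v \<Rightarrow> 'v set" where
  "desc v = {w \<in> V. \<exists>k. (p ^^ k) w = v}"

definition children :: "'v \<Rightarrow> 'v set" where
  "children v = {w \<in> V - {r}. p w = v}"

lemma desc_subset: "desc v \<subseteq> V"
  by (auto simp: desc_def)

lemma desc_in: "w \<in> desc v \<Longrightarrow> w \<in> V"
  by (simp add: desc_def)

lemma finite_desc: "finite (desc v)"
  using finite_subset[OF desc_subset finite_V] .

lemma finite_children: "finite (children v)"
  by (auto simp: children_def intro: finite_subset[OF _ finite_V])

lemma desc_refl: "v \<in> V \<Longrightarrow> v \<in> desc v"
  by (auto simp: desc_def intro: exI[of _ 0])

lemma desc_trans: "u \<in> desc v \<Longrightarrow> v \<in> desc w \<Longrightarrow> u \<in> desc w"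
proof -
  assume "u \<in> desc v" "v \<in> desc w"
  then obtain i j where "u \<in> V" "(p ^^ i) u = v" "(p ^^ j) v = w" by (auto simp: desc_def)
  then have "(p ^^ (j + i)) u = w" by (simp add: funpow_add)
  with \<open>u \<in> V\<close> show "u \<in> desc w" by (auto simp: desc_def)
qed

lemma parent_desc: "w \<in> V \<Longrightarrow> w \<in> desc (p w)"
  by (auto simp: desc_def intro: exI[of _ 1])

lemma desc_root_eq: "r \<in> desc v \<Longrightarrow> v = r"
proof -
  have "(p ^^ k) r = r" for k by (induction k) (auto simp: parent_root)
  then show "r \<in> desc v \<Longrightarrow> v = r" by (auto simp: desc_def)
qed

lemma desc_cases:
  assumes "w \<in> desc v" "w \<noteq> v"
  shows "w \<noteq> r" "p w \<in> desc v"
proof -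
  show "w \<noteq> r" using assms desc_root_eq by auto
  obtain k where k: "(p ^^ k) w = v" "w \<in> V" using assms by (auto simp: desc_def)
  with assms obtain k' where "k = Suc k'" by (cases k) auto
  then have "(p ^^ k') (p w) = v" using k by (simp add: funpow_swap1)
  then show "p w \<in> desc v" using k parent_in by (auto simp: desc_def)
qed

lemma height_desc: "w \<in> desc v \<Longrightarrow> w \<noteq> v \<Longrightarrow> h v < h w"
proof (induction "h w" arbitrary: w rule: less_induct)
  case less
  have w: "w \<noteq> r" "p w \<in> desc v" using desc_cases less.prems by auto
  have "w \<in> V" using less.prems desc_in by blast
  then have hp: "h w = Suc (h (p w))" using w height_parent by auto
  show ?case
    using less.hyps[of "p w"] hp w by (cases "p w = v") auto
qed

lemma height_desc_le: "w \<in> desc v \<Longrightarrow> h v \<le> h w"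
  using height_desc[of w v] by (cases "w = v") auto

lemma desc_antisym: "v \<in> desc w \<Longrightarrow> w \<in> desc v \<Longrightarrow> v = w"
  using height_desc[of v w] height_desc[of w v] by (metis less_asym)

text \<open>All ancestors of \<open>w\<close> lie on the one chain of iterates of \<open>p\<close>,
  and the smaller exponent gives the lower vertex.\<close>

lemma desc_comparable:
  assumes "w \<in> desc x" "w \<in> desc y"
  shows "x \<in> desc y \<or> y \<in> desc x"
proof -
  obtain i j where ij: "(p ^^ i) w = x" "(p ^^ j) w = y" "w \<in> V"
    using assms by (auto simp: desc_def)
  have inV: "(p ^^ k) w \<in> V" for k by (induction k) (auto simp: ij parent_in)
  have *: "(p ^^ (b - a)) ((p ^^ a) w) = (p ^^ b) w" if "a \<le> b" for a b
    using that by (metis comp_apply funpow_add le_add_diff_inverse2)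
  show ?thesis
  proof (cases "i \<le> j")
    case True
    then show ?thesis using *[OF True] ij inV[of i] by (auto simp: desc_def)
  next
    case False
    then show ?thesis using *[of j i] ij inV[of j] by (auto simp: desc_def)
  qed
qed

lemma desc_root: "desc r = V"
proof -
  have "w \<in> desc r" if "w \<in> V" for w
    using that
  proof (induction "h w" arbitrary: w rule: less_induct)
    case less
    show ?case
    proof (cases "w = r")
      case False
      then have "p w \<in> desc r" using less height_parent parent_in by simp
      then show ?thesis using parent_desc less.prems desc_trans by blast
    qed (use less desc_refl in auto)
  qed
  then show ?thesis using desc_subset by auto
qed

lemma desc_child:
  assumes "w \<in> desc v" "w \<noteq> v"
  obtains c where "c \<in> children v" "w \<in> desc c"
proof -
  have "\<exists>c \<in> children v. w \<in> desc c"
    using assms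
  proof (induction "h w" arbitrary: w rule: less_induct)
    case less
    have w: "w \<noteq> r" "p w \<in> desc v" "w \<in> V"
      using desc_cases[OF less.prems] desc_in[OF less.prems(1)] by auto
    show ?case
    proof (cases "p w = v")
      case True
      then show ?thesis using w desc_refl by (auto simp: children_def intro!: bexI[of _ w])
    next
      case False
      then obtain c where "c \<in> children v" "p w \<in> desc c"
        using less.hyps[of "p w"] w height_parent by auto
      then show ?thesis using parent_desc[of w] w desc_trans by blast
    qed
  qed
  then show thesis using that by blast
qed

lemma children_desc:
  assumes c: "c \<in> children v"
  shows "c \<in> desc v" "c \<noteq> v"
proof -
  have "c \<in> V" "c \<noteq> r" "p c = v" using c by (auto simp: children_def)
  then show "c \<in> desc v" "c \<noteq> v" using parent_desc[of c] height_parent[of c] by auto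
qed

text \<open>Siblings have equal height, while a proper descendant is strictly higher in
  \<open>h\<close>; so two comparable siblings coincide.\<close>

lemma children_disjoint:
  assumes "c \<in> children v" "c' \<in> children v" "w \<in> desc c" "w \<in> desc c'"
  shows "c = c'"
proof (rule ccontr)
  assume ne: "c \<noteq> c'"
  have "h c = h c'" using assms height_parent by (auto simp: children_def)
  moreover have "c \<in> desc c' \<or> c' \<in> desc c" using desc_comparable assms by auto
  ultimately show False using height_desc[of c c'] height_desc[of c' c] ne by auto
qed

definition leaves :: "'v set" where
  "leaves = {v \<in> V - {r}. children v = {}}"

lemma leaf_exists:
  assumes "v \<in> V" "v \<noteq> r"
  obtains w where "w \<in> leaves" "w \<in> desc v"
proof -
  have "Max (h ` desc v) \<in> h ` desc v"
    using desc_refl[OF assms(1)] finite_desc by (intro Max_in) auto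
  then obtain w where w: "w \<in> desc v" "h w = Max (h ` desc v)" by auto
  have w: "w \<in> desc v" "\<And>u. u \<in> desc v \<Longrightarrow> h u \<le> h w"
    using w finite_desc by auto
  have "children w = {}"
  proof (rule ccontr)
    assume "children w \<noteq> {}"
    then obtain c where c: "c \<in> children w" by auto
    then have "c \<in> desc v" using children_desc w desc_trans by blast
    moreover have "h w < h c" using height_desc children_desc c by blast
    ultimately show False using w(2)[of c] by simp
  qed
  moreover have "w \<noteq> r" using w desc_root_eq assms by auto
  ultimately show thesis using that w desc_in[OF w(1)] by (simp add: leaves_def)
qed

text \<open>Each edge is named by its lower vertex, so the edges at \<open>v\<close> are those of
  its children and, unless \<open>v\<close> is the root, its own.\<close>

lemma valence_children:
  assumes "v \<in> V"
  shows "valence ((\<lambda>w. {p w, w}) ` (V - {r})) v = card (children v) + (if v = r then 0 else 1)"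
proof -
  let ?e = "\<lambda>w. {p w, w}"
  have inj: "inj_on ?e (V - {r})"
  proof (rule inj_onI)
    fix x y assume xy: "x \<in> V - {r}" "y \<in> V - {r}" "?e x = ?e y"
    show "x = y"
    proof (rule ccontr)
      assume "x \<noteq> y"
      then have "x = p y" "y = p x" using xy by (auto simp: doubleton_eq_iff)
      then show False using height_parent[of x] height_parent[of y] xy by auto
    qed
  qed
  have eq: "{e \<in> ?e ` (V - {r}). v \<in> e} = ?e ` (children v \<union> ({v} - {r}))"
    using assms by (auto simp: children_def)
  have "valence (?e ` (V - {r})) v = card (children v \<union> ({v} - {r}))"
    unfolding valence_def eq using assms
    by (intro card_image inj_on_subset[OF inj]) (auto simp: children_def)
  also have "\<dots> = card (children v) + card ({v} - {r})"
    using children_desc(2)[of v v] by (intro card_Un_disjoint finite_children) auto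
  finally show ?thesis by auto
qed

text \<open>This turns \<open>ends_side\<close>, which is defined by reachability, into a set of
  descendants. Every remaining edge joins a vertex to its parent, and the only such step out of the
  subtree of \<open>v\<close> is the deleted one.\<close>

lemma reach_desc:
  assumes "v \<in> V" "v \<noteq> r"
  defines "E \<equiv> (\<lambda>w. {p w, w}) ` (V - {r})"
  shows "(v, w) \<in> (adj_rel (E - {{v, p v}}))\<^sup>* \<longleftrightarrow> w \<in> desc v"
proof
  assume "(v, w) \<in> (adj_rel (E - {{v, p v}}))\<^sup>*"
  then show "w \<in> desc v"
  proof (induction rule: rtrancl_induct)
    case base
    show ?case using desc_refl assms by simp
  next
    case (step y z)
    then have yz: "{y, z} \<in> E" "{y, z} \<noteq> {v, p v}" "y \<noteq> z" by (auto simp: adj_rel_def)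
    then obtain u where "u \<in> V - {r}" "{y, z} = {p u, u}" unfolding E_def by blast
    then consider "y = p z" "z \<in> V - {r}" | "z = p y" "y \<in> V - {r}"
      by (auto simp: doubleton_eq_iff)
    then show ?case
    proof cases
      case 1
      then show ?thesis using parent_desc[of z] step.IH desc_trans by auto
    next
      case 2
      then have "y \<noteq> v" using yz by (auto simp: insert_commute)
      then show ?thesis using desc_cases(2)[OF step.IH] 2 by simp
    qed
  qed
next
  assume "w \<in> desc v"
  then show "(v, w) \<in> (adj_rel (E - {{v, p v}}))\<^sup>*"
  proof (induction "h w" arbitrary: w rule: less_induct)
    case less
    show ?case
    proof (cases "w = v")
      case False
      have w: "w \<noteq> r" "p w \<in> desc v" "w \<in> V"
        using desc_cases[OF less.prems False] desc_in[OF less.prems(1)] by auto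
      then have "(v, p w) \<in> (adj_rel (E - {{v, p v}}))\<^sup>*"
        using less.hyps height_parent by auto
      moreover have "{p w, w} \<noteq> {v, p v}"
      proof
        assume "{p w, w} = {v, p v}"
        then have "w = p v" using False by (auto simp: doubleton_eq_iff)
        then have "h v = Suc (h w)" using assms height_parent by auto
        then show False using height_desc_le[OF less.prems] by simp
      qed
      then have "(p w, w) \<in> adj_rel (E - {{v, p v}})"
        using w height_parent[of w] by (force simp: adj_rel_def E_def)
      ultimately show ?thesis by (rule rtrancl.rtrancl_into_rtrancl)
    qed simp
  qed
qed

end

section \<open>Rooting a marked ribbon tree at its marked end\<close>

lemma finite_tree_rooted:
  assumes T: "is_finite_tree V E" and r: "r \<in> V"
  obtains p h where "rooted_tree V r p h" "E = (\<lambda>v. {p v, v}) ` (V - {r})"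
proof -
  have fin: "finite V" and ed: "\<And>e. e \<in> E \<Longrightarrow> \<exists>x y. x \<in> V \<and> y \<in> V \<and> x \<noteq> y \<and> e = {x, y}"
    and conn: "\<And>x y. x \<in> V \<Longrightarrow> y \<in> V \<Longrightarrow> (x, y) \<in> (adj_rel E)\<^sup>*"
    and cE: "card E + 1 = card V"
    using T unfolding is_finite_tree_def by blast+
  define dist where "dist v = (LEAST n. (r, v) \<in> adj_rel E ^^ n)" for v
  have dist: "(r, v) \<in> adj_rel E ^^ dist v" if "v \<in> V" for v
    unfolding dist_def using rtrancl_imp_relpow[OF conn[OF r that]] by (rule LeastI_ex)
  have dist_le: "dist v \<le> n" if "(r, v) \<in> adj_rel E ^^ n" for v n
    unfolding dist_def using that by (rule Least_le)
  have ex: "\<exists>u. u \<in> V \<and> {u, v} \<in> E \<and> dist v = Suc (dist u)" if v: "v \<in> V" "v \<noteq> r" for v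
  proof -
    obtain m where m: "dist v = Suc m"
      using dist[OF v(1)] v(2) by (cases "dist v") auto
    then obtain u where u: "(r, u) \<in> adj_rel E ^^ m" "(u, v) \<in> adj_rel E"
      using dist[OF v(1)] by auto
    have uE: "{u, v} \<in> E" "u \<noteq> v" using u by (auto simp: adj_rel_def)
    then have uV: "u \<in> V" using ed[OF uE(1)] by (auto simp: doubleton_eq_iff)
    have "(r, v) \<in> adj_rel E ^^ Suc (dist u)" using dist[OF uV] u(2) by auto
    then have "dist v \<le> Suc (dist u)" by (rule dist_le)
    moreover have "dist u \<le> m" using u(1) by (rule dist_le)
    ultimately have "dist v = Suc (dist u)" using m by auto
    then show ?thesis using uE uV by blast
  qed
  define p where "p v = (if v \<in> V \<and> v \<noteq> r then SOME u. u \<in> V \<and> {u, v} \<in> E \<and> dist v = Suc (dist u) else r)" for v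
  have p: "p v \<in> V" "{p v, v} \<in> E" "dist v = Suc (dist (p v))" if "v \<in> V" "v \<noteq> r" for v
    using someI_ex[OF ex[OF that]] that by (auto simp: p_def)
  have pr: "p r = r" by (simp add: p_def)
  have "rooted_tree V r p dist"
  proof
    show "p v \<in> V" if "v \<in> V" for v using p(1)[of v] that r pr by (cases "v = r") simp_all
    show "dist v = Suc (dist (p v))" if "v \<in> V" "v \<noteq> r" for v using p(3)[OF that] .
  qed (fact fin r pr)+
  \<comment> \<open>Acyclicity enters here, through the edge count: the parent edges are
    \<open>card V - 1\<close> distinct edges of \<open>E\<close>, hence all of them.\<close>
  moreover have "(\<lambda>v. {p v, v}) ` (V - {r}) = E"
  proof (rule card_subset_eq)
    have "E \<subseteq> Pow V" using ed by fastforce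
    then show "finite E" using fin finite_subset by auto
    show "(\<lambda>v. {p v, v}) ` (V - {r}) \<subseteq> E" using p by auto
    have "inj_on (\<lambda>v. {p v, v}) (V - {r})"
    proof (rule inj_onI)
      fix x y assume xy: "x \<in> V - {r}" "y \<in> V - {r}" "{p x, x} = {p y, y}"
      show "x = y"
      proof (rule ccontr)
        assume "x \<noteq> y"
        then have "x = p y" "y = p x" using xy by (auto simp: doubleton_eq_iff)
        then show False using p(3)[of x] p(3)[of y] xy by auto
      qed
    qed
    then have "card ((\<lambda>v. {p v, v}) ` (V - {r})) = card (V - {r})" by (rule card_image)
    then show "card ((\<lambda>v. {p v, v}) ` (V - {r})) = card E" using cE r fin by simp
  qed
  ultimately show thesis using that by blast
qed

text \<open>A cyclic interval that avoids the residue 0 cannot wrap around, so it is an interval in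
  the usual order.\<close>

lemma cyclic_interval_convex:
  assumes "cyclic_interval m S" "0 \<notin> S" "a \<in> S" "c \<in> S" "a \<le> b" "b \<le> c" "m > 0"
  shows "b \<in> S"
proof -
  obtain s k where S: "S = {(s + i) mod m | i. i < k}" using assms by (auto simp: cyclic_interval_def)
  define t where "t = s mod m"
  have S: "S = {(t + i) mod m | i. i < k}" unfolding S t_def by (simp add: mod_simps)
  have tm: "t < m" unfolding t_def using assms by simp
  have lt: "t + i < m" if "i < k" for i
  proof (rule ccontr)
    assume "\<not> t + i < m"
    then have "m - t < k" "(t + (m - t)) mod m = 0" using tm that by auto
    then have "0 \<in> S" unfolding S by (metis (mono_tags, lifting) mem_Collect_eq)
    then show False using assms by simp
  qed
  have S: "S = {t + i | i. i < k}" unfolding S using lt by (metis (no_types, lifting) mod_less)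
  obtain i j where "a = t + i" "c = t + j" "i < k" "j < k" using assms unfolding S by auto
  then show ?thesis unfolding S using assms by (auto intro!: exI[of _ "b - t"])
qed

text \<open>Once the root with its label 0 is set aside, planarity says that each subtree carries an
  ordinary interval of the labels 1 to \<open>d\<close>. The assumption
  \<open>card_root_children\<close> expresses that the root is an end, \<open>card_children\<close>
  that no vertex has valence 2.\<close>

locale planar_tree = rooted_tree V r p h for V :: "'v set" and r p h +
  fixes d :: nat and lab :: "'v \<Rightarrow> nat"
  assumes lab_bij: "bij_betw lab leaves {1..d}"
    and card_root_children: "card (children r) = 1"
    and card_children: "v \<in> V \<Longrightarrow> v \<noteq> r \<Longrightarrow> v \<notin> leaves \<Longrightarrow> card (children v) \<ge> 2"
    and convex: "v \<in> V \<Longrightarrow> v \<noteq> r \<Longrightarrow> a \<in> lab ` (leaves \<inter> desc v) \<Longrightarrow> c \<in> lab ` (leaves \<inter> desc v)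
       \<Longrightarrow> a \<le> b \<Longrightarrow> b \<le> c \<Longrightarrow> b \<in> lab ` (leaves \<inter> desc v)"

lemma marked_ribbon_tree_planar:
  assumes M: "marked_ribbon_tree d V E lab"
  obtains r p h where "planar_tree V r p h d lab" "E = (\<lambda>v. {p v, v}) ` (V - {r})"
    "lab r = 0" "r \<in> tree_ends V E"
    "tree_ends V E = insert r (rooted_tree.leaves V r p)"
    "tree_branch V E = V - {r} - rooted_tree.leaves V r p"
    "\<And>v. v \<in> tree_branch V E \<Longrightarrow> valence E v = card (rooted_tree.children V r p v) + 1"
proof -
  have T: "is_finite_tree V E" and Vu: "V = tree_ends V E \<union> tree_branch V E"
    and bij: "bij_betw lab (tree_ends V E) {..d}"
    and cyc: "\<And>x y. {x, y} \<in> E \<Longrightarrow> cyclic_interval (d + 1) (lab ` ends_side V E {x, y} x)"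
    using M unfolding marked_ribbon_tree_def by blast+
  have "0 \<in> lab ` tree_ends V E" using bij by (auto simp: bij_betw_def)
  then obtain r where r: "r \<in> tree_ends V E" "lab r = 0" by force
  then have rV: "r \<in> V" by (auto simp: tree_ends_def)
  obtain p h where RT: "rooted_tree V r p h" and E: "E = (\<lambda>v. {p v, v}) ` (V - {r})"
    using finite_tree_rooted[OF T rV] by metis
  interpret rooted_tree V r p h by fact
  have val: "valence E v = card (children v) + (if v = r then 0 else 1)" if "v \<in> V" for v
    unfolding E using valence_children[OF that] .
  have ends: "tree_ends V E = insert r leaves"
    using r val finite_children by (auto simp: tree_ends_def leaves_def)
  have branch: "tree_branch V E = V - {r} - leaves"
  proof -
    have "tree_ends V E \<inter> tree_branch V E = {}" by (auto simp: tree_ends_def tree_branch_def)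
    then show ?thesis using Vu ends by auto
  qed
  have rl: "r \<notin> leaves" by (simp add: leaves_def)
  have "planar_tree V r p h d lab"
  proof
    have "bij_betw lab (insert r leaves - {r}) ({..d} - {lab r})"
      using bij r by (intro bij_betw_DiffI) (auto simp: ends bij_betw_def)
    moreover have "{..d} - {lab r} = {1..d}" using r by auto
    ultimately show "bij_betw lab leaves {1..d}" using rl by (simp add: insert_Diff_if)
    show "card (children r) = 1" using val[OF rV] r by (simp add: tree_ends_def)
    show "card (children v) \<ge> 2" if "v \<in> V" "v \<noteq> r" "v \<notin> leaves" for v
    proof -
      have "v \<in> tree_branch V E" using that branch by blast
      then have "valence E v \<ge> 3" by (simp add: tree_branch_def)
      then show ?thesis using val[OF that(1)] that(2) by simp
    qed
    fix v a b c assume v: "v \<in> V" "v \<noteq> r" and ac: "a \<in> lab ` (leaves \<inter> desc v)"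
      "c \<in> lab ` (leaves \<inter> desc v)" "a \<le> b" "b \<le> c"
    have "ends_side V E {v, p v} v = insert r leaves \<inter> desc v"
      unfolding ends_side_def ends using reach_desc[OF v] unfolding E[symmetric] by auto
    then have "ends_side V E {v, p v} v = leaves \<inter> desc v"
      using desc_root_eq v by auto
    moreover have "{v, p v} \<in> E" using v by (auto simp: E)
    ultimately have ci: "cyclic_interval (d + 1) (lab ` (leaves \<inter> desc v))"
      using cyc[of v "p v"] by simp
    have "0 \<notin> lab ` leaves"
    proof
      assume "0 \<in> lab ` leaves"
      then obtain w where "w \<in> leaves" "lab w = lab r" using r by auto
      then have "w = r" using bij unfolding ends bij_betw_def inj_on_def by blast
      then show False using \<open>w \<in> leaves\<close> rl by simp
    qed
    then have "0 \<notin> lab ` (leaves \<inter> desc v)" by auto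
    then show "b \<in> lab ` (leaves \<inter> desc v)"
      using cyclic_interval_convex[OF ci _ ac] by auto
  qed
  moreover have "valence E v = card (children v) + 1" if "v \<in> tree_branch V E" for v
    using val[of v] that branch by simp
  ultimately show thesis using that[OF _ E r(2,1) ends branch] by blast
qed

section \<open>Positions of the ends and branch points on the line\<close>

lemma exit_index:
  fixes j k :: nat
  assumes "j \<le> k" "P j" "\<not> P k"
  obtains i where "j \<le> i" "i < k" "P i" "\<not> P (Suc i)"
proof -
  have "\<exists>i. j \<le> i \<and> i < k \<and> P i \<and> \<not> P (Suc i)"
    using assms by (induction rule: dec_induct) (metis le_refl less_Suc_eq less_SucI)+
  then show thesis using that by blast
qed

context planar_tree
begin

definition below :: "'v \<Rightarrow> nat set" where
  "below v = lab ` (leaves \<inter> desc v)"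

definition lo :: "'v \<Rightarrow> nat" where
  "lo v = Min (below v)"

definition leaf :: "nat \<Rightarrow> 'v" where
  "leaf = inv_into leaves lab"

lemma leaf: "j \<in> {1..d} \<Longrightarrow> leaf j \<in> leaves" "j \<in> {1..d} \<Longrightarrow> lab (leaf j) = j"
  using lab_bij unfolding leaf_def bij_betw_def by (auto simp: inv_into_into f_inv_into_f)

lemma leaf_lab: "v \<in> leaves \<Longrightarrow> leaf (lab v) = v" "v \<in> leaves \<Longrightarrow> lab v \<in> {1..d}"
  using lab_bij unfolding leaf_def bij_betw_def by (auto simp: inv_into_f_f)

lemma mem_below: "j \<in> below v \<longleftrightarrow> j \<in> {1..d} \<and> leaf j \<in> desc v"
proof
  assume "j \<in> below v"
  then obtain w where "w \<in> leaves" "w \<in> desc v" "j = lab w" by (auto simp: below_def)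
  then show "j \<in> {1..d} \<and> leaf j \<in> desc v" using leaf_lab by simp
next
  assume j: "j \<in> {1..d} \<and> leaf j \<in> desc v"
  then show "j \<in> below v" using leaf[of j] by (auto simp: below_def intro!: image_eqI[of j lab "leaf j"])
qed

lemma below_subset: "below v \<subseteq> {1..d}"
  using mem_below by auto

lemma below_le: "j \<in> below v \<Longrightarrow> 1 \<le> j" "j \<in> below v \<Longrightarrow> j \<le> d"
  using mem_below by auto

lemma finite_below: "finite (below v)"
  using below_subset finite_subset by blast

lemma below_mono: "v \<in> desc u \<Longrightarrow> below v \<subseteq> below u"
  using desc_trans mem_below by blast

lemma below_comparable: "j \<in> below u \<Longrightarrow> j \<in> below v \<Longrightarrow> u \<in> desc v \<or> v \<in> desc u"
  using desc_comparable mem_below by blast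

lemma leaves_in: "v \<in> leaves \<Longrightarrow> v \<in> V" "v \<in> leaves \<Longrightarrow> v \<noteq> r"
  by (auto simp: leaves_def)

lemma below_root: "below r = {1..d}"
  using mem_below[of _ r] leaf leaves_in(1) unfolding desc_root by blast

lemma desc_leaf: "v \<in> leaves \<Longrightarrow> desc v = {v}"
proof -
  assume v: "v \<in> leaves"
  have "w = v" if w: "w \<in> desc v" for w
  proof (rule ccontr)
    assume "w \<noteq> v"
    with w obtain c where "c \<in> children v" by (rule desc_child)
    then show False using v by (auto simp: leaves_def)
  qed
  then show "desc v = {v}" using desc_refl[of v] leaves_in v by auto
qed

lemma below_leaf: "v \<in> leaves \<Longrightarrow> below v = {lab v}"
  by (simp add: below_def desc_leaf)

lemma below_convex:
  assumes "v \<in> V" "a \<in> below v" "c \<in> below v" "a \<le> b" "b \<le> c"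
  shows "b \<in> below v"
proof (cases "v = r")
  case True
  then show ?thesis using assms by (auto simp: below_root)
next
  case False
  then show ?thesis using convex[of v a c b] assms by (simp add: below_def)
qed

lemma lo_in:
  assumes "v \<in> V" "v \<noteq> r"
  shows "lo v \<in> below v"
proof -
  obtain w where "w \<in> leaves" "w \<in> desc v" using leaf_exists[OF assms] .
  then have "below v \<noteq> {}" by (auto simp: below_def)
  then show ?thesis unfolding lo_def using finite_below by (rule Min_in[rotated])
qed

lemma lo_le: "j \<in> below v \<Longrightarrow> lo v \<le> j"
  unfolding lo_def using finite_below by simp

lemma lo_leaf: "v \<in> leaves \<Longrightarrow> lo v = lab v"
  by (simp add: lo_def below_leaf)

text \<open>Height of the last common ancestor of the consecutive ends \<open>i\<close> and
  \<open>Suc i\<close>; the common ancestors form a chain, so the maximal height singles it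
  out.\<close>

definition gap_depth :: "nat \<Rightarrow> nat" where
  "gap_depth i = Max (h ` {v \<in> V. i \<in> below v \<and> Suc i \<in> below v})"

lemma gap_depth_ge:
  assumes "v \<in> V" "i \<in> below v" "Suc i \<in> below v"
  shows "h v \<le> gap_depth i"
  unfolding gap_depth_def using assms finite_V by (intro Max_ge) auto

text \<open>The last common ancestor of the two ends is comparable with \<open>v\<close>, since both
  lie above a common end, and it is not below \<open>v\<close>, since \<open>v\<close> misses one of
  the two ends.\<close>

lemma gap_depth_less:
  assumes v: "v \<in> V" and i: "i \<in> {1..d}" "Suc i \<in> {1..d}"
    and one: "(i \<in> below v) \<noteq> (Suc i \<in> below v)"
  shows "gap_depth i < h v"
proof -
  let ?S = "{v \<in> V. i \<in> below v \<and> Suc i \<in> below v}"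
  have "r \<in> ?S" using i root_in by (simp add: below_root)
  then have "?S \<noteq> {}" by blast
  then have "gap_depth i \<in> h ` ?S" unfolding gap_depth_def using finite_V by (intro Max_in) auto
  then obtain u where u: "u \<in> V" "i \<in> below u" "Suc i \<in> below u" "gap_depth i = h u" by auto
  have "u \<in> desc v \<or> v \<in> desc u" using below_comparable u one by blast
  moreover have "u \<notin> desc v" using below_mono[of u v] u one by auto
  ultimately show ?thesis using height_desc[of v u] desc_refl v u by auto
qed

definition xpos :: "real \<Rightarrow> nat \<Rightarrow> real" where
  "xpos \<epsilon> j = (\<Sum>i\<in>{1..<j}. \<epsilon> ^ gap_depth i)"

lemma xpos_diff: "1 \<le> j \<Longrightarrow> j \<le> k \<Longrightarrow> xpos \<epsilon> k - xpos \<epsilon> j = (\<Sum>i\<in>{j..<k}. \<epsilon> ^ gap_depth i)"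
  unfolding xpos_def using sum.atLeastLessThan_concat[of 1 j k "\<lambda>i. \<epsilon> ^ gap_depth i"] by simp

lemma xpos_less:
  assumes "\<epsilon> > 0" "1 \<le> j" "j < k"
  shows "xpos \<epsilon> j < xpos \<epsilon> k"
proof -
  have "0 < (\<Sum>i\<in>{j..<k}. \<epsilon> ^ gap_depth i)" using assms by (intro sum_pos) auto
  then show ?thesis using xpos_diff[of j k \<epsilon>] assms by simp
qed

text \<open>Every gap between ends below \<open>v\<close> has depth at least \<open>h v\<close>, and
  there are at most \<open>d\<close> of them.\<close>

lemma xpos_near:
  assumes "0 < \<epsilon>" "\<epsilon> \<le> 1" "v \<in> V" "j \<in> below v" "k \<in> below v"
  shows "\<bar>xpos \<epsilon> k - xpos \<epsilon> j\<bar> \<le> real d * \<epsilon> ^ h v"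
proof -
  have *: "\<bar>xpos \<epsilon> k - xpos \<epsilon> j\<bar> \<le> real d * \<epsilon> ^ h v" if "j \<in> below v" "k \<in> below v" "j \<le> k" for j k
  proof -
    have jk: "1 \<le> j" "k \<le> d" using that below_le by blast+
    have "xpos \<epsilon> k - xpos \<epsilon> j = (\<Sum>i\<in>{j..<k}. \<epsilon> ^ gap_depth i)" using xpos_diff that jk by simp
    moreover have "\<dots> \<le> (\<Sum>i\<in>{j..<k}. \<epsilon> ^ h v)"
    proof (intro sum_mono power_decreasing gap_depth_ge)
      fix i assume "i \<in> {j..<k}"
      then show "i \<in> below v" "Suc i \<in> below v" using below_convex[OF assms(3) that(1,2)] by auto
    qed (use assms in auto)
    moreover have "(\<Sum>i\<in>{j..<k}. \<epsilon> ^ h v) \<le> real d * \<epsilon> ^ h v"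
      using assms jk by (auto intro!: mult_right_mono)
    moreover have "0 \<le> (\<Sum>i\<in>{j..<k}. \<epsilon> ^ gap_depth i)" using assms by (intro sum_nonneg) auto
    ultimately show ?thesis by simp
  qed
  show ?thesis
    using *[of j k] *[of k j] assms(4,5) by (cases "j \<le> k") (auto simp: abs_minus_commute)
qed

text \<open>Between \<open>j\<close> and \<open>k\<close> the interval \<open>below v\<close> is
  left across some gap, whose depth is less than \<open>h v\<close>. This single summand already
  exceeds the scale of \<open>v\<close> by the factor \<open>1 / \<epsilon>\<close>.\<close>

lemma xpos_far:
  assumes \<epsilon>: "0 < \<epsilon>" "\<epsilon> \<le> 1" and v: "v \<in> V" and j: "j \<in> below v" and k: "k \<in> {1..d} - below v"
  shows "\<epsilon> ^ h v \<le> \<epsilon> * \<bar>xpos \<epsilon> k - xpos \<epsilon> j\<bar>"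
proof -
  have j1: "j \<in> {1..d}" using below_le[OF j] by simp
  have "\<exists>i a b. {a, b} = {j, k} \<and> 1 \<le> a \<and> a \<le> i \<and> i < b \<and> b \<le> d \<and> (i \<in> below v) \<noteq> (Suc i \<in> below v)"
  proof (cases "j \<le> k")
    case True
    obtain i where "j \<le> i" "i < k" "i \<in> below v" "Suc i \<notin> below v"
      using exit_index[OF True, of "\<lambda>i. i \<in> below v"] j k by auto
    then show ?thesis using j1 k by (intro exI[of _ i] exI[of _ j] exI[of _ k]) auto
  next
    case False
    obtain i where "k \<le> i" "i < j" "i \<notin> below v" "Suc i \<in> below v"
      using exit_index[of k j "\<lambda>i. i \<notin> below v"] False j k by auto
    then show ?thesis using j1 k by (intro exI[of _ i] exI[of _ k] exI[of _ j]) auto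
  qed
  then obtain i a b where i: "{a, b} = {j, k}" "1 \<le> a" "a \<le> i" "i < b" "b \<le> d"
    "(i \<in> below v) \<noteq> (Suc i \<in> below v)" by auto
  have "gap_depth i < h v" using gap_depth_less[OF v] i by auto
  then have "\<epsilon> ^ h v \<le> \<epsilon> ^ Suc (gap_depth i)" using \<epsilon> by (intro power_decreasing) auto
  also have "\<dots> = \<epsilon> * \<epsilon> ^ gap_depth i" by simp
  also have "\<epsilon> ^ gap_depth i \<le> (\<Sum>i\<in>{a..<b}. \<epsilon> ^ gap_depth i)"
    using i \<epsilon> by (intro member_le_sum) auto
  also have "\<dots> = xpos \<epsilon> b - xpos \<epsilon> a" using xpos_diff i by auto
  also have "\<dots> \<le> \<bar>xpos \<epsilon> k - xpos \<epsilon> j\<bar>" using i(1) by (auto simp: doubleton_eq_iff)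
  finally show ?thesis using \<epsilon> by simp
qed

text \<open>Limit position of the end \<open>j\<close> in the picture rescaled at \<open>v\<close>:
  after division by \<open>\<epsilon> ^ h v\<close> a gap of depth \<open>h v\<close> has length 1
  and each deeper gap shrinks to 0.\<close>

definition cluster :: "'v \<Rightarrow> nat \<Rightarrow> nat" where
  "cluster v j = card {i \<in> {lo v..<j}. gap_depth i = h v}"

lemma gap_depth_below:
  assumes "v \<in> V" "v \<noteq> r" "j \<in> below v" "i \<in> {lo v..<j}"
  shows "h v \<le> gap_depth i"
  using assms below_convex[OF assms(1) lo_in[OF assms(1,2)] assms(3)]
  by (intro gap_depth_ge) auto

lemma cluster_tendsto:
  assumes v: "v \<in> V" "v \<noteq> r" and j: "j \<in> below v"
    and e: "(\<epsilon> \<longlongrightarrow> 0) F" "\<forall>\<^sub>F n in F. \<epsilon> n > 0"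
  shows "((\<lambda>n. (xpos (\<epsilon> n) j - xpos (\<epsilon> n) (lo v)) / \<epsilon> n ^ h v) \<longlongrightarrow> real (cluster v j)) F"
proof -
  have lo: "1 \<le> lo v" "lo v \<le> j" using below_le[OF lo_in[OF v]] lo_le[OF j] by auto
  have ge: "h v \<le> gap_depth i" if "i \<in> {lo v..<j}" for i
    using gap_depth_below[OF v j that] .
  have "((\<lambda>n. \<Sum>i\<in>{lo v..<j}. \<epsilon> n ^ (gap_depth i - h v)) \<longlongrightarrow>
      (\<Sum>i\<in>{lo v..<j}. if gap_depth i = h v then 1 else 0)) F"
  proof (intro tendsto_sum)
    fix i assume i: "i \<in> {lo v..<j}"
    have "((\<lambda>n. \<epsilon> n ^ (gap_depth i - h v)) \<longlongrightarrow> 0 ^ (gap_depth i - h v)) F"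
      using e by (intro tendsto_intros)
    then show "((\<lambda>n. \<epsilon> n ^ (gap_depth i - h v)) \<longlongrightarrow> (if gap_depth i = h v then 1 else 0)) F"
      using ge[OF i] by (auto simp: power_0_left)
  qed
  also have "(\<Sum>i\<in>{lo v..<j}. if gap_depth i = h v then 1 else 0) = real (cluster v j)"
    by (simp add: cluster_def sum.If_cases Int_def)
  finally show ?thesis
  proof (rule Lim_transform_eventually)
    show "\<forall>\<^sub>F n in F. (\<Sum>i\<in>{lo v..<j}. \<epsilon> n ^ (gap_depth i - h v)) =
      (xpos (\<epsilon> n) j - xpos (\<epsilon> n) (lo v)) / \<epsilon> n ^ h v"
      using e(2)
    proof eventually_elim
      case (elim n)
      show ?case unfolding xpos_diff[OF lo] sum_divide_distrib
        using elim ge by (intro sum.cong refl) (simp add: power_diff)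
    qed
  qed
qed

text \<open>Ends under the same child are separated only by deeper gaps and collapse to one limit;
  passing from one child to another crosses a gap of depth exactly \<open>h v\<close>. With the
  marked end at infinity this makes as many limit points as the valence of \<open>v\<close>.\<close>

lemma card_cluster:
  assumes v: "v \<in> V" "v \<noteq> r" "v \<notin> leaves"
  shows "card (cluster v ` below v) = card (children v)"
proof -
  have ch: "c \<in> V" "c \<noteq> r" "h c = Suc (h v)" "below c \<subseteq> below v" if "c \<in> children v" for c
    using that height_parent[of c] children_desc[OF that] below_mono by (auto simp: children_def)
  have same: "cluster v j = cluster v k" if "c \<in> children v" "j \<in> below c" "k \<in> below c" "j \<le> k" for c j k
  proof -
    have "gap_depth i \<noteq> h v" if "i \<in> {j..<k}" for i
      using gap_depth_ge[of c i] below_convex[of c j k] \<open>c \<in> children v\<close> \<open>j \<in> below c\<close> \<open>k \<in> below c\<close> ch that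
      by fastforce
    then have "i < j" if "i < k" "gap_depth i = h v" for i
      using that by (metis atLeastLessThan_iff not_less)
    then have "{i \<in> {lo v..<j}. gap_depth i = h v} = {i \<in> {lo v..<k}. gap_depth i = h v}"
      using \<open>j \<le> k\<close> by auto
    then show ?thesis by (simp add: cluster_def)
  qed
  have diff: "cluster v j < cluster v k"
    if c: "c \<in> children v" "j \<in> below c" "k \<in> below v - below c" "j \<le> k" for c j k
  proof -
    obtain i where i: "j \<le> i" "i < k" "i \<in> below c" "Suc i \<notin> below c"
      using exit_index[OF c(4), of "\<lambda>i. i \<in> below c"] c by auto
    have jv: "j \<in> below v" using c ch(4) by blast
    have lj: "lo v \<le> j" using lo_le jv .
    have "gap_depth i < h c" using i ch(1)[OF c(1)] below_le[of i c] below_le[of k v] c(3)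
      by (intro gap_depth_less) auto
    moreover have "h v \<le> gap_depth i"
      using gap_depth_below[OF v(1,2), of k i] c i lj by auto
    ultimately have "gap_depth i = h v" using ch c by auto
    then have "i \<in> {i \<in> {lo v..<k}. gap_depth i = h v} - {i \<in> {lo v..<j}. gap_depth i = h v}"
      using i lj by auto
    then have "{i \<in> {lo v..<j}. gap_depth i = h v} \<subset> {i \<in> {lo v..<k}. gap_depth i = h v}"
      using c by auto
    then show ?thesis unfolding cluster_def by (intro psubset_card_mono) auto
  qed
  have "bij_betw (\<lambda>c. cluster v (lo c)) (children v) (cluster v ` below v)"
  proof (intro bij_betw_imageI inj_onI)
    fix c c' assume cc: "c \<in> children v" "c' \<in> children v" "cluster v (lo c) = cluster v (lo c')"
    show "c = c'"
    proof (rule ccontr)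
      assume ne: "c \<noteq> c'"
      have dj: "below c \<inter> below c' = {}"
        using children_disjoint[OF cc(1,2)] ne by (auto simp: mem_below)
      have l: "lo c \<in> below c" "lo c' \<in> below c'" using lo_in ch cc by auto
      have "lo c \<in> below v - below c'" "lo c' \<in> below v - below c"
        using l dj ch(4)[OF cc(1)] ch(4)[OF cc(2)] by auto
      moreover have "lo c' \<le> lo c" if "\<not> lo c \<le> lo c'" using that by simp
      ultimately show False
        using diff[OF cc(1) l(1), of "lo c'"] diff[OF cc(2) l(2), of "lo c"] cc(3) less_irrefl by metis
    qed
  next
    show "(\<lambda>c. cluster v (lo c)) ` children v = cluster v ` below v"
    proof
      show "(\<lambda>c. cluster v (lo c)) ` children v \<subseteq> cluster v ` below v"
        using lo_in ch by blast
      show "cluster v ` below v \<subseteq> (\<lambda>c. cluster v (lo c)) ` children v"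
      proof
        fix y assume "y \<in> cluster v ` below v"
        then obtain j where j: "j \<in> below v" "y = cluster v j" by auto
        then have "leaf j \<in> desc v" "leaf j \<noteq> v" using mem_below leaf v by auto
        then obtain c where c: "c \<in> children v" "leaf j \<in> desc c" by (rule desc_child)
        then have jc: "j \<in> below c" using j mem_below by auto
        have "cluster v (lo c) = cluster v j"
          using same[OF c(1) _ jc] lo_in ch c(1) lo_le[OF jc] by auto
        then show "y \<in> (\<lambda>c. cluster v (lo c)) ` children v" using j c by force
      qed
    qed
  qed
  then show ?thesis using bij_betw_same_card by metis
qed

end

section \<open>Hyperbolic geodesics and half-planes in the disk\<close>

lemma moeb_denom_nz:
  assumes "norm p < 1" "norm z \<le> 1"
  shows "1 + cnj p * z \<noteq> 0" "1 - cnj p * z \<noteq> 0"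
proof -
  have "norm (cnj p * z) < 1"
    using assms mult_mono[of "norm p" "norm p" "norm z" 1] by (simp add: norm_mult)
  then show "1 + cnj p * z \<noteq> 0" "1 - cnj p * z \<noteq> 0"
    by (auto simp: add_eq_0_iff)
qed

lemma moeb_norm_identity:
  assumes "1 + cnj p * z \<noteq> 0"
  shows "1 - (norm (moeb p z))\<^sup>2 = (1 - (norm p)\<^sup>2) * (1 - (norm z)\<^sup>2) / (norm (1 + cnj p * z))\<^sup>2"
proof -
  have "(norm (1 + cnj p * z))\<^sup>2 - (norm (z + p))\<^sup>2 = (1 - (norm p)\<^sup>2) * (1 - (norm z)\<^sup>2)"
    unfolding cmod_power2 by (simp add: power2_eq_square algebra_simps)
  moreover have "(norm (1 + cnj p * z))\<^sup>2 \<noteq> 0" using assms by simp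
  ultimately show ?thesis
    by (simp add: moeb_def norm_divide power_divide divide_simps)
qed

lemma moeb_ball: "norm p < 1 \<Longrightarrow> norm z < 1 \<Longrightarrow> norm (moeb p z) < 1"
proof -
  assume p: "norm p < 1" and z: "norm z < 1"
  have "0 < (1 - (norm p)\<^sup>2) * (1 - (norm z)\<^sup>2) / (norm (1 + cnj p * z))\<^sup>2"
    using p z moeb_denom_nz[of p z] by (intro divide_pos_pos mult_pos_pos) (auto simp: abs_square_less_1)
  then have "(norm (moeb p z))\<^sup>2 < 1"
    using moeb_norm_identity[of p z] moeb_denom_nz[of p z] p z by auto
  then show "norm (moeb p z) < 1" by (simp add: abs_square_less_1)
qed

lemma moeb_cball: "norm p < 1 \<Longrightarrow> norm z \<le> 1 \<Longrightarrow> norm (moeb p z) \<le> 1"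
proof -
  assume p: "norm p < 1" and z: "norm z \<le> 1"
  have "0 \<le> (1 - (norm p)\<^sup>2) * (1 - (norm z)\<^sup>2) / (norm (1 + cnj p * z))\<^sup>2"
    using p z by (intro divide_nonneg_nonneg mult_nonneg_nonneg) (auto simp: abs_square_le_1)
  then have "(norm (moeb p z))\<^sup>2 \<le> 1"
    using moeb_norm_identity[of p z] moeb_denom_nz[of p z] p z by auto
  then show "norm (moeb p z) \<le> 1" by (simp add: abs_square_le_1)
qed

lemma moeb_inverse:
  assumes "norm p < 1" "norm q \<le> 1"
  shows "moeb p (moeb (- p) q) = q"
proof -
  have 1: "1 - cnj p * q \<noteq> 0" using moeb_denom_nz assms by auto
  have 2: "1 - cnj p * p \<noteq> 0" using moeb_denom_nz[of p p] assms by auto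
  have 3: "1 + cnj p * ((q - p) / (1 - cnj p * q)) = (1 - cnj p * p) / (1 - cnj p * q)"
    using 1 by (simp add: field_simps)
  have 4: "(q - p) / (1 - cnj p * q) + p = q * (1 - cnj p * p) / (1 - cnj p * q)"
    using 1 by (simp add: field_simps)
  show ?thesis unfolding moeb_def using 1 2 3 4 by simp
qed

lemma geo_open_alt: "geo_open p q = {moeb p (of_real s * moeb (- p) q) | s. 0 < s \<and> s < 1}"
  by (simp add: geo_open_def moeb_def)

lemma moeb_minus_cball: "norm p < 1 \<Longrightarrow> norm z \<le> 1 \<Longrightarrow> norm (moeb (- p) z) \<le> 1"
  using moeb_cball[of "- p" z] by simp

lemma geo_open_in_ball:
  assumes "norm p < 1" "norm q \<le> 1" "z \<in> geo_open p q"
  shows "norm z < 1"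
proof -
  obtain s where s: "0 < s" "s < 1" "z = moeb p (of_real s * moeb (- p) q)"
    using assms(3) by (auto simp: geo_open_alt)
  have "norm (of_real s * moeb (- p) q) \<le> s * 1"
    using moeb_minus_cball[OF assms(1,2)] s by (simp add: norm_mult mult_left_le)
  then show ?thesis using moeb_ball[OF assms(1)] s by fastforce
qed

text \<open>The change of centre from \<open>p\<close> to \<open>q\<close> is a disk automorphism
  that takes \<open>a\<close> to 0, hence \<open>moeb (- a)\<close> followed by a rotation. The
  explicit form serves to reverse geodesic segments.\<close>

lemma moeb_compose:
  assumes p: "norm p < 1" and q: "norm q < 1" and z: "norm z < 1"
  defines "a \<equiv> moeb (- p) q"
  shows "moeb (- q) (moeb p z) = (1 + p * cnj a) / (1 + cnj p * a) * ((z - a) / (1 - cnj a * z))"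
proof -
  have na: "norm a < 1" unfolding a_def using moeb_ball[of "- p" q] p q by simp
  have qa: "q = (a + p) / (1 + cnj p * a)"
    using moeb_inverse[OF p less_imp_le[OF q]] by (simp add: a_def moeb_def)
  have n: "1 + cnj p * a \<noteq> 0" "1 + cnj p * z \<noteq> 0" "1 - cnj a * z \<noteq> 0" "1 - cnj p * p \<noteq> 0"
    "1 + p * cnj a \<noteq> 0"
    using moeb_denom_nz[of p a] moeb_denom_nz[of p z] moeb_denom_nz[of a z] moeb_denom_nz[of p p]
      moeb_denom_nz[of "cnj p" "cnj a"] p na z by auto
  let ?w = "(z + p) / (1 + cnj p * z)"
  have num: "?w - q = (1 - cnj p * p) * (z - a) / ((1 + cnj p * z) * (1 + cnj p * a))"
    unfolding qa using n by (simp add: divide_simps) (simp add: algebra_simps)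
  have cq: "cnj q = (cnj a + cnj p) / (1 + p * cnj a)" unfolding qa by simp
  have den: "1 - cnj q * ?w = (1 - cnj p * p) * (1 - cnj a * z) / ((1 + cnj p * z) * (1 + p * cnj a))"
    unfolding cq using n by (simp add: divide_simps) (simp add: algebra_simps)
  have "moeb (- q) (moeb p z) = (?w - q) / (1 - cnj q * ?w)" by (simp add: moeb_def)
  also have "\<dots> = (1 + p * cnj a) / (1 + cnj p * a) * ((z - a) / (1 - cnj a * z))"
    unfolding num den using n by (simp add: divide_simps)
  finally show ?thesis .
qed

lemma geo_open_commute:
  assumes p: "norm p < 1" and q: "norm q < 1"
  shows "geo_open p q \<subseteq> geo_open q p"
proof
  fix z assume "z \<in> geo_open p q"
  then obtain s where s: "0 < s" "s < 1" "z = moeb p (of_real s * moeb (- p) q)"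
    by (auto simp: geo_open_alt)
  define a where "a = moeb (- p) q"
  define k where "k = (1 + p * cnj a) / (1 + cnj p * a)"
  have na: "norm a < 1" unfolding a_def using moeb_ball[of "- p" q] p q by simp
  have sa: "norm (of_real s * a) < 1"
    using na s mult_strict_mono[of s 1 "norm a" 1] by (simp add: norm_mult mult_le_one)
  have zb: "norm z < 1" using s(3) moeb_ball[OF p sa] by (simp add: a_def)
  have aa: "cnj a * a = of_real ((norm a)\<^sup>2)" by (simp add: complex_norm_square[symmetric] mult.commute del: of_real_power)
  \<comment> \<open>Up to a common rotation, passing to the centre \<open>q\<close> takes
    \<open>s * a\<close> to \<open>(s * a - a) / (1 - s * (norm a)\<^sup>2)\<close>, which is
    \<open>- t * a\<close>, and takes 0, the point \<open>p\<close>, to \<open>- a\<close>. So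
    \<open>t\<close> is the parameter of the reversed segment.\<close>
  define t where "t = (1 - s) / (1 - s * (norm a)\<^sup>2)"
  have na2: "(norm a)\<^sup>2 < 1" using na by (simp add: abs_square_less_1)
  have lt: "s * (norm a)\<^sup>2 < s" using na2 s by simp
  then have lt1: "s * (norm a)\<^sup>2 < 1" using s by linarith
  have t: "0 < t" using s lt1 unfolding t_def by (intro divide_pos_pos) auto
  show "z \<in> geo_open q p"
  proof (cases "a = 0")
    case True
    then have "z = moeb p 0" using s by (simp add: a_def[symmetric])
    moreover have "q = moeb p 0" using moeb_inverse[OF p less_imp_le[OF q]] True by (simp add: a_def)
    ultimately have "z = p" "q = p" by (simp_all add: moeb_def)
    then have "z = moeb q (of_real (1/2) * moeb (- q) p)" by (simp add: moeb_def)
    then show ?thesis unfolding geo_open_alt by (intro CollectI exI[of _ "1/2"]) auto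
  next
    case False
    have t1: "t < 1" unfolding t_def using lt lt1 by simp
    have "moeb (- q) z = k * ((of_real s * a - a) / (1 - cnj a * (of_real s * a)))"
      using moeb_compose[OF p q sa] s(3) by (simp add: a_def k_def)
    also have "cnj a * (of_real s * a) = of_real (s * (norm a)\<^sup>2)"
      using aa by (simp add: algebra_simps)
    also have "(of_real s * a - a) / (1 - of_real (s * (norm a)\<^sup>2)) = of_real t * (- a)"
      using lt1 s by (simp add: t_def divide_simps) (simp add: algebra_simps)
    also have "k * (of_real t * (- a)) = of_real t * (k * (- a))" by simp
    also have "k * (- a) = moeb (- q) p"
      using moeb_compose[OF p q, of 0] by (simp add: a_def k_def moeb_def)
    finally have "moeb (- q) z = of_real t * moeb (- q) p" .
    then have "z = moeb q (of_real t * moeb (- q) p)"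
      using moeb_inverse[OF q less_imp_le[OF zb]] by simp
    then show ?thesis using t t1 unfolding geo_open_alt by blast
  qed
qed

text \<open>Seen from \<open>p\<close> both segments are radial. A common point puts their far ends
  on one ray, and the nearer of these ends then lies on the other segment. This excludes overlaps of
  edges at a common vertex.\<close>

lemma geo_open_same_ray:
  assumes p: "norm p < 1" and q: "norm q1 \<le> 1" "norm q2 \<le> 1"
    and z: "z \<in> geo_open p q1" "z \<in> geo_open p q2"
  shows "q1 = q2 \<or> (norm q1 < 1 \<and> q1 \<in> geo_open p q2) \<or> (norm q2 < 1 \<and> q2 \<in> geo_open p q1)"
proof -
  have key: "q1 = q2 \<or> (norm q1 < 1 \<and> q1 \<in> geo_open p q2)"
    if n: "norm q1 \<le> 1" "norm q2 \<le> 1" and s: "0 < s" "s < 1" and t: "0 < t" "t < 1" "t \<le> s"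
      and eq: "of_real s * moeb (- p) q1 = of_real t * moeb (- p) q2" for q1 q2 s t
  proof -
    have a1: "moeb (- p) q1 = of_real (t / s) * moeb (- p) q2"
      using eq s by (simp add: field_simps)
    have q1: "q1 = moeb p (of_real (t / s) * moeb (- p) q2)"
      using moeb_inverse[OF p n(1)] a1 by simp
    show ?thesis
    proof (cases "t = s")
      case True
      then show ?thesis using q1 s moeb_inverse[OF p n(2)] by simp
    next
      case False
      then have "0 < t / s" "t / s < 1" using s t by auto
      then have "q1 \<in> geo_open p q2" using q1 unfolding geo_open_alt by blast
      then show ?thesis using geo_open_in_ball[OF p n(2)] by blast
    qed
  qed
  obtain s where s: "0 < s" "s < 1" "z = moeb p (of_real s * moeb (- p) q1)"
    using z(1) by (auto simp: geo_open_alt)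
  obtain t where t: "0 < t" "t < 1" "z = moeb p (of_real t * moeb (- p) q2)"
    using z(2) by (auto simp: geo_open_alt)
  have inv: "moeb (- p) (moeb p w) = w" if "norm w \<le> 1" for w
    using moeb_inverse[of "- p" w] p that by simp
  have bd: "norm (of_real u * moeb (- p) x) \<le> 1" if "0 < u" "u < 1" "norm x \<le> 1" for u x
    using that moeb_minus_cball[OF p that(3)] by (simp add: norm_mult mult_le_one)
  have eq: "of_real s * moeb (- p) q1 = of_real t * moeb (- p) q2"
    using inv[OF bd[OF s(1,2) q(1)]] inv[OF bd[OF t(1,2) q(2)]] s(3) t(3) by metis
  show ?thesis
    using key[OF q s(1,2) t(1,2) _ eq] key[OF q(2,1) t(1,2) s(1,2) _ eq[symmetric]]
    by (cases "t \<le> s") auto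
qed

text \<open>Hyperbolic half-planes of the disk are the positivity sets of these functions.\<close>
definition half_form :: "real \<Rightarrow> complex \<Rightarrow> complex \<Rightarrow> real" where
  "half_form \<alpha> \<beta> z = \<alpha> * (1 + (norm z)\<^sup>2) + 2 * Re (cnj \<beta> * z)"

text \<open>Hyperbolic isometries permute half-planes, so the pull-back is a form of the same type
  after multiplication by the positive factor that clears the denominator. It allows a geodesic to
  be treated as if it started at the centre.\<close>

lemma half_form_moeb:
  obtains \<alpha>' \<beta>' where "\<And>z. 1 + cnj p * z \<noteq> 0 \<Longrightarrow>
     half_form \<alpha> \<beta> (moeb p z) * (norm (1 + cnj p * z))\<^sup>2 = half_form \<alpha>' \<beta>' z"
proof -
  define \<alpha>' where "\<alpha>' = \<alpha> * (1 + (norm p)\<^sup>2) + 2 * Re (cnj \<beta> * p)"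
  define \<beta>' where "\<beta>' = 2 * of_real \<alpha> * p + \<beta> + cnj \<beta> * p * p"
  have "half_form \<alpha> \<beta> (moeb p z) * (norm (1 + cnj p * z))\<^sup>2 = half_form \<alpha>' \<beta>' z"
    if nz: "1 + cnj p * z \<noteq> 0" for z
  proof -
    let ?d = "1 + cnj p * z"
    have nd: "(norm ?d)\<^sup>2 \<noteq> 0" using nz by simp
    have q: "(z + p) / ?d = (z + p) * cnj ?d / of_real ((norm ?d)\<^sup>2)"
      using nz by (metis complex_div_cnj of_real_power)
    have "Re (cnj \<beta> * ((z + p) / ?d)) * (norm ?d)\<^sup>2 = Re (cnj \<beta> * ((z + p) * cnj ?d))"
      unfolding q using nd by (simp add: Re_divide_of_real del: of_real_power)
    moreover have "(norm ((z + p) / ?d))\<^sup>2 * (norm ?d)\<^sup>2 = (norm (z + p))\<^sup>2"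
      using nd by (simp add: norm_divide power_divide)
    ultimately have "half_form \<alpha> \<beta> (moeb p z) * (norm ?d)\<^sup>2 =
      \<alpha> * ((norm ?d)\<^sup>2 + (norm (z + p))\<^sup>2) + 2 * Re (cnj \<beta> * ((z + p) * cnj ?d))"
      unfolding half_form_def moeb_def by (simp add: algebra_simps)
    also have "\<dots> = half_form \<alpha>' \<beta>' z"
      unfolding half_form_def \<alpha>'_def \<beta>'_def cmod_power2
      by (simp add: power2_eq_square algebra_simps)
    finally show ?thesis .
  qed
  then show thesis using that by blast
qed

text \<open>Along a ray from the centre a half-plane form is \<open>\<alpha> (1 + m s\<^sup>2) + 2 B s\<close> with \<open>m \<le> 1\<close>,
  which is bounded below by \<open>(1 - s) (1 - m s)\<close> times its value at 0 when its value at 1 is nonnegative.\<close>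
lemma half_form_geo:
  assumes p: "norm p < 1" and q: "norm q \<le> 1" and z: "z \<in> geo_open p q"
    and hp: "half_form \<alpha> \<beta> p \<ge> 0" and hq: "half_form \<alpha> \<beta> q \<ge> 0"
  shows "half_form \<alpha> \<beta> z \<ge> 0" "half_form \<alpha> \<beta> p > 0 \<or> half_form \<alpha> \<beta> q > 0 \<Longrightarrow> half_form \<alpha> \<beta> z > 0"
proof -
  obtain s where s: "0 < s" "s < 1" "z = moeb p (of_real s * moeb (- p) q)"
    using z by (auto simp: geo_open_alt)
  define a where "a = moeb (- p) q"
  have na: "norm a \<le> 1" unfolding a_def using moeb_minus_cball[OF p q] .
  obtain \<alpha>' \<beta>' where F: "\<And>z. 1 + cnj p * z \<noteq> 0 \<Longrightarrow>
     half_form \<alpha> \<beta> (moeb p z) * (norm (1 + cnj p * z))\<^sup>2 = half_form \<alpha>' \<beta>' z"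
    using half_form_moeb by blast
  have sa: "norm (of_real s * a) \<le> 1" using na s by (simp add: norm_mult mult_le_one)
  define m B where "m = (norm a)\<^sup>2" and "B = Re (cnj \<beta>' * a)"
  have m: "0 \<le> m" "m \<le> 1" using na by (auto simp: m_def abs_square_le_1)
  have F0: "half_form \<alpha> \<beta> p = \<alpha>'" using F[of 0] by (simp add: half_form_def moeb_def)
  have F1: "half_form \<alpha> \<beta> q * (norm (1 + cnj p * a))\<^sup>2 = \<alpha>' * (1 + m) + 2 * B"
    using F[of a] moeb_inverse[OF p q] moeb_denom_nz(1)[OF p na] by (simp add: half_form_def a_def m_def B_def)
  have Fs: "half_form \<alpha> \<beta> z * (norm (1 + cnj p * (of_real s * a)))\<^sup>2 = \<alpha>' * (1 + s\<^sup>2 * m) + 2 * s * B"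
    using F[of "of_real s * a"] moeb_denom_nz(1)[OF p sa] s(1)
    by (simp add: half_form_def a_def[symmetric] m_def B_def s(3) norm_mult power_mult_distrib algebra_simps)
  have N1: "(norm (1 + cnj p * a))\<^sup>2 > 0" and Ns: "(norm (1 + cnj p * (of_real s * a)))\<^sup>2 > 0"
    using moeb_denom_nz(1)[OF p na] moeb_denom_nz(1)[OF p sa] by auto
  define H1 where "H1 = \<alpha>' * (1 + m) + 2 * B"
  have H1: "H1 \<ge> 0" using F1 hq N1 unfolding H1_def by (metis mult_nonneg_nonneg less_imp_le)
  have \<alpha>: "\<alpha>' \<ge> 0" using F0 hp by simp
  have id: "\<alpha>' * (1 + s\<^sup>2 * m) + 2 * s * B = s * H1 + \<alpha>' * ((1 - s) * (1 - s * m))"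
    by (simp add: H1_def algebra_simps power2_eq_square)
  have "s * m \<le> s" using m s by (simp add: mult_left_le)
  then have sm: "s * m < 1" using s by linarith
  have c: "(1 - s) * (1 - s * m) > 0" using s sm by simp
  have "s * H1 + \<alpha>' * ((1 - s) * (1 - s * m)) \<ge> 0" using s H1 \<alpha> c
    by (intro add_nonneg_nonneg mult_nonneg_nonneg[OF _ H1] mult_nonneg_nonneg[OF _ less_imp_le[OF c]]) auto
  then show "half_form \<alpha> \<beta> z \<ge> 0" using Fs id Ns by (metis zero_le_mult_iff not_less)
  assume "half_form \<alpha> \<beta> p > 0 \<or> half_form \<alpha> \<beta> q > 0"
  then have "\<alpha>' > 0 \<or> H1 > 0" using F0 F1 N1 unfolding H1_def by (metis mult_pos_pos)
  then have "s * H1 + \<alpha>' * ((1 - s) * (1 - s * m)) > 0"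
    using s H1 \<alpha> c by (auto intro: add_pos_nonneg add_nonneg_pos mult_nonneg_nonneg mult_pos_pos simp: less_imp_le)
  then show "half_form \<alpha> \<beta> z > 0" using Fs id Ns by (metis zero_less_mult_pos2)
qed

section \<open>The upper half-plane chart and its half-planes\<close>

definition cayley :: "complex \<Rightarrow> complex \<Rightarrow> complex \<Rightarrow> complex" where
  "cayley u p w = u * (w - p) / (w - cnj p)"

text \<open>The positivity sets in the upper half-plane are hyperbolic half-planes: sides of a
  vertical line for \<open>a = 0\<close>, otherwise the inside or the outside of a circle centred on
  the real line.\<close>

definition qform :: "real \<Rightarrow> real \<Rightarrow> real \<Rightarrow> complex \<Rightarrow> real" where
  "qform a b c w = a * (norm w)\<^sup>2 + b * Re w + c"

text \<open>The Cayley map sends \<open>p\<close> to the centre, the real line to the circle and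
  infinity to \<open>u\<close>; the marked end is placed at infinity, the other ends on the
  line.\<close>

locale half_plane_chart =
  fixes u p :: complex
  assumes norm_u: "norm u = 1" and Im_p: "Im p > 0"
begin

abbreviation A where "A \<equiv> cayley u p"

lemma u_nz: "u \<noteq> 0" and u_cnj: "u * cnj u = 1"
  using norm_u by (auto simp: complex_norm_square[symmetric])

lemma denom_nz: "Im w \<ge> 0 \<Longrightarrow> w - cnj p \<noteq> 0"
  using Im_p by (auto simp: complex_eq_iff)

lemma norm_A: "norm (A w) = norm (w - p) / norm (w - cnj p)"
  by (simp add: cayley_def norm_divide norm_mult norm_u)

lemma norm_diff: "(norm (w - cnj p))\<^sup>2 - (norm (w - p))\<^sup>2 = 4 * Im w * Im p"
  unfolding cmod_power2 by (simp add: power2_eq_square algebra_simps)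

lemma one_minus_norm_A: "Im w \<ge> 0 \<Longrightarrow> 1 - (norm (A w))\<^sup>2 = 4 * Im w * Im p / (norm (w - cnj p))\<^sup>2"
  using norm_diff[of w] denom_nz[of w] unfolding norm_A by (simp add: power_divide divide_simps)

lemma A_ball: "Im w > 0 \<Longrightarrow> norm (A w) < 1"
proof -
  assume w: "Im w > 0"
  have "0 < 1 - (norm (A w))\<^sup>2"
    using one_minus_norm_A[of w] w Im_p denom_nz[of w] by simp
  then show ?thesis by (simp add: abs_square_less_1)
qed

lemma A_sphere: "Im w = 0 \<Longrightarrow> norm (A w) = 1"
proof -
  assume w: "Im w = 0"
  then have "cnj (w - p) = w - cnj p" by (simp add: complex_eq_iff)
  then have "norm (w - p) = norm (w - cnj p)" by (metis complex_mod_cnj)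
  then show ?thesis using denom_nz[of w] w by (simp add: norm_A)
qed

lemma A_cball: "Im w \<ge> 0 \<Longrightarrow> norm (A w) \<le> 1"
  using A_ball[of w] A_sphere[of w] by (cases "Im w = 0") auto

lemma A_diff:
  assumes "Im w \<ge> 0" "Im w' \<ge> 0"
  shows "A w - A w' = u * (p - cnj p) * (w - w') / ((w - cnj p) * (w' - cnj p))"
  using denom_nz[OF assms(1)] denom_nz[OF assms(2)]
  by (simp add: cayley_def divide_simps) (simp add: algebra_simps)

lemma A_diff_u:
  assumes "Im w \<ge> 0"
  shows "A w - u = - (u * (p - cnj p) / (w - cnj p))"
  using denom_nz[OF assms] by (simp add: cayley_def divide_simps) (simp add: algebra_simps)

lemma p_cnj_nz: "p - cnj p \<noteq> 0"
  using Im_p by (auto simp: complex_eq_iff)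

lemma A_inj:
  assumes "Im w \<ge> 0" "Im w' \<ge> 0" "A w = A w'"
  shows "w = w'"
  using A_diff[OF assms(1,2)] assms denom_nz[OF assms(1)] denom_nz[OF assms(2)] u_nz p_cnj_nz by auto

lemma A_neq_u: "Im w \<ge> 0 \<Longrightarrow> A w \<noteq> u"
  using A_diff_u[of w] denom_nz[of w] u_nz p_cnj_nz by auto

lemma A_one_minus_cnj:
  assumes "Im w \<ge> 0" "Im w' \<ge> 0"
  shows "1 - cnj (A w') * A w = (cnj p - p) * (w - cnj w') / ((w - cnj p) * (cnj w' - p))"
proof -
  have n: "w - cnj p \<noteq> 0" "cnj w' - p \<noteq> 0"
    using denom_nz[OF assms(1)] denom_nz[OF assms(2)] by (auto simp: complex_eq_iff)
  have "cnj (A w') * A w = (cnj w' - cnj p) / (cnj w' - p) * ((w - p) / (w - cnj p))"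
    using u_cnj by (simp add: cayley_def mult_ac)
  then show ?thesis using n by (simp add: divide_simps) (simp add: algebra_simps)
qed

lemma hdist_A:
  assumes "Im w \<ge> 0" "Im w' \<ge> 0"
  shows "norm (A w - A w') / norm (1 - cnj (A w') * A w) = norm (w - w') / norm (w - cnj w')"
proof -
  have n: "norm (w - cnj p) \<noteq> 0" "norm (w' - cnj p) \<noteq> 0" "norm (p - cnj p) \<noteq> 0"
    using denom_nz[OF assms(1)] denom_nz[OF assms(2)] p_cnj_nz by auto
  have e: "norm (cnj w' - p) = norm (w' - cnj p)" by (metis complex_cnj_cnj complex_cnj_diff complex_mod_cnj)
  show ?thesis
    unfolding A_diff[OF assms] A_one_minus_cnj[OF assms] norm_divide norm_mult norm_u e
      norm_minus_commute[of "cnj p" p]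
    using n by simp
qed

lemma A_surj:
  assumes "norm z < 1"
  obtains w where "Im w > 0" "A w = z"
proof -
  have uz: "u - z \<noteq> 0" using assms norm_u by auto
  define w where "w = (p * u - cnj p * z) / (u - z)"
  have 1: "w - p = (p - cnj p) * z / (u - z)" and 2: "w - cnj p = (p - cnj p) * u / (u - z)"
    using uz by (simp_all add: w_def divide_simps) (simp_all add: algebra_simps)
  have Az: "A w = z" unfolding cayley_def 1 2 using uz p_cnj_nz u_nz by simp
  have "(norm (w - p))\<^sup>2 < (norm (w - cnj p))\<^sup>2"
    unfolding 1 2 norm_divide norm_mult norm_u using uz p_cnj_nz assms
    by (intro power_strict_mono divide_strict_right_mono mult_strict_left_mono) auto
  then have "0 < 4 * Im w * Im p" using norm_diff[of w] by linarith
  then have "Im w > 0" using Im_p by (simp add: zero_less_mult_iff)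
  then show thesis using that Az by blast
qed

text \<open>The coefficients are solved from the identity \<open>hform_A\<close>: with
  \<open>w = Re p + Im p * v\<close>, the form \<open>qform a b c w\<close> divided by
  \<open>(Im p)\<^sup>2\<close> has the coefficients \<open>a\<close>, \<open>2 * g\<close>,
  \<open>t\<close> in \<open>v\<close>.\<close>

definition hform :: "real \<Rightarrow> real \<Rightarrow> real \<Rightarrow> complex \<Rightarrow> real" where
  "hform a b c = (let g = (b + 2 * Re p * a) / (2 * Im p);
      t = (c - a * (Re p)\<^sup>2 + 2 * g * Re p * Im p) / (Im p)\<^sup>2
    in half_form ((a + t) / 2) (Complex ((a - t) / 2) (- g) * u))"

lemma hform_A:
  assumes w: "Im w \<ge> 0"
  shows "hform a b c (A w) * (norm (w - cnj p))\<^sup>2 = 2 * qform a b c w"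
proof -
  define g t where "g = (b + 2 * Re p * a) / (2 * Im p)"
    and "t = (c - a * (Re p)\<^sup>2 + 2 * g * Re p * Im p) / (Im p)\<^sup>2"
  have b: "b = 2 * g * Im p - 2 * Re p * a" using Im_p by (simp add: g_def field_simps)
  have c: "c = t * (Im p)\<^sup>2 + a * (Re p)\<^sup>2 - 2 * g * Re p * Im p" using Im_p by (simp add: t_def)
  define \<gamma> where "\<gamma> = Complex ((a - t) / 2) g"
  have hf: "hform a b c = half_form ((a + t) / 2) (cnj \<gamma> * u)"
  proof -
    have "cnj \<gamma> = Complex ((a - t) / 2) (- g)" by (simp add: \<gamma>_def complex_eq_iff)
    then show ?thesis unfolding hform_def Let_def by (simp only: g_def t_def)
  qed
  have d: "(norm (w - cnj p))\<^sup>2 \<noteq> 0" using denom_nz[OF w] by simp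
  have q: "(w - p) / (w - cnj p) = (w - p) * cnj (w - cnj p) / of_real ((norm (w - cnj p))\<^sup>2)"
    using denom_nz[OF w] by (metis complex_div_cnj of_real_power)
  have "cnj (cnj \<gamma> * u) * A w = \<gamma> * ((w - p) / (w - cnj p))"
    using u_cnj by (simp add: cayley_def mult_ac)
  then have "Re (cnj (cnj \<gamma> * u) * A w) * (norm (w - cnj p))\<^sup>2 = Re (\<gamma> * ((w - p) * cnj (w - cnj p)))"
    unfolding q using d by (simp add: Re_divide_of_real del: of_real_power)
  moreover have "(norm (A w))\<^sup>2 * (norm (w - cnj p))\<^sup>2 = (norm (w - p))\<^sup>2"
    using d by (simp add: norm_A power_divide)
  ultimately have "hform a b c (A w) * (norm (w - cnj p))\<^sup>2 =
      (a + t) / 2 * ((norm (w - cnj p))\<^sup>2 + (norm (w - p))\<^sup>2) + 2 * Re (\<gamma> * ((w - p) * cnj (w - cnj p)))"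
    unfolding hf half_form_def by (simp add: algebra_simps)
  also have "\<dots> = 2 * qform a b c w"
    unfolding qform_def b c \<gamma>_def cmod_power2 by (simp add: power2_eq_square field_simps)
  finally show ?thesis .
qed

text \<open>At infinity the leading coefficient decides on which side of the half-plane the marked
  end lies.\<close>

lemma hform_u: "hform a b c u = 2 * a"
proof -
  have "half_form \<alpha> (Complex g k * u) u = 2 * \<alpha> + 2 * g" for \<alpha> g k
  proof -
    have "cnj (Complex g k * u) * u = cnj (Complex g k)" using u_cnj by (simp add: mult_ac)
    then have "Re (cnj (Complex g k * u) * u) = g" by (simp only: cnj.simps complex.sel)
    then show ?thesis using norm_u by (simp add: half_form_def)
  qed
  then show ?thesis unfolding hform_def Let_def by (simp add: field_simps)
qed

lemma hform_sign:
  assumes "Im w \<ge> 0"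
  shows "hform a b c (A w) > 0 \<longleftrightarrow> qform a b c w > 0" "hform a b c (A w) \<ge> 0 \<longleftrightarrow> qform a b c w \<ge> 0"
proof -
  have d: "(norm (w - cnj p))\<^sup>2 > 0" using denom_nz[OF assms] by simp
  have "hform a b c (A w) > 0 \<longleftrightarrow> hform a b c (A w) * (norm (w - cnj p))\<^sup>2 > 0"
    "hform a b c (A w) \<ge> 0 \<longleftrightarrow> hform a b c (A w) * (norm (w - cnj p))\<^sup>2 \<ge> 0"
    using d by (simp_all only: zero_less_mult_iff zero_le_mult_iff) auto
  then show "hform a b c (A w) > 0 \<longleftrightarrow> qform a b c w > 0" "hform a b c (A w) \<ge> 0 \<longleftrightarrow> qform a b c w \<ge> 0"
    unfolding hform_A[OF assms] by auto
qed

lemma hform_geo: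
  assumes "norm x < 1" "norm y \<le> 1" "z \<in> geo_open x y" "hform a b c x \<ge> 0" "hform a b c y \<ge> 0"
  shows "hform a b c z \<ge> 0" "hform a b c x > 0 \<or> hform a b c y > 0 \<Longrightarrow> hform a b c z > 0"
  using half_form_geo[OF assms(1-3)] assms(4,5) by (auto simp: hform_def Let_def)

text \<open>The form \<open>t |w - x'|\<^sup>2 + (t\<^sup>2 + s\<^sup>2) Re (w - x')\<close> cuts out the disk through \<open>x'\<close> and \<open>x + i s\<close>
  centred on the real line; together with a vertical strip it confines the geodesic to a Stolz angle at \<open>x'\<close>.\<close>
lemma geodesic_in_cone:
  assumes s: "s > 0" and x: "x \<le> x'" "x' - x \<le> C * s" and y: "y \<ge> 0"
    and w: "Im w > 0" "A w \<in> geo_open (A (Complex x s)) (A (Complex x' y))"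
  shows "\<bar>Re w - x'\<bar> \<le> C * Im w"
proof -
  define t where "t = x' - x"
  have geo: "qform a b c w \<ge> 0"
    if "qform a b c (Complex x s) \<ge> 0" "qform a b c (Complex x' y) \<ge> 0" for a b c
    using hform_geo(1)[OF A_ball A_cball w(2), of a b c] hform_sign(2)[of _ a b c] that s y w(1)
    by simp
  have 1: "Re w \<ge> x" using geo[of 0 1 "- x"] x by (simp add: qform_def)
  have 2: "Re w \<le> x'" using geo[of 0 "-1" x'] x by (simp add: qform_def)
  have q: "qform t (t\<^sup>2 + s\<^sup>2 - 2 * t * x') (t * x'\<^sup>2 - (t\<^sup>2 + s\<^sup>2) * x') v =
     t * ((Re v - x')\<^sup>2 + (Im v)\<^sup>2) + (t\<^sup>2 + s\<^sup>2) * (Re v - x')" for v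
    unfolding qform_def cmod_power2 by (simp add: power2_eq_square algebra_simps)
  define a where "a = x' - Re w"
  have a: "0 \<le> a" "a \<le> t" using 1 2 by (auto simp: a_def t_def)
  have "qform t (t\<^sup>2 + s\<^sup>2 - 2 * t * x') (t * x'\<^sup>2 - (t\<^sup>2 + s\<^sup>2) * x') w \<ge> 0"
  proof (rule geo)
    show "qform t (t\<^sup>2 + s\<^sup>2 - 2 * t * x') (t * x'\<^sup>2 - (t\<^sup>2 + s\<^sup>2) * x') (Complex x s) \<ge> 0"
      unfolding q by (simp add: t_def power2_eq_square algebra_simps)
    show "qform t (t\<^sup>2 + s\<^sup>2 - 2 * t * x') (t * x'\<^sup>2 - (t\<^sup>2 + s\<^sup>2) * x') (Complex x' y) \<ge> 0"
      unfolding q using x by (simp add: t_def)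
  qed
  then have main: "t * (a\<^sup>2 + (Im w)\<^sup>2) \<ge> (t\<^sup>2 + s\<^sup>2) * a"
    unfolding q by (simp add: a_def power2_eq_square algebra_simps)
  \<comment> \<open>With \<open>y = Im w\<close>, multiply \<open>main\<close> by \<open>t\<close>
    and use \<open>a * a \<le> t * a\<close>: what remains is \<open>(t * y)\<^sup>2 \<ge> s\<^sup>2
    * t * a \<ge> (s * a)\<^sup>2\<close>, that is, \<open>a \<le> (t / s) * y\<close>.\<close>
  have "t * (t * (t * a)) \<ge> t * (t * (a * a))" using a by (intro mult_left_mono mult_right_mono) auto
  moreover have "t * (t * (a\<^sup>2 + (Im w)\<^sup>2)) \<ge> t * ((t\<^sup>2 + s\<^sup>2) * a)"
    using main a by (intro mult_left_mono) auto
  moreover have "(t * Im w)\<^sup>2 = t * (t * (a\<^sup>2 + (Im w)\<^sup>2)) - t * (t * (a * a))"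
    "s\<^sup>2 * (t * a) = t * ((t\<^sup>2 + s\<^sup>2) * a) - t * (t * (t * a))"
    by (simp_all add: power2_eq_square algebra_simps)
  ultimately have "(t * Im w)\<^sup>2 \<ge> s\<^sup>2 * (t * a)" by linarith
  moreover have "s\<^sup>2 * (t * a) \<ge> s\<^sup>2 * (a * a)" using a by (intro mult_left_mono mult_right_mono) auto
  moreover have "(s * a)\<^sup>2 = s\<^sup>2 * (a * a)" by (simp add: power2_eq_square)
  ultimately have "(s * a)\<^sup>2 \<le> (t * Im w)\<^sup>2" by linarith
  moreover have "0 \<le> t * Im w" using a w(1) by (intro mult_nonneg_nonneg) linarith+
  ultimately have "s * a \<le> t * Im w" by (rule power2_le_imp_le)
  also have "\<dots> \<le> C * s * Im w" using x(2) w(1) unfolding t_def by (intro mult_right_mono) linarith+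
  also have "\<dots> = s * (C * Im w)" by simp
  finally have "a \<le> C * Im w" using s by (rule mult_left_le_imp_le)
  then show ?thesis using a by (simp add: a_def)
qed

text \<open>Both closed half-planes bounded by the vertical line at \<open>x\<close> contain the two
  ends of the geodesic.\<close>

lemma geodesic_vertical:
  assumes s: "s > 0" and w: "Im w > 0" "A w \<in> geo_open (A (Complex x s)) u"
  shows "Re w = x"
proof -
  have geo: "qform 0 b c w \<ge> 0" if "qform 0 b c (Complex x s) \<ge> 0" for b c
    using hform_geo(1)[OF A_ball _ w(2), of 0 b c] hform_sign(2)[of _ 0 b c] that s w(1) norm_u
    by (simp add: hform_u)
  show ?thesis using geo[of 1 "- x"] geo[of "-1" x] by (simp add: qform_def)
qed

end

section \<open>Anti-Blaschke products with prescribed fixed points\<close>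

definition anti_blaschke :: "nat \<Rightarrow> (nat \<Rightarrow> complex) \<Rightarrow> complex \<Rightarrow> complex" where
  "anti_blaschke d a z = cnj z * (\<Prod>i < d - 1. (cnj z - a i) / (1 - cnj (a i * z)))"

lemma anti_blaschke_in_Bminus: "(\<And>i. i < d - 1 \<Longrightarrow> norm (a i) < 1) \<Longrightarrow> anti_blaschke d a \<in> Bminus d"
  unfolding Bminus_def anti_blaschke_def by blast

text \<open>The condition \<open>sum_\<zeta>\<close> means \<open>f 0 = 0\<close>, and
  \<open>prod_\<zeta>\<close> makes the leading coefficient of \<open>num\<close> equal to
  \<open>d + 1\<close>, so that the resulting Blaschke product carries no unimodular
  constant.\<close>

locale unit_points =
  fixes d :: nat and \<zeta> :: "nat \<Rightarrow> complex"
  assumes d_pos: "d \<ge> 1"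
    and norm_\<zeta>: "j \<le> d \<Longrightarrow> norm (\<zeta> j) = 1"
    and inj_\<zeta>: "inj_on \<zeta> {..d}"
    and sum_\<zeta>: "(\<Sum>j\<le>d. \<zeta> j) = 0"
    and prod_\<zeta>: "(\<Prod>j\<le>d. \<zeta> j) = (- 1) ^ d"
begin

definition others :: "nat \<Rightarrow> complex \<Rightarrow> complex" where
  "others j w = (\<Prod>k\<in>{..d} - {j}. 1 - \<zeta> k * w)"

text \<open>With \<open>G = num / den\<close>, the Herglotz formula says that
  \<open>1 / (1 - w * G w)\<close> is the mean of the kernels
  \<open>1 / (1 - \<zeta> j * w)\<close>. Numerator and denominator of \<open>G\<close> are
  multiplied by \<open>full\<close> so that they make sense at the fixed points themselves.\<close>

definition num :: "complex \<Rightarrow> complex" where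
  "num w = (\<Sum>j\<le>d. \<zeta> j * others j w)"

definition den :: "complex \<Rightarrow> complex" where
  "den w = (\<Sum>j\<le>d. others j w)"

definition full :: "complex \<Rightarrow> complex" where
  "full w = (\<Prod>k\<le>d. 1 - \<zeta> k * w)"

definition tsum :: "complex \<Rightarrow> complex" where
  "tsum w = (\<Sum>j\<le>d. \<zeta> j / (1 - \<zeta> j * w))"

lemma \<zeta>_nz: "j \<le> d \<Longrightarrow> \<zeta> j \<noteq> 0" and \<zeta>_cnj: "j \<le> d \<Longrightarrow> \<zeta> j * cnj (\<zeta> j) = 1"
  using norm_\<zeta>[of j] by (auto simp: complex_norm_square[symmetric])

lemma full_others: "j \<le> d \<Longrightarrow> full w = (1 - \<zeta> j * w) * others j w"
  unfolding full_def others_def by (rule prod.remove) auto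

lemma others_self_nz:
  assumes "k \<le> d"
  shows "others k (cnj (\<zeta> k)) \<noteq> 0"
proof -
  have "1 - \<zeta> l * cnj (\<zeta> k) \<noteq> 0" if "l \<in> {..d} - {k}" for l
  proof
    assume "1 - \<zeta> l * cnj (\<zeta> k) = 0"
    then have "\<zeta> l * (\<zeta> k * cnj (\<zeta> k)) = \<zeta> k" by (simp add: mult_ac)
    then have "\<zeta> l = \<zeta> k" using \<zeta>_cnj[OF assms] by simp
    then show False using inj_\<zeta> that assms by (auto simp: inj_on_def)
  qed
  then show ?thesis by (auto simp: others_def)
qed

lemma others_other:
  assumes "k \<le> d" "j \<le> d" "j \<noteq> k"
  shows "others j (cnj (\<zeta> k)) = 0"
  unfolding others_def using assms \<zeta>_cnj[OF assms(1)] by (intro prod_zero) (auto intro!: bexI[of _ k])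

lemma num_self: "k \<le> d \<Longrightarrow> num (cnj (\<zeta> k)) = \<zeta> k * others k (cnj (\<zeta> k))"
proof -
  assume k: "k \<le> d"
  have "num (cnj (\<zeta> k)) = (\<Sum>j\<le>d. if j = k then \<zeta> k * others k (cnj (\<zeta> k)) else 0)"
    unfolding num_def using others_other[OF k] by (intro sum.cong) auto
  then show ?thesis using k by simp
qed

lemma den_self: "k \<le> d \<Longrightarrow> den (cnj (\<zeta> k)) = others k (cnj (\<zeta> k))"
proof -
  assume k: "k \<le> d"
  have "den (cnj (\<zeta> k)) = (\<Sum>j\<le>d. if j = k then others k (cnj (\<zeta> k)) else 0)"
    unfolding den_def using others_other[OF k] by (intro sum.cong) auto
  then show ?thesis using k by simp
qed

lemma full_zero_iff: "full w = 0 \<longleftrightarrow> (\<exists>k\<le>d. w = cnj (\<zeta> k))"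
proof -
  have "1 - \<zeta> k * w = 0 \<longleftrightarrow> w = cnj (\<zeta> k)" if "k \<le> d" for k
  proof -
    have "\<zeta> k * w = \<zeta> k * cnj (\<zeta> k) \<longleftrightarrow> w = cnj (\<zeta> k)" using \<zeta>_nz[OF that] by simp
    then show ?thesis using \<zeta>_cnj[OF that] by auto
  qed
  then show ?thesis unfolding full_def by (auto simp: prod_zero_iff)
qed

lemma num_tsum: "full w \<noteq> 0 \<Longrightarrow> num w = full w * tsum w"
  unfolding num_def tsum_def sum_distrib_left
  by (intro sum.cong refl) (auto simp: full_others)

lemma den_num: "den w - w * num w = of_nat (d + 1) * full w"
proof -
  have "den w - w * num w = (\<Sum>j\<le>d. (1 - \<zeta> j * w) * others j w)"
    unfolding den_def num_def by (simp add: sum_distrib_left sum_subtractf[symmetric] algebra_simps)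
  also have "\<dots> = (\<Sum>j\<le>d. full w)" by (intro sum.cong refl) (simp add: full_others)
  finally show ?thesis by simp
qed

text \<open>For \<open>norm w \<ge> 1\<close> and away from the poles each
  \<open>\<zeta> j * w / (1 - \<zeta> j * w)\<close> has real part at most \<open>- 1 / 2\<close>,
  so the terms cannot cancel. Hence the zeros of \<open>num\<close> lie in the open disk.\<close>

lemma num_nz:
  assumes w: "norm w \<ge> 1"
  shows "num w \<noteq> 0"
proof (cases "full w = 0")
  case True
  then obtain k where "k \<le> d" "w = cnj (\<zeta> k)" using full_zero_iff by auto
  then show ?thesis using num_self others_self_nz \<zeta>_nz by simp
next
  case False
  have *: "Re (\<zeta> j * w / (1 - \<zeta> j * w)) \<le> - 1 / 2" if j: "j \<le> d" for j
  proof -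
    define v where "v = \<zeta> j * w"
    have v1: "1 - v \<noteq> 0" using False j by (auto simp: full_def v_def)
    have nv: "norm v \<ge> 1" using w norm_\<zeta>[OF j] by (simp add: v_def norm_mult)
    then have nv2: "(norm v)\<^sup>2 \<ge> 1" by (simp add: one_le_power)
    have p: "(norm (1 - v))\<^sup>2 > 0" using v1 by simp
    have "Re (v / (1 - v)) = Re (v * cnj (1 - v)) / (norm (1 - v))\<^sup>2"
      by (subst complex_div_cnj) (simp add: Re_divide_of_real del: of_real_power)
    also have "Re (v * cnj (1 - v)) = Re v - (norm v)\<^sup>2"
      unfolding cmod_power2 by (simp add: power2_eq_square algebra_simps)
    also have "(Re v - (norm v)\<^sup>2) / (norm (1 - v))\<^sup>2 \<le> - 1 / 2"
    proof -
      have "(norm (1 - v))\<^sup>2 = 1 - 2 * Re v + (norm v)\<^sup>2"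
        unfolding cmod_power2 by (simp add: power2_eq_square algebra_simps)
      then have "Re v - (norm v)\<^sup>2 \<le> - 1 / 2 * (norm (1 - v))\<^sup>2" using nv2 by linarith
      then show ?thesis using p by (simp only: pos_divide_le_eq)
    qed
    finally show ?thesis by (simp add: v_def)
  qed
  have "Re (w * tsum w) = (\<Sum>j\<le>d. Re (\<zeta> j * w / (1 - \<zeta> j * w)))"
    unfolding tsum_def by (simp add: sum_distrib_left mult_ac)
  also have "\<dots> \<le> (\<Sum>j\<le>d. - 1 / 2)" using * by (intro sum_mono) auto
  also have "\<dots> < 0" by simp
  finally have "tsum w \<noteq> 0" by auto
  then show ?thesis using num_tsum False by simp
qed

text \<open>Away from 0, \<open>den w\<close> is the reflection
  \<open>w ^ d * cnj (num (1 / cnj w))\<close> of \<open>num\<close> in the circle, so each root of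
  \<open>num\<close> yields the matching Blaschke factor of the quotient. Barycentre 0 makes 0 one
  of the roots.\<close>

lemma num_factorization:
  obtains a where "\<And>i. i < d - 1 \<Longrightarrow> norm (a i) < 1"
    "\<And>w. num w = of_nat (d + 1) * (w * (\<Prod>i<d - 1. w - a i))"
    "\<And>w. den w = of_nat (d + 1) * (\<Prod>i<d - 1. 1 - cnj (a i) * w)"
proof -
  define L where "L j = (\<Prod>k\<in>{..d} - {j}. [:1, - \<zeta> k:])" for j
  define P where "P = (\<Sum>j\<le>d. smult (\<zeta> j) (L j))"
  have Pn: "poly P w = num w" for w
    by (simp add: P_def L_def num_def others_def poly_sum poly_prod mult_ac)
  have dL: "degree (L j) = d" "coeff (L j) d = (- 1) ^ d * (\<Prod>k\<in>{..d} - {j}. \<zeta> k)" if "j \<le> d" for j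
  proof -
    have c: "card ({..d} - {j}) = d" using that by simp
    show dg: "degree (L j) = d"
      unfolding L_def using \<zeta>_nz c by (subst degree_prod_sum_eq) auto
    have "lead_coeff (L j) = (\<Prod>k\<in>{..d} - {j}. - \<zeta> k)"
      unfolding L_def lead_coeff_prod using \<zeta>_nz by (intro prod.cong) auto
    also have "\<dots> = (- 1) ^ d * (\<Prod>k\<in>{..d} - {j}. \<zeta> k)"
      by (subst prod_uminus) (use c in simp)
    finally show "coeff (L j) d = (- 1) ^ d * (\<Prod>k\<in>{..d} - {j}. \<zeta> k)" using dg by simp
  qed
  have cP: "coeff P d = of_nat (d + 1)"
  proof -
    have "coeff P d = (\<Sum>j\<le>d. (- 1) ^ d * (\<zeta> j * (\<Prod>k\<in>{..d} - {j}. \<zeta> k)))"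
      unfolding P_def coeff_sum using dL by (intro sum.cong) (auto simp: mult_ac)
    also have "\<dots> = (\<Sum>j\<le>d. 1)"
    proof (intro sum.cong refl)
      fix j assume "j \<in> {..d}"
      then have "\<zeta> j * (\<Prod>k\<in>{..d} - {j}. \<zeta> k) = (\<Prod>k\<le>d. \<zeta> k)"
        by (intro prod.remove[symmetric]) auto
      then show "(- 1) ^ d * (\<zeta> j * (\<Prod>k\<in>{..d} - {j}. \<zeta> k)) = 1"
        by (simp add: prod_\<zeta> power_mult_distrib[symmetric])
    qed
    finally show ?thesis by simp
  qed
  have dP: "degree P = d"
  proof (rule antisym)
    show "degree P \<le> d" unfolding P_def using dL by (intro degree_sum_le) (auto intro: order_trans[OF degree_smult_le])
    show "d \<le> degree P" using cP by (intro le_degree) (simp del: of_nat_Suc of_nat_add)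
  qed
  have "poly P 0 = 0" unfolding Pn num_def others_def using sum_\<zeta> by simp
  then obtain P1 where P1: "P = pCons 0 P1" by (cases P) auto
  have "P1 \<noteq> 0" using dP d_pos P1 by auto
  then have dP1: "degree P1 = d - 1" and lP1: "lead_coeff P1 = of_nat (d + 1)"
    using dP cP P1 d_pos by (auto simp: degree_pCons_eq coeff_pCons split: nat.splits)
  obtain a where a: "smult (lead_coeff P1) (\<Prod>i<degree P1. [:- a i, 1:]) = P1"
    by (rule complex_poly_decompose')
  have a': "P1 = smult (of_nat (d + 1)) (\<Prod>i<d - 1. [:- a i, 1:])"
    using a unfolding lP1 unfolding dP1 by (rule sym)
  have N: "num w = of_nat (d + 1) * (w * (\<Prod>i<d - 1. w - a i))" for w
  proof -
    have "num w = w * poly P1 w" unfolding Pn[symmetric] P1 by simp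
    also have "poly P1 w = of_nat (d + 1) * (\<Prod>i<d - 1. w - a i)"
      by (subst a') (simp add: poly_prod)
    finally show ?thesis by simp
  qed
  have "den w = of_nat (d + 1) * (\<Prod>i<d - 1. 1 - cnj (a i) * w)" for w
  proof (cases "w = 0")
    case True
    then show ?thesis by (simp add: den_def others_def)
  next
    case False
    have "cnj (\<zeta> j * others j (1 / cnj w)) = others j w / w ^ d" if j: "j \<le> d" for j
    proof -
      have "cnj (\<zeta> j * others j (1 / cnj w)) = cnj (\<zeta> j) * (\<Prod>k\<in>{..d} - {j}. 1 - cnj (\<zeta> k) / w)"
        by (simp add: others_def)
      also have "(\<Prod>k\<in>{..d} - {j}. 1 - cnj (\<zeta> k) / w) =
          (\<Prod>k\<in>{..d} - {j}. (- 1 / w) * cnj (\<zeta> k) * (1 - \<zeta> k * w))"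
      proof (intro prod.cong refl)
        fix k assume "k \<in> {..d} - {j}"
        then have "cnj (\<zeta> k) * \<zeta> k = 1" using \<zeta>_cnj[of k] by (simp add: mult.commute)
        then show "1 - cnj (\<zeta> k) / w = (- 1 / w) * cnj (\<zeta> k) * (1 - \<zeta> k * w)"
          using False by (simp add: field_simps)
      qed
      also have "\<dots> = (- 1 / w) ^ d * (\<Prod>k\<in>{..d} - {j}. cnj (\<zeta> k)) * others j w"
        using j by (simp only: prod.distrib others_def) simp
      also have "cnj (\<zeta> j) * \<dots> = (- 1 / w) ^ d * (cnj (\<zeta> j) * (\<Prod>k\<in>{..d} - {j}. cnj (\<zeta> k))) * others j w"
        by (simp only: mult_ac)
      also have "cnj (\<zeta> j) * (\<Prod>k\<in>{..d} - {j}. cnj (\<zeta> k)) = (\<Prod>k\<le>d. cnj (\<zeta> k))"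
        using j by (intro prod.remove[symmetric]) auto
      also have "\<dots> = (- 1) ^ d" using arg_cong[OF prod_\<zeta>, of cnj] by simp
      also have "(- 1 / w) ^ d * (- 1) ^ d = 1 / w ^ d"
        by (simp add: power_mult_distrib[symmetric] power_one_over)
      finally show ?thesis by simp
    qed
    then have "cnj (num (1 / cnj w)) = den w / w ^ d"
      unfolding num_def den_def cnj_sum sum_divide_distrib by (intro sum.cong) auto
    then have "den w = w ^ d * cnj (num (1 / cnj w))" using False by simp
    also have "cnj (num (1 / cnj w)) = of_nat (d + 1) * (1 / w * (\<Prod>i<d - 1. 1 / w - cnj (a i)))"
      unfolding N by simp
    also have "(\<Prod>i<d - 1. 1 / w - cnj (a i)) = (\<Prod>i<d - 1. 1 / w * (1 - cnj (a i) * w))"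
      using False by (intro prod.cong) (auto simp: field_simps)
    also have "\<dots> = (1 / w) ^ (d - 1) * (\<Prod>i<d - 1. 1 - cnj (a i) * w)"
      by (simp only: prod.distrib) simp
    also have "w ^ d * (of_nat (d + 1) * (1 / w * ((1 / w) ^ (d - 1) * (\<Prod>i<d - 1. 1 - cnj (a i) * w)))) =
       of_nat (d + 1) * (w ^ d * ((1 / w) * (1 / w) ^ (d - 1))) * (\<Prod>i<d - 1. 1 - cnj (a i) * w)"
      by (simp only: mult_ac)
    also have "(1 / w) * (1 / w) ^ (d - 1) = (1 / w) ^ d" using d_pos by (cases d) auto
    also have "w ^ d * (1 / w) ^ d = 1" using False by (simp add: power_mult_distrib[symmetric])
    finally show ?thesis by simp
  qed
  moreover have "norm (a i) < 1" if "i < d - 1" for i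
  proof (rule ccontr)
    assume "\<not> norm (a i) < 1"
    then have "num (a i) \<noteq> 0" using num_nz by simp
    moreover have "(\<Prod>i'<d - 1. a i - a i') = 0" using that by (intro prod_zero) auto
    then have "num (a i) = 0" using N by simp
    ultimately show False by simp
  qed
  ultimately show thesis using that N by blast
qed

lemma anti_blaschke_points:
  obtains a where "\<And>i. i < d - 1 \<Longrightarrow> norm (a i) < 1" "\<And>z. anti_blaschke d a z = num (cnj z) / den (cnj z)"
proof -
  obtain a where a: "\<And>i. i < d - 1 \<Longrightarrow> norm (a i) < 1"
    "\<And>w. num w = of_nat (d + 1) * (w * (\<Prod>i<d - 1. w - a i))"
    "\<And>w. den w = of_nat (d + 1) * (\<Prod>i<d - 1. 1 - cnj (a i) * w)"
    using num_factorization by metis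
  have "anti_blaschke d a z = num (cnj z) / den (cnj z)" for z
    unfolding anti_blaschke_def a(2,3) prod_dividef by (simp del: of_nat_Suc of_nat_add)
  then show thesis using that a(1) by blast
qed

lemma den_nz:
  assumes "norm w \<le> 1"
  shows "den w \<noteq> 0"
proof -
  obtain a where a: "\<And>i. i < d - 1 \<Longrightarrow> norm (a i) < 1"
    "\<And>w. den w = of_nat (d + 1) * (\<Prod>i<d - 1. 1 - cnj (a i) * w)"
    using num_factorization by metis
  have "1 - cnj (a i) * w \<noteq> 0" if "i < d - 1" for i
  proof -
    have "norm (cnj (a i) * w) < 1"
      using a(1)[OF that] assms mult_mono[of "norm (a i)" "norm (a i)" "norm w" 1] by (simp add: norm_mult)
    then show ?thesis by auto
  qed
  then show ?thesis unfolding a(2) by (auto simp del: of_nat_Suc of_nat_add)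
qed

lemma full_nz: "norm w < 1 \<Longrightarrow> full w \<noteq> 0"
  using full_zero_iff norm_\<zeta> by auto

lemma fixed_iff:
  assumes "norm z = 1"
  shows "num (cnj z) / den (cnj z) = z \<longleftrightarrow> (\<exists>k\<le>d. z = \<zeta> k)"
proof -
  have zz: "z * cnj z = 1" "z \<noteq> 0" using assms by (auto simp: complex_norm_square[symmetric])
  have dn: "den (cnj z) \<noteq> 0" using den_nz assms by simp
  have "num (cnj z) / den (cnj z) = z \<longleftrightarrow> num (cnj z) = z * den (cnj z)"
    using dn by (simp add: divide_eq_eq)
  also have "\<dots> \<longleftrightarrow> z * (den (cnj z) - cnj z * num (cnj z)) = 0"
    using zz by (simp add: right_diff_distrib mult.assoc[symmetric]) metis
  also have "\<dots> \<longleftrightarrow> full (cnj z) = 0"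
    unfolding den_num using zz by (simp del: of_nat_Suc of_nat_add)
  also have "\<dots> \<longleftrightarrow> (\<exists>k\<le>d. z = \<zeta> k)" unfolding full_zero_iff by (metis complex_cnj_cancel_iff)
  finally show ?thesis .
qed

lemma holo: "others j holomorphic_on S" "num holomorphic_on S" "den holomorphic_on S"
  unfolding others_def num_def den_def by (intro holomorphic_intros)+

text \<open>Differentiate \<open>1 - w * G w = (d + 1) * full w / den w\<close>, with
  \<open>G = num / den\<close>, at the zero \<open>cnj (\<zeta> k)\<close> of \<open>full\<close>.
  Equal weights make the modulus \<open>d\<close> at every fixed point.\<close>

lemma has_deriv_self:
  assumes k: "k \<le> d"
  shows "((\<lambda>w. num w / den w) has_field_derivative of_nat d * (\<zeta> k)\<^sup>2) (at (cnj (\<zeta> k)))"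
proof -
  let ?w = "cnj (\<zeta> k)"
  have dn: "den ?w \<noteq> 0" using den_nz norm_\<zeta>[OF k] by simp
  have fd: "f field_differentiable at ?w" if "f holomorphic_on UNIV" for f
    using that by (simp add: holomorphic_on_def)
  obtain D where D: "((\<lambda>w. num w / den w) has_field_derivative D) (at ?w)"
    using field_differentiable_divide[OF fd[OF holo(2)] fd[OF holo(3)] dn]
    unfolding field_differentiable_def by blast
  obtain D1 where D1: "(others k has_field_derivative D1) (at ?w)"
    using fd[OF holo(1)] unfolding field_differentiable_def by blast
  obtain D2 where D2: "(den has_field_derivative D2) (at ?w)"
    using fd[OF holo(3)] unfolding field_differentiable_def by blast
  have z: "1 - \<zeta> k * ?w = 0" using \<zeta>_cnj[OF k] by simp
  have eq: "den w - w * num w = of_nat (d + 1) * ((1 - \<zeta> k * w) * others k w)" for w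
    unfolding den_num full_others[OF k] ..
  have L: "((\<lambda>w. 1 - w * (num w / den w)) has_field_derivative - (num ?w / den ?w + ?w * D)) (at ?w)"
    using DERIV_diff[OF DERIV_const[of 1] DERIV_mult[OF DERIV_ident D]] by (simp add: algebra_simps)
  have R: "((\<lambda>w. of_nat (d + 1) * ((1 - \<zeta> k * w) * others k w) / den w) has_field_derivative
      of_nat (d + 1) * (- \<zeta> k * others k ?w) / den ?w) (at ?w)"
    using dn z by (auto intro!: derivative_eq_intros D1 D2 simp del: of_nat_Suc of_nat_add)
  have "\<forall>\<^sub>F w in nhds ?w. den w \<noteq> 0"
    using holo(3)[of UNIV] dn
    by (intro tendsto_imp_eventually_ne[where c = "den ?w"]) (auto dest!: holomorphic_on_imp_continuous_on simp: continuous_on_eq_continuous_at isCont_def tendsto_at_iff_tendsto_nhds)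
  then have "\<forall>\<^sub>F w in nhds ?w. 1 - w * (num w / den w) = of_nat (d + 1) * ((1 - \<zeta> k * w) * others k w) / den w"
  proof eventually_elim
    case (elim w)
    then show ?case using eq[of w] by (simp add: field_simps del: of_nat_Suc of_nat_add)
  qed
  then have "((\<lambda>w. 1 - w * (num w / den w)) has_field_derivative
      of_nat (d + 1) * (- \<zeta> k * others k ?w) / den ?w) (at ?w)"
    using R by (subst DERIV_cong_ev[OF refl _ refl]) auto
  then have "- (num ?w / den ?w + ?w * D) = of_nat (d + 1) * (- \<zeta> k * others k ?w) / den ?w"
    using L DERIV_unique by blast
  then have "- (\<zeta> k + ?w * D) = - (of_nat (d + 1) * \<zeta> k)"
    using num_self[OF k] den_self[OF k] others_self_nz[OF k] by (simp del: of_nat_Suc of_nat_add)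
  then have "\<zeta> k + ?w * D = of_nat (d + 1) * \<zeta> k" by (simp only: neg_equal_iff_equal)
  then have "?w * D = of_nat d * \<zeta> k" by (simp add: algebra_simps)
  then have "(\<zeta> k * ?w) * D = of_nat d * (\<zeta> k)\<^sup>2" by (simp add: power2_eq_square mult_ac)
  then show ?thesis using D \<zeta>_cnj[OF k] by simp
qed

lemma inv_sum:
  assumes "norm w < 1"
  shows "(\<Sum>j\<le>d. 1 / (1 - \<zeta> j * w)) = of_nat (d + 1) + w * tsum w" "of_nat (d + 1) + w * tsum w \<noteq> 0"
    "num w / den w = tsum w / (of_nat (d + 1) + w * tsum w)"
proof -
  have f: "full w \<noteq> 0" using full_nz[OF assms] .
  have nz: "1 - \<zeta> j * w \<noteq> 0" if "j \<le> d" for j using f that by (auto simp: full_def)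
  have "(\<Sum>j\<le>d. 1 / (1 - \<zeta> j * w)) = (\<Sum>j\<le>d. 1 + w * (\<zeta> j / (1 - \<zeta> j * w)))"
    using nz by (intro sum.cong refl) (auto simp: divide_simps mult_ac)
  also have "\<dots> = of_nat (d + 1) + w * tsum w" by (simp add: sum.distrib tsum_def sum_distrib_left)
  finally show "(\<Sum>j\<le>d. 1 / (1 - \<zeta> j * w)) = of_nat (d + 1) + w * tsum w" .
  have "den w = full w * (of_nat (d + 1) + w * tsum w)"
    using den_num[of w] num_tsum[OF f] by (simp add: algebra_simps)
  then show "of_nat (d + 1) + w * tsum w \<noteq> 0" "num w / den w = tsum w / (of_nat (d + 1) + w * tsum w)"
    using den_nz[of w] assms num_tsum[OF f] f by auto
qed

lemma deriv_quotient:
  assumes w: "norm w < 1"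
  shows "deriv (\<lambda>w. num w / den w) w =
    (of_nat (d + 1) * (\<Sum>j\<le>d. (\<zeta> j)\<^sup>2 / (1 - \<zeta> j * w)\<^sup>2) - (tsum w)\<^sup>2) / (of_nat (d + 1) + w * tsum w)\<^sup>2"
proof -
  let ?T' = "\<Sum>j\<le>d. (\<zeta> j)\<^sup>2 / (1 - \<zeta> j * w)\<^sup>2"
  have nz: "1 - \<zeta> j * w \<noteq> 0" if "j \<le> d" for j using full_nz[OF w] that by (auto simp: full_def)
  have T: "(tsum has_field_derivative ?T') (at w)"
    unfolding tsum_def using nz
    by (auto intro!: derivative_eq_intros sum.cong simp: power2_eq_square)
  have "((\<lambda>w. tsum w / (of_nat (d + 1) + w * tsum w)) has_field_derivative
      (?T' * (of_nat (d + 1) + w * tsum w) - tsum w * (tsum w + w * ?T')) / (of_nat (d + 1) + w * tsum w)\<^sup>2) (at w)"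
    using inv_sum(2)[OF w] by (auto intro!: derivative_eq_intros T simp: power2_eq_square algebra_simps)
  also have "?T' * (of_nat (d + 1) + w * tsum w) - tsum w * (tsum w + w * ?T') =
      of_nat (d + 1) * ?T' - (tsum w)\<^sup>2" by (simp add: power2_eq_square algebra_simps)
  finally have D: "((\<lambda>w. tsum w / (of_nat (d + 1) + w * tsum w)) has_field_derivative
      (of_nat (d + 1) * ?T' - (tsum w)\<^sup>2) / (of_nat (d + 1) + w * tsum w)\<^sup>2) (at w)" .
  have "\<forall>\<^sub>F x in nhds w. x \<in> ball 0 1" using w by (intro eventually_nhds_in_open) auto
  then have "\<forall>\<^sub>F x in nhds w. num x / den x = tsum x / (of_nat (d + 1) + x * tsum x)"
    by eventually_elim (use inv_sum in auto)
  then have "((\<lambda>w. num w / den w) has_field_derivative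
      (of_nat (d + 1) * ?T' - (tsum w)\<^sup>2) / (of_nat (d + 1) + w * tsum w)\<^sup>2) (at w)"
    using D by (subst DERIV_cong_ev[OF refl _ refl]) auto
  then show ?thesis by (rule DERIV_imp_deriv)
qed

text \<open>The summands are the fixed points after \<open>z\<close> has been moved to the centre,
  and the left side is the pseudo-hyperbolic distance of \<open>f z\<close> and \<open>z\<close>.
  Behind the computation: weights are conformally invariant, so the formula at \<open>z\<close> is
  the one at 0, where \<open>num / den\<close> is the mean of the points.\<close>

lemma displacement:
  assumes z: "norm z < 1" and f: "f z = num (cnj z) / den (cnj z)"
  shows "norm (f z - z) / norm (1 - cnj z * f z) =
    norm (\<Sum>j\<le>d. (\<zeta> j - z) / (1 - \<zeta> j * cnj z)) / real (d + 1)"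
proof -
  let ?w = "cnj z" let ?S = "of_nat (d + 1) + ?w * tsum ?w"
  have w: "norm ?w < 1" using z by simp
  have S: "(\<Sum>j\<le>d. 1 / (1 - \<zeta> j * ?w)) = ?S" "?S \<noteq> 0" "f z = tsum ?w / ?S"
    using inv_sum[OF w] f by auto
  have "(\<Sum>j\<le>d. (\<zeta> j - z) / (1 - \<zeta> j * ?w)) = tsum ?w - z * ?S"
    unfolding S(1)[symmetric] unfolding tsum_def sum_distrib_left sum_subtractf[symmetric]
    by (simp add: diff_divide_distrib)
  moreover have "f z - z = (tsum ?w - z * ?S) / ?S" using S by (simp add: diff_divide_distrib)
  moreover have "1 - ?w * f z = of_nat (d + 1) / ?S"
  proof -
    have "f z * ?S = tsum ?w" using S by simp
    then have "(1 - ?w * f z) * ?S = ?S - ?w * tsum ?w" by (simp only: left_diff_distrib mult.assoc mult_1)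
    also have "\<dots> = of_nat (d + 1)" by simp
    finally show ?thesis using S(2) by (simp only: eq_divide_eq) simp
  qed
  ultimately show ?thesis using S(2)
    by (simp add: norm_divide del: of_nat_Suc of_nat_add)
qed

end

section \<open>The marked fixed point\<close>

lemma circ_add: "circ (s + t) = circ s * circ t"
  by (simp add: circ_def cis_mult distrib_left)

lemma circ_power: "circ t ^ n = circ (real n * t)"
proof -
  have "real n * (2 * pi * t) = 2 * pi * (real n * t)" by simp
  then show ?thesis unfolding circ_def Complex.DeMoivre by (rule arg_cong)
qed

lemma norm_circ [simp]: "norm (circ t) = 1"
  by (simp add: circ_def)

lemma circ_of_int [simp]: "circ (of_int k) = 1"
  by (simp add: circ_def cis_multiple_2pi)

lemma circ_eq_1_iff: "circ t = 1 \<longleftrightarrow> t \<in> \<int>"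
proof
  assume "circ t = 1"
  then have "cos (2 * pi * t) = 1" by (simp add: circ_def complex_eq_iff)
  then obtain n where "2 * pi * t = of_int n * 2 * pi" by (auto simp: cos_one_2pi_int)
  then have "t = of_int n" by simp
  then show "t \<in> \<int>" by simp
qed (auto elim: Ints_cases)

lemma circ_eq_iff: "circ s = circ t \<longleftrightarrow> s - t \<in> \<int>"
proof -
  have "circ s = circ (s - t) * circ t" using circ_add[of "s - t" t] by simp
  moreover have "circ t \<noteq> 0" by (metis norm_circ norm_zero zero_neq_one)
  ultimately show ?thesis using circ_eq_1_iff[of "s - t"] by auto
qed

lemma continuous_on_circ [continuous_intros]:
  "continuous_on S f \<Longrightarrow> continuous_on S (\<lambda>x. circ (f x))"
  unfolding circ_def by (intro continuous_intros)

lemma inner_factor_pos: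
  assumes "norm b < 1" "norm z \<le> 1"
  shows "Re (1 - b * z) > 0"
proof -
  have "norm (b * z) < 1"
    using assms mult_mono[of "norm b" "norm b" "norm z" 1] by (simp add: norm_mult)
  then show ?thesis using complex_Re_le_cmod[of "b * z"] by simp
qed

text \<open>A lift of \<open>z / f z\<close> to the line, so that the fixed points are the integer values.\<close>
definition fix_lift :: "nat \<Rightarrow> (nat \<Rightarrow> complex) \<Rightarrow> real \<Rightarrow> real" where
  "fix_lift d b x = real (d + 1) * x - (\<Sum>i<d - 1. Im (Ln (1 - b i * circ x)) / pi)"

text \<open>On the circle each factor is \<open>cnj z * (w / cnj w)\<close> with
  \<open>w = 1 - b i * z\<close> in the right half-plane, where the principal logarithm is
  continuous. The argument of \<open>w / cnj w\<close> is twice that of \<open>w\<close>, which is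
  \<open>Im (Ln w) / pi\<close> in units of a full turn.\<close>

lemma anti_blaschke_circ:
  assumes "d \<ge> 1" and b: "\<And>i. i < d - 1 \<Longrightarrow> norm (b i) < 1"
  shows "anti_blaschke d b (circ x) = circ (x - fix_lift d b x)"
proof -
  have c: "cnj (circ x) = circ (- x)" by (simp add: circ_def cis_cnj)
  have f: "(cnj (circ x) - b i) / (1 - cnj (b i * circ x)) = circ (- x + Im (Ln (1 - b i * circ x)) / pi)"
    if i: "i < d - 1" for i
  proof -
    define w where "w = 1 - b i * circ x"
    have "Re w > 0" using inner_factor_pos[OF b[OF i], of "circ x"] by (simp add: w_def del: minus_complex.simps)
    then have w: "w \<noteq> 0" by auto
    define r \<theta> where "r = exp (Re (Ln w))" and "\<theta> = Im (Ln w)"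
    have we: "w = of_real r * cis \<theta>"
      using exp_Ln[OF w] unfolding r_def \<theta>_def by (metis exp_eq_polar)
    have "w / cnj w = cis \<theta> / cis (- \<theta>)" unfolding we by (simp add: cis_cnj r_def)
    also have "\<dots> = circ (\<theta> / pi)" by (simp add: cis_divide circ_def)
    finally have q: "w / cnj w = circ (\<theta> / pi)" .
    have "circ (- x) * circ x = 1" using circ_add[of "- x" x] by (simp add: circ_def)
    then have "cnj (circ x) - b i = circ (- x) * w"
      by (simp add: w_def c algebra_simps)
    then have "(cnj (circ x) - b i) / (1 - cnj (b i * circ x)) = circ (- x) * (w / cnj w)"
      by (simp add: w_def)
    then show ?thesis unfolding q circ_add by (simp add: \<theta>_def w_def)
  qed
  have prod: "(\<Prod>i\<in>I. circ (g i)) = circ (\<Sum>i\<in>I. g i)" if "finite I" for I :: "nat set" and g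
    using that by (induction I rule: finite_induct) (simp_all add: circ_add circ_eq_1_iff)
  have "anti_blaschke d b (circ x) = circ (- x) * circ (\<Sum>i<d - 1. - x + Im (Ln (1 - b i * circ x)) / pi)"
    unfolding anti_blaschke_def using f by (simp add: c prod[symmetric])
  also have "\<dots> = circ (x - fix_lift d b x)"
    using assms(1) unfolding circ_add[symmetric] fix_lift_def
    by (simp add: sum.distrib sum_negf sum_subtractf of_nat_diff algebra_simps)
  finally show ?thesis .
qed

lemma fix_lift_int:
  assumes "d \<ge> 1" "\<And>i. i < d - 1 \<Longrightarrow> norm (b i) < 1" "anti_blaschke d b (circ x) = circ x"
  shows "fix_lift d b x \<in> \<int>"
proof -
  have "circ (x - fix_lift d b x) = circ x" using anti_blaschke_circ[of d b x] assms by metis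
  then have "- fix_lift d b x \<in> \<int>" unfolding circ_eq_iff by simp
  then show ?thesis using Ints_minus by fastforce
qed

text \<open>Rotating the zeros translates the argument by \<open>r / (d + 1)\<close>, and the linear
  term \<open>(d + 1) * x\<close> turns this into a shift by the integer \<open>r\<close>.\<close>

lemma fix_lift_rotate:
  assumes "d \<ge> 1"
  shows "fix_lift d (\<lambda>i. circ (real r / real (d + 1)) * b i) x = fix_lift d b (x + real r / real (d + 1)) - real r"
  unfolding fix_lift_def circ_add by (simp add: algebra_simps add_divide_distrib[symmetric]) (simp add: field_simps)

lemma fix_lift_shift: "k \<in> \<int> \<Longrightarrow> fix_lift d b (x + k) = fix_lift d b x + real (d + 1) * k"
  unfolding fix_lift_def circ_add by (auto simp: circ_eq_1_iff[THEN iffD2] algebra_simps)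

text \<open>Continuity of \<open>eta\<close> is given for uniform convergence on the circle; joint
  continuity in parameter and point, with the circle compact, supplies it.\<close>

lemma anti_blaschke_scale_uniform:
  assumes b: "\<And>i. i < d - 1 \<Longrightarrow> norm (b i) < 1"
    and t: "\<And>n. t n \<in> {0..1::real}" "t0 \<in> {0..1}" "t \<longlonglongrightarrow> t0"
  shows "uniform_limit (sphere 0 1) (\<lambda>n. anti_blaschke d (\<lambda>i. of_real (t n) * b i))
    (anti_blaschke d (\<lambda>i. of_real t0 * b i)) sequentially"
proof -
  let ?F = "\<lambda>x. anti_blaschke d (\<lambda>i. of_real (fst x) * b i) (snd x)"
  have nz: "1 - cnj (of_real s * b i * z) \<noteq> 0" if "s \<in> {0..1}" "z \<in> sphere 0 1" "i < d - 1" for s z i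
  proof -
    have "norm (of_real s * b i) < 1"
      using that b[OF that(3)] mult_left_le_one_le[of "norm (b i)" s] by (simp add: norm_mult)
    then have "Re (1 - of_real s * b i * z) > 0" using that by (intro inner_factor_pos) auto
    then show ?thesis by (metis cnj.simps(1) complex_cnj_diff complex_cnj_one less_irrefl zero_complex.simps(1))
  qed
  have cont: "continuous_on ({0..1} \<times> sphere 0 1) ?F"
    unfolding anti_blaschke_def using nz by (intro continuous_intros) (auto simp: split_beta)
  show ?thesis
  proof (rule uniform_limitI)
    fix e :: real assume e: "e > 0"
    obtain X where X: "t0 \<in> X" "open X"
      "\<forall>s \<in> X \<inter> {0..1}. \<forall>z \<in> sphere 0 1. dist (?F (s, z)) (?F (t0, z)) \<le> e / 2"
      using continuous_on_prod_compactE[OF cont compact_sphere t(2), of "e / 2"] e by auto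
    have "\<forall>\<^sub>F n in sequentially. t n \<in> X" using t(3) X(2,1) by (rule topological_tendstoD)
    then show "\<forall>\<^sub>F n in sequentially. \<forall>z\<in>sphere 0 1.
      dist (anti_blaschke d (\<lambda>i. of_real (t n) * b i) z) (anti_blaschke d (\<lambda>i. of_real t0 * b i) z) < e"
    proof eventually_elim
      case (elim n)
      then have "dist (?F (t n, z)) (?F (t0, z)) \<le> e / 2" if "z \<in> sphere 0 1" for z
        using X(3) t(1) that by blast
      then show ?case using e by fastforce
    qed
  qed
qed

text \<open>Along the path \<open>t \<mapsto> f\<^sub>t\<close> scaling the zeros by \<open>t\<close>, the integer \<open>fix_lift\<close> of the
  marked point is constant, and it is 0 for \<open>z \<mapsto> (cnj z)\<^sup>d\<close>.\<close>
lemma fix_lift_eta: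
  assumes d: "d \<ge> 1" and eta: "conjugacy_family d eta"
    and b: "\<And>i. i < d - 1 \<Longrightarrow> norm (b i) < 1"
  shows "fix_lift d b (eta (anti_blaschke d b) 0) = 0"
    "anti_blaschke d b (circ (eta (anti_blaschke d b) 0)) = circ (eta (anti_blaschke d b) 0)"
proof -
  define f where "f t = anti_blaschke d (\<lambda>i. of_real t * b i)" for t :: real
  define g where "g t = eta (f t) 0" for t
  have bt: "norm (of_real t * b i) < 1" if "t \<in> {0..1}" "i < d - 1" for t i
    using that b[OF that(2)] mult_left_le_one_le[of "norm (b i)" t] by (simp add: norm_mult)
  have fB: "f t \<in> Bminus d" if "t \<in> {0..1}" for t
    unfolding f_def using bt[OF that] by (intro anti_blaschke_in_Bminus) auto
  have fixed: "f t (circ (g t)) = circ (g t)" if "t \<in> {0..1}" for t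
  proof -
    have "\<forall>s. circ (eta (f t) (- real d * s)) = f t (circ (eta (f t) s))"
      using eta fB[OF that] unfolding conjugacy_family_def by blast
    then have "circ (eta (f t) (- real d * 0)) = f t (circ (eta (f t) 0))" by blast
    then show ?thesis by (simp add: g_def)
  qed
  have gcont: "continuous_on {0..1} g"
    unfolding continuous_on_sequentially
  proof (intro allI ballI impI, elim conjE)
    fix x t0 assume t: "t0 \<in> {0..1}" "\<forall>n. x n \<in> {0..1::real}" "x \<longlonglongrightarrow> t0"
    have "uniform_limit (sphere 0 1) (\<lambda>n. f (x n)) (f t0) sequentially"
      unfolding f_def using t by (intro anti_blaschke_scale_uniform b) auto
    moreover have "\<forall>n. f (x n) \<in> Bminus d" "f t0 \<in> Bminus d" using fB t by auto
    moreover have "\<forall>fs f. (\<forall>n. fs n \<in> Bminus d) \<and> f \<in> Bminus d \<and>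
        uniform_limit (sphere 0 1) fs f sequentially \<longrightarrow>
        uniform_limit UNIV (\<lambda>n. eta (fs n)) (eta f) sequentially"
      using eta unfolding conjugacy_family_def by (elim conjE)
    ultimately have "uniform_limit UNIV (\<lambda>n. eta (f (x n))) (eta (f t0)) sequentially"
      by (auto dest: spec[of _ "\<lambda>n. f (x n)"])
    from tendsto_uniform_limitI[OF this, of 0] show "(g \<circ> x) \<longlonglongrightarrow> g t0"
      by (simp add: g_def o_def)
  qed
  define \<Psi> where "\<Psi> t = fix_lift d (\<lambda>i. of_real t * b i) (g t)" for t
  have cont: "continuous_on {0..1} \<Psi>"
  proof -
    have "1 - of_real t * b i * circ (g t) \<notin> \<real>\<^sub>\<le>\<^sub>0" if "t \<in> {0..1}" "i < d - 1" for t i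
    proof -
      have "Re (1 - of_real t * b i * circ (g t)) > 0"
        using bt[OF that] by (intro inner_factor_pos) auto
      then show ?thesis by (auto simp: complex_nonpos_Reals_iff)
    qed
    then show ?thesis unfolding \<Psi>_def fix_lift_def by (intro continuous_intros gcont) auto
  qed
  have int: "\<Psi> t \<in> \<int>" if "t \<in> {0..1}" for t
    unfolding \<Psi>_def using bt[OF that] fixed[OF that] by (intro fix_lift_int[OF d]) (auto simp: f_def)
  have "\<Psi> constant_on {0..1}"
  proof (rule continuous_discrete_range_constant[OF _ cont])
    fix t :: real assume t: "t \<in> {0..1}"
    have "1 \<le> norm (\<Psi> s - \<Psi> t)" if "s \<in> {0..1}" "\<Psi> s \<noteq> \<Psi> t" for s
      using int[OF that(1)] int[OF t] that(2) by (auto elim!: Ints_cases simp flip: of_int_diff of_int_abs)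
    then show "\<exists>e>0. \<forall>s. s \<in> {0..1} \<and> \<Psi> s \<noteq> \<Psi> t \<longrightarrow> e \<le> norm (\<Psi> s - \<Psi> t)"
      by (intro exI[of _ 1]) auto
  qed auto
  then have "\<Psi> 1 = \<Psi> 0" unfolding constant_on_def by (metis atLeastAtMost_iff order_refl zero_le_one)
  moreover have "\<Psi> 0 = 0"
  proof -
    have "cnj z * cnj z ^ (d - 1) = cnj z ^ d" for z using d by (cases d) auto
    then have "f 0 = (\<lambda>z. cnj z ^ d)" by (simp add: f_def anti_blaschke_def fun_eq_iff)
    then have "g 0 = 0" using eta by (simp add: g_def conjugacy_family_def)
    then show ?thesis by (simp add: \<Psi>_def fix_lift_def)
  qed
  moreover have f1: "f 1 = anti_blaschke d b" by (simp add: f_def)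
  ultimately show "fix_lift d b (eta (anti_blaschke d b) 0) = 0" by (simp add: \<Psi>_def g_def)
  show "anti_blaschke d b (circ (eta (anti_blaschke d b) 0)) = circ (eta (anti_blaschke d b) 0)"
    using fixed[of 1] f1 by (simp add: g_def)
qed

text \<open>Multiplying the zeros by \<rho> amounts to conjugating by a rotation, up to the constant
  \<open>\<rho> ^ (d + 1)\<close>; roots of unity therefore preserve the normal form.\<close>

lemma anti_blaschke_rotate:
  assumes d: "d \<ge> 1" and \<rho>: "norm \<rho> = 1" "\<rho> ^ (d + 1) = 1"
  shows "anti_blaschke d (\<lambda>i. \<rho> * a i) z = cnj \<rho> * anti_blaschke d a (\<rho> * z)"
proof -
  have r: "\<rho> * cnj \<rho> = 1" using \<rho> by (simp add: complex_norm_square[symmetric])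
  have e: "cnj z - \<rho> * a i = \<rho> * (cnj (\<rho> * z) - a i)" for i
  proof -
    have "\<rho> * (cnj (\<rho> * z) - a i) = (\<rho> * cnj \<rho>) * cnj z - \<rho> * a i" by (simp add: algebra_simps)
    then show ?thesis using r by simp
  qed
  have m: "\<rho> * a i * z = a i * (\<rho> * z)" for i by simp
  have "anti_blaschke d (\<lambda>i. \<rho> * a i) z =
      cnj z * (\<Prod>i<d - 1. \<rho> * ((cnj (\<rho> * z) - a i) / (1 - cnj (a i * (\<rho> * z)))))"
    unfolding anti_blaschke_def m e by simp
  also have "\<dots> = \<rho> ^ (d - 1) * cnj z * (\<Prod>i<d - 1. (cnj (\<rho> * z) - a i) / (1 - cnj (a i * (\<rho> * z))))"
    by (simp only: prod.distrib) simp
  also have "\<rho> ^ (d - 1) * cnj z = cnj \<rho> * cnj (\<rho> * z)"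
  proof -
    have "\<rho> ^ (d - 1) = \<rho> ^ (d - 1) * (\<rho> * cnj \<rho>) * (\<rho> * cnj \<rho>)" using r by simp
    also have "\<dots> = \<rho> ^ (d - 1 + 2) * cnj \<rho> * cnj \<rho>" by (simp only: power_add power2_eq_square mult_ac)
    also have "d - 1 + 2 = d + 1" using d by simp
    finally show ?thesis using \<rho> by simp
  qed
  finally show ?thesis unfolding anti_blaschke_def by (simp only: mult_ac)
qed

lemma unit_points_rotate:
  assumes "unit_points d \<zeta>" "norm \<rho> = 1" "\<rho> ^ (d + 1) = 1"
  shows "unit_points d (\<lambda>j. cnj \<rho> * \<zeta> j)"
    "unit_points.num d (\<lambda>j. cnj \<rho> * \<zeta> j) w = cnj \<rho> * unit_points.num d \<zeta> (cnj \<rho> * w)"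
    "unit_points.den d (\<lambda>j. cnj \<rho> * \<zeta> j) w = unit_points.den d \<zeta> (cnj \<rho> * w)"
proof -
  interpret unit_points d \<zeta> by fact
  have r: "cnj \<rho> ^ (d + 1) = 1" "cnj \<rho> \<noteq> 0"
    using assms(2,3) by (metis complex_cnj_one complex_cnj_power) (use assms(2) in auto)
  show U: "unit_points d (\<lambda>j. cnj \<rho> * \<zeta> j)"
  proof
    show "inj_on (\<lambda>j. cnj \<rho> * \<zeta> j) {..d}" using inj_\<zeta> r by (auto simp: inj_on_def)
    show "(\<Prod>j\<le>d. cnj \<rho> * \<zeta> j) = (- 1) ^ d" using r(1) by (simp add: prod.distrib prod_\<zeta>)
  qed (use d_pos norm_\<zeta> assms(2) sum_\<zeta> in \<open>auto simp: norm_mult sum_distrib_left[symmetric]\<close>)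
  interpret R: unit_points d "\<lambda>j. cnj \<rho> * \<zeta> j" by fact
  have "R.others j w = others j (cnj \<rho> * w)" for j
    unfolding R.others_def others_def by (simp add: mult_ac)
  then show "R.num w = cnj \<rho> * num (cnj \<rho> * w)" "R.den w = den (cnj \<rho> * w)"
    unfolding R.num_def num_def R.den_def den_def by (simp_all add: sum_distrib_left mult_ac)
qed

text \<open>Rotated back to the original map, the marked point of the \<open>r\<close>-th rotated
  map has \<open>fix_lift\<close> equal to \<open>r\<close>. Moving once around the circle changes
  this value by \<open>d + 1\<close>, so the \<open>d + 1\<close> rotations give distinct fixed
  points and exhaust them; one of them gives \<open>\<zeta> 0\<close>.\<close>

lemma marked_rotation:
  assumes U: "unit_points d \<zeta>" and eta: "conjugacy_family d eta"
  obtains \<rho> f where "norm \<rho> = 1" "unit_points d (\<lambda>j. \<rho> * \<zeta> j)" "f \<in> Bminus d"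
    "\<And>z. f z = unit_points.num d (\<lambda>j. \<rho> * \<zeta> j) (cnj z) / unit_points.den d (\<lambda>j. \<rho> * \<zeta> j) (cnj z)"
    "circ (eta f 0) = \<rho> * \<zeta> 0"
proof -
  interpret unit_points d \<zeta> by fact
  obtain a where a: "\<And>i. i < d - 1 \<Longrightarrow> norm (a i) < 1"
    "\<And>z. anti_blaschke d a z = num (cnj z) / den (cnj z)"
    using anti_blaschke_points by metis
  define \<rho> where "\<rho> r = circ (real r / real (d + 1))" for r
  have \<rho>: "norm (\<rho> r) = 1" "\<rho> r ^ (d + 1) = 1" "\<rho> r * cnj (\<rho> r) = 1" for r
  proof -
    show n: "norm (\<rho> r) = 1" by (simp add: \<rho>_def)
    show "\<rho> r ^ (d + 1) = 1"
      using circ_of_int[of "int r"] by (simp add: \<rho>_def circ_power del: power_Suc circ_of_int)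
    show "\<rho> r * cnj (\<rho> r) = 1" using n by (simp add: complex_norm_square[symmetric])
  qed
  have b: "norm (\<rho> r * a i) < 1" if "i < d - 1" for r i
    using a(1)[OF that] \<rho>(1) by (simp add: norm_mult)
  define f where "f r = anti_blaschke d (\<lambda>i. \<rho> r * a i)" for r
  define y where "y r = eta (f r) 0 + real r / real (d + 1)" for r
  have circ_y: "circ (y r) = \<rho> r * circ (eta (f r) 0)" for r
    by (simp add: y_def \<rho>_def circ_add)
  have fl: "fix_lift d a (y r) = real r" for r
  proof -
    have "fix_lift d (\<lambda>i. \<rho> r * a i) (eta (f r) 0) = 0"
      unfolding f_def by (rule fix_lift_eta(1)[OF d_pos eta b])
    then show ?thesis unfolding \<rho>_def fix_lift_rotate[OF d_pos] y_def by simp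
  qed
  have f_alt: "f r z = cnj (\<rho> r) * (num (cnj (\<rho> r) * cnj z) / den (cnj (\<rho> r) * cnj z))" for r z
    unfolding f_def anti_blaschke_rotate[OF d_pos \<rho>(1,2)] a(2) by simp
  have yfix: "\<exists>k\<le>d. circ (y r) = \<zeta> k" for r
  proof -
    have "f r (circ (eta (f r) 0)) = circ (eta (f r) 0)"
      unfolding f_def by (rule fix_lift_eta(2)[OF d_pos eta b])
    then have "\<rho> r * f r (circ (eta (f r) 0)) = circ (y r)" by (simp add: circ_y)
    moreover have "\<rho> r * f r (circ (eta (f r) 0)) = num (cnj (circ (y r))) / den (cnj (circ (y r)))"
      using \<rho>(3)[of r] by (subst f_alt) (simp add: circ_y mult.assoc[symmetric])
    ultimately show ?thesis using fixed_iff[of "circ (y r)"] by simp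
  qed
  have "inj_on (\<lambda>r. circ (y r)) {..d}"
  proof (rule inj_onI)
    fix r s assume rs: "r \<in> {..d}" "s \<in> {..d}" "circ (y r) = circ (y s)"
    then have "y r - y s \<in> \<int>" by (simp add: circ_eq_iff)
    then obtain k where k: "y r = y s + of_int k" by (auto elim!: Ints_cases simp: algebra_simps)
    then have "real r = fix_lift d a (y s + of_int k)" using fl[of r] by simp
    also have "\<dots> = real s + real (d + 1) * of_int k"
      using fix_lift_shift[of "of_int k" d a "y s"] fl[of s] by simp
    finally have "real r = real s + real (d + 1) * of_int k" .
    then have eq: "int r = int s + (int d + 1) * k"
      by (metis (mono_tags, opaque_lifting) of_int_add of_int_eq_iff of_int_mult of_int_of_nat_eq of_nat_add of_nat_1)
    have "k = 0"
    proof (rule ccontr)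
      assume "k \<noteq> 0"
      then have "k \<ge> 1 \<or> k \<le> -1" by linarith
      then have "(int d + 1) * k \<ge> int d + 1 \<or> (int d + 1) * k \<le> - (int d + 1)"
        using mult_left_mono[of 1 k "int d + 1"] mult_left_mono[of k "-1" "int d + 1"] by auto
      moreover have "int r \<le> int d" "int s \<le> int d" using rs(1,2) by auto
      ultimately show False using eq by linarith
    qed
    then show "r = s" using eq by simp
  qed
  moreover have "(\<lambda>r. circ (y r)) ` {..d} \<subseteq> \<zeta> ` {..d}" using yfix by fastforce
  moreover have "card (\<zeta> ` {..d}) = card {..d}" by (rule card_image[OF inj_\<zeta>])
  ultimately have "(\<lambda>r. circ (y r)) ` {..d} = \<zeta> ` {..d}"
    by (intro card_subset_eq) (auto simp: card_image)
  then have "\<zeta> 0 \<in> (\<lambda>r. circ (y r)) ` {..d}" by auto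
  then obtain r where r: "circ (y r) = \<zeta> 0" by auto
  have "cnj (\<rho> r) * \<zeta> 0 = circ (eta (f r) 0)"
    using \<rho>(3)[of r] unfolding r[symmetric] circ_y by (simp add: mult_ac)
  moreover have "f r \<in> Bminus d" unfolding f_def by (intro anti_blaschke_in_Bminus b)
  ultimately show thesis
    using that[of "cnj (\<rho> r)" "f r"] unit_points_rotate[OF U \<rho>(1,2)] \<rho>(1) f_alt by simp
qed

section \<open>The conformal barycentre\<close>

text \<open>The barycentre maximizes the product of the Poisson kernels of the points \<open>x j\<close> and of \<open>\<infinity>\<close>.\<close>
lemma conformal_barycenter:
  fixes x :: "nat \<Rightarrow> real"
  assumes d: "d \<ge> 2" and inj: "inj_on x {1..d}"
  obtains p where "Im p > 0" "(\<Sum>j\<in>{1..d}. (of_real (x j) - p) / (of_real (x j) - cnj p)) = - 1"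
proof -
  define nn where "nn j q = (Re q - x j)\<^sup>2 + (Im q)\<^sup>2" for j and q :: complex
  have nn: "nn j q = (norm (q - of_real (x j)))\<^sup>2" for j q
    unfolding nn_def cmod_power2 by simp
  \<comment> \<open>Up to constants the kernel of \<open>x j\<close> is \<open>Im q / nn j q\<close>
    and that of infinity is \<open>Im q\<close>; \<open>L\<close> is the logarithm of their
    product.\<close>
  define L where "L q = real (d + 1) * ln (Im q) - (\<Sum>j\<in>{1..d}. ln (nn j q))" for q :: complex
  have nn_pos: "nn j q > 0" if "Im q > 0" for j q using that by (auto simp: nn_def add_nonneg_pos)
  define c where "c = L \<i>"
  obtain M where M: "\<And>j. j \<in> {1..d} \<Longrightarrow> \<bar>x j\<bar> \<le> M" "M \<ge> 1"
  proof
    show "\<bar>x j\<bar> \<le> 1 + (\<Sum>j\<in>{1..d}. \<bar>x j\<bar>)" if "j \<in> {1..d}" for j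
      using member_le_sum[of j "{1..d}" "\<lambda>j. \<bar>x j\<bar>"] that by simp
    show "1 + (\<Sum>j\<in>{1..d}. \<bar>x j\<bar>) \<ge> 1" by (simp add: sum_nonneg)
  qed
  \<comment> \<open>For large \<open>q\<close> the function \<open>L\<close> is at most a constant
    minus \<open>(d - 1) * ln (norm q)\<close>, so \<open>d \<ge> 2\<close> bounds the set where it
    is at least \<open>c\<close>.\<close>
  have bounded: "norm q \<le> max (2 * M) (exp (2 * real d * ln 2 - c))" if q: "Im q > 0" "L q \<ge> c" for q
  proof (rule ccontr)
    assume "\<not> ?thesis"
    then have big: "norm q > 2 * M" "norm q > exp (2 * real d * ln 2 - c)" by auto
    then have n1: "norm q > 1" using M(2) by simp
    then have q0: "q \<noteq> 0" by auto
    have "2 * ln (norm q) - 2 * ln 2 \<le> ln (nn j q)" if "j \<in> {1..d}" for j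
    proof -
      have "norm (q - of_real (x j)) \<ge> norm q / 2"
        using norm_triangle_ineq2[of q "of_real (x j)"] M(1)[OF that] big(1) by simp
      then have "nn j q \<ge> (norm q / 2)\<^sup>2" unfolding nn by (intro power_mono) auto
      then have "ln (nn j q) \<ge> ln ((norm q / 2)\<^sup>2)" using n1 by (intro ln_mono) auto
      also have "ln ((norm q / 2)\<^sup>2) = 2 * (ln (norm q) - ln 2)" using n1 q0 by (simp add: ln_realpow ln_div)
      finally show ?thesis by simp
    qed
    then have "(\<Sum>j\<in>{1..d}. 2 * ln (norm q) - 2 * ln 2) \<le> (\<Sum>j\<in>{1..d}. ln (nn j q))" by (intro sum_mono)
    moreover have "ln (Im q) \<le> ln (norm q)" using q abs_Im_le_cmod[of q] by (intro ln_mono) auto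
    then have "real (d + 1) * ln (Im q) \<le> real (d + 1) * ln (norm q)" by (intro mult_left_mono) auto
    moreover have "(\<Sum>j\<in>{1..d}. 2 * ln (norm q) - 2 * ln 2) = real d * (2 * ln (norm q) - 2 * ln 2)" by simp
    ultimately have "c \<le> real (d + 1) * ln (norm q) - real d * (2 * ln (norm q) - 2 * ln 2)"
      using q(2) unfolding L_def by linarith
    also have "\<dots> = 2 * real d * ln 2 - (real d - 1) * ln (norm q)" by (simp add: algebra_simps)
    also have "\<dots> \<le> 2 * real d * ln 2 - 1 * ln (norm q)"
      using d n1 by (intro diff_left_mono mult_right_mono) auto
    finally have "ln (norm q) \<le> 2 * real d * ln 2 - c" by simp
    then have "norm q \<le> exp (2 * real d * ln 2 - c)" using q0
      by (metis exp_le_cancel_iff exp_ln zero_less_norm_iff)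
    then show False using big by simp
  qed
  define P where "P = {q \<in> {1..d} \<times> {1..d}. fst q \<noteq> snd q}"
  define S where "S = insert 1 ((\<lambda>q. \<bar>x (fst q) - x (snd q)\<bar>) ` P)"
  define \<delta> where "\<delta> = Min S / 2"
  have "finite P" unfolding P_def by (rule finite_subset[of _ "{1..d} \<times> {1..d}"]) auto
  then have finS: "finite S" by (simp add: S_def)
  have "\<forall>s\<in>S. s > 0"
  proof
    fix s assume "s \<in> S"
    then have "s = 1 \<or> (\<exists>q\<in>P. s = \<bar>x (fst q) - x (snd q)\<bar>)" unfolding S_def by blast
    then show "s > 0"
    proof (elim disjE bexE)
      fix q assume q: "q \<in> P" "s = \<bar>x (fst q) - x (snd q)\<bar>"
      then have "x (fst q) \<noteq> x (snd q)" using inj_onD[OF inj, of "fst q" "snd q"] by (auto simp: P_def)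
      then show ?thesis using q by simp
    qed simp
  qed
  moreover have "Min S \<in> S" using finS by (intro Min_in) (auto simp: S_def)
  ultimately have "Min S > 0" by blast
  moreover have "\<bar>x j - x k\<bar> \<ge> Min S" if "j \<in> {1..d}" "k \<in> {1..d}" "j \<noteq> k" for j k
  proof -
    have "(j, k) \<in> P" using that by (simp add: P_def)
    then have "\<bar>x j - x k\<bar> \<in> S" unfolding S_def by (intro insertI2 image_eqI[of _ _ "(j, k)"]) auto
    then show ?thesis using finS by (rule Min_le[rotated])
  qed
  ultimately have \<delta>: "\<delta> > 0" "\<And>j k. j \<in> {1..d} \<Longrightarrow> k \<in> {1..d} \<Longrightarrow> j \<noteq> k \<Longrightarrow> \<bar>x j - x k\<bar> \<ge> 2 * \<delta>"
    by (auto simp: \<delta>_def)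
  \<comment> \<open>At most one \<open>x j\<close> is within \<delta> of \<open>q\<close>. It costs
    \<open>2 * ln (Im q)\<close> of the available \<open>(d + 1) * ln (Im q)\<close>, and the rest
    still tends to minus infinity at the real line.\<close>
  have high: "Im q \<ge> min 1 (exp (c + 2 * (real d - 1) * ln \<delta>))" if q: "Im q > 0" "L q \<ge> c" for q
  proof (rule ccontr)
    assume "\<not> ?thesis"
    then have low: "Im q < 1" "Im q < exp (c + 2 * (real d - 1) * ln \<delta>)" by auto
    obtain j0 where j0: "j0 \<in> {1..d}" "\<And>j. j \<in> {1..d} \<Longrightarrow> j \<noteq> j0 \<Longrightarrow> norm (q - of_real (x j)) \<ge> \<delta>"
    proof (cases "\<exists>j0\<in>{1..d}. norm (q - of_real (x j0)) < \<delta>")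
      case True
      then obtain j0 where j0: "j0 \<in> {1..d}" "norm (q - of_real (x j0)) < \<delta>" by auto
      have "norm (q - of_real (x j)) \<ge> \<delta>" if "j \<in> {1..d}" "j \<noteq> j0" for j
      proof -
        have "norm (of_real (x j) - of_real (x j0) :: complex) = \<bar>x j - x j0\<bar>"
          by (metis norm_of_real of_real_diff)
        then have "2 * \<delta> \<le> norm (of_real (x j) - of_real (x j0) :: complex)"
          using \<delta>(2)[OF that(1) j0(1) that(2)] by simp
        also have "\<dots> \<le> norm (q - of_real (x j0)) + norm (q - of_real (x j))"
          using norm_triangle_ineq4[of "q - of_real (x j0)" "q - of_real (x j)"] by simp
        finally show ?thesis using j0(2) by simp
      qed
      then show ?thesis using that j0 by blast
    next
      case False
      then show ?thesis using that[of 1] d by force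
    qed
    have "2 * ln \<delta> \<le> ln (nn j q)" if "j \<in> {1..d} - {j0}" for j
    proof -
      have "nn j q \<ge> \<delta>\<^sup>2" unfolding nn using j0(2) that \<delta>(1) by (intro power_mono) auto
      then have "ln (nn j q) \<ge> ln (\<delta>\<^sup>2)" using \<delta>(1) by (intro ln_mono) auto
      then show ?thesis using \<delta>(1) by (simp add: ln_realpow)
    qed
    then have "(\<Sum>j\<in>{1..d} - {j0}. 2 * ln \<delta>) \<le> (\<Sum>j\<in>{1..d} - {j0}. ln (nn j q))" by (intro sum_mono)
    moreover have "(\<Sum>j\<in>{1..d} - {j0}. 2 * ln \<delta>) = 2 * (real d - 1) * ln \<delta>"
      using j0(1) d by (simp add: of_nat_diff)
    moreover have "ln (nn j0 q) \<ge> 2 * ln (Im q)"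
    proof -
      have "nn j0 q \<ge> (Im q)\<^sup>2" by (simp add: nn_def)
      then have "ln (nn j0 q) \<ge> ln ((Im q)\<^sup>2)" using q(1) by (intro ln_mono) auto
      then show ?thesis using q(1) by (simp add: ln_realpow)
    qed
    moreover have "(\<Sum>j\<in>{1..d}. ln (nn j q)) = ln (nn j0 q) + (\<Sum>j\<in>{1..d} - {j0}. ln (nn j q))"
      using j0(1) by (intro sum.remove) auto
    ultimately have "c \<le> real (d + 1) * ln (Im q) - (2 * ln (Im q) + 2 * (real d - 1) * ln \<delta>)"
      using q(2) unfolding L_def by linarith
    also have "\<dots> = (real d - 1) * ln (Im q) - 2 * (real d - 1) * ln \<delta>" by (simp add: algebra_simps)
    also have "\<dots> \<le> 1 * ln (Im q) - 2 * (real d - 1) * ln \<delta>"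
      using d low(1) q(1) by (intro diff_right_mono mult_right_mono_neg) auto
    finally have "c + 2 * (real d - 1) * ln \<delta> \<le> ln (Im q)" by simp
    then have "exp (c + 2 * (real d - 1) * ln \<delta>) \<le> Im q" using q(1) by (simp add: ln_ge_iff)
    then show False using low by simp
  qed
  define R y0 where "R = max (2 * M) (exp (2 * real d * ln 2 - c))"
    and "y0 = min 1 (exp (c + 2 * (real d - 1) * ln \<delta>))"
  define K where "K = cball 0 R \<inter> {q. Im q \<ge> y0}"
  have y0: "y0 > 0" by (simp add: y0_def)
  have comp: "compact K" unfolding K_def by (intro compact_Int_closed compact_cball closed_halfspace_Im_ge)
  have inK: "q \<in> K" if "Im q > 0" "L q \<ge> c" for q
    using bounded[OF that] high[OF that] by (simp add: K_def R_def y0_def)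
  have "continuous_on K L"
    unfolding L_def nn_def using y0
    by (intro continuous_intros) (auto simp: K_def sum_power2_eq_zero_iff)
  moreover have iK: "\<i> \<in> K" by (intro inK) (auto simp: c_def)
  ultimately obtain p where p: "p \<in> K" "\<And>q. q \<in> K \<Longrightarrow> L q \<le> L p"
    using continuous_attains_sup[OF comp] by (metis empty_iff)
  have ip: "Im p > 0" using p(1) y0 by (auto simp: K_def)
  have max: "L q \<le> L p" if "Im q > 0" for q
    using inK[OF that] p(2)[of q] p(2)[OF iK] by (cases "L q \<ge> c") (auto simp: c_def)
  let ?n = "\<lambda>j. nn j p"
  have n0: "?n j \<noteq> 0" for j using nn_pos[OF ip, of j] by simp
  \<comment> \<open>The horizontal derivative at the maximum gives the imaginary part of the
    barycentre equation, the vertical one its real part. The value is \<open>- 1\<close> because the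
    marked point at infinity contributes 1.\<close>
  have h: "(\<Sum>j\<in>{1..d}. 2 * (Re p - x j) / ?n j) = 0"
  proof -
    have D: "((\<lambda>t. L (Complex (Re p + t) (Im p))) has_real_derivative - (\<Sum>j\<in>{1..d}. 2 * (Re p - x j) / ?n j)) (at 0)"
      unfolding L_def nn_def
      using n0 nn_pos[OF ip] by (auto intro!: derivative_eq_intros sum.cong simp: nn_def power2_eq_square)
    have "- (\<Sum>j\<in>{1..d}. 2 * (Re p - x j) / ?n j) = 0"
      by (rule DERIV_local_max[OF D, of 1]) (use max ip in \<open>auto simp: complex_eq_iff\<close>)
    then show ?thesis by simp
  qed
  have v: "(\<Sum>j\<in>{1..d}. 2 * Im p / ?n j) = real (d + 1) / Im p"
  proof -
    have D: "((\<lambda>t. L (Complex (Re p) (Im p + t))) has_real_derivative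
        real (d + 1) / Im p - (\<Sum>j\<in>{1..d}. 2 * Im p / ?n j)) (at 0)"
      unfolding L_def nn_def
      using n0 nn_pos[OF ip] ip by (auto intro!: derivative_eq_intros sum.cong simp: nn_def power2_eq_square)
    have "real (d + 1) / Im p - (\<Sum>j\<in>{1..d}. 2 * Im p / ?n j) = 0"
      by (rule DERIV_local_max[OF D, of "Im p"]) (use max ip in \<open>auto simp: complex_eq_iff\<close>)
    then show ?thesis by simp
  qed
  have summand: "(of_real (x j) - p) / (of_real (x j) - cnj p) =
      Complex (1 - Im p * (2 * Im p / ?n j)) (Im p * (2 * (Re p - x j) / ?n j))" for j
  proof -
    have "of_real (x j) - cnj p \<noteq> 0" using ip by (auto simp: complex_eq_iff)
    moreover have "of_real (x j) - p =
      Complex (1 - Im p * (2 * Im p / ?n j)) (Im p * (2 * (Re p - x j) / ?n j)) * (of_real (x j) - cnj p)"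
      using n0[of j] by (simp add: complex_eq_iff field_simps) (simp add: nn_def power2_eq_square algebra_simps)
    ultimately show ?thesis by (simp add: divide_eq_eq)
  qed
  have "(\<Sum>j\<in>{1..d}. (of_real (x j) - p) / (of_real (x j) - cnj p)) =
      Complex (real d - Im p * (\<Sum>j\<in>{1..d}. 2 * Im p / ?n j)) (Im p * (\<Sum>j\<in>{1..d}. 2 * (Re p - x j) / ?n j))"
    unfolding summand by (simp add: complex_eq_iff sum_subtractf sum_distrib_left)
  also have "\<dots> = - 1" unfolding h v using ip by (simp add: complex_eq_iff)
  finally show thesis using that ip by blast
qed

definition circle_point :: "complex \<Rightarrow> complex \<Rightarrow> (nat \<Rightarrow> real) \<Rightarrow> nat \<Rightarrow> complex" where
  "circle_point u p x j = (if j = 0 then u else cayley u p (of_real (x j)))"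

text \<open>Two rotations follow the Moebius map: \<open>u1\<close>, a root of order
  \<open>d + 1\<close>, corrects the product of the points, and \<rho> moves the marking. Both
  preserve barycentre 0 and are absorbed into \<open>u\<close>.\<close>

lemma marked_configuration:
  assumes d: "d \<ge> 2" and inj: "inj_on x {1..d}" and eta: "conjugacy_family d eta"
  obtains u p f where "half_plane_chart u p" "unit_points d (circle_point u p x)" "f \<in> Bminus d"
    "\<And>z. f z = unit_points.num d (circle_point u p x) (cnj z) / unit_points.den d (circle_point u p x) (cnj z)"
    "circ (eta f 0) = u"
proof -
  obtain p where p: "Im p > 0" "(\<Sum>j\<in>{1..d}. (of_real (x j) - p) / (of_real (x j) - cnj p)) = - 1"
    using conformal_barycenter[OF d inj] .
  define y where "y j = (if j = 0 then 1 else (of_real (x j) - p) / (of_real (x j) - cnj p))" for j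
  interpret C1: half_plane_chart 1 p using p by unfold_locales auto
  have y: "y = circle_point 1 p x" by (auto simp: y_def circle_point_def cayley_def)
  have ny: "norm (y j) = 1" for j
    unfolding y circle_point_def using C1.A_sphere by simp
  have injy: "inj_on y {..d}"
  proof (rule inj_onI)
    fix j k assume jk: "j \<in> {..d}" "k \<in> {..d}" "y j = y k"
    have "x j = x k" if "j \<noteq> 0" "k \<noteq> 0"
    proof -
      have "cayley 1 p (of_real (x j)) = cayley 1 p (of_real (x k))"
        using jk(3) that by (simp add: y circle_point_def)
      then have "of_real (x j) = (of_real (x k) :: complex)" by (rule C1.A_inj[rotated 2]) auto
      then show ?thesis by simp
    qed
    moreover have "j = 0 \<longleftrightarrow> k = 0"
    proof -
      have ne: "cayley 1 p (of_real t) \<noteq> 1" for t by (rule C1.A_neq_u) simp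
      then have "1 \<noteq> cayley 1 p (of_real t)" for t by metis
      then show ?thesis using jk(3) ne unfolding y circle_point_def by (metis (full_types))
    qed
    ultimately show "j = k"
      using jk(1,2) inj_onD[OF inj, of j k] by (cases "j = 0") auto
  qed
  have ins: "{..d} = insert 0 {1..d}" by auto
  have sumy: "(\<Sum>j\<le>d. y j) = 0"
  proof -
    have "(\<Sum>j\<in>{1..d}. y j) = - 1" using p(2) by (simp add: y_def)
    then show ?thesis unfolding ins by (simp add: y_def)
  qed
  define c where "c = (- 1) ^ d / (\<Prod>j\<le>d. y j)"
  have np: "norm (\<Prod>j\<le>d. y j) = 1" by (simp add: prod_norm[symmetric] ny)
  then have nc: "norm c = 1" by (simp add: c_def norm_divide norm_power)
  obtain t where t: "c = circ t"
  proof -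
    have "c \<noteq> 0" using nc by auto
    then have "c = cis (Arg c)" using nc by (simp add: cis_Arg sgn_div_norm)
    then have "c = circ (Arg c / (2 * pi))" by (simp add: circ_def)
    then show thesis using that by blast
  qed
  define u1 where "u1 = circ (t / real (d + 1))"
  have u1: "norm u1 = 1" "u1 ^ (d + 1) = c"
    unfolding u1_def circ_power t by (simp_all del: of_nat_Suc of_nat_add)
  have U1: "unit_points d (\<lambda>j. u1 * y j)"
  proof
    show "inj_on (\<lambda>j. u1 * y j) {..d}" using injy u1(1) by (auto simp: inj_on_def)
    show "(\<Prod>j\<le>d. u1 * y j) = (- 1) ^ d"
    proof -
      have "(\<Prod>j\<le>d. u1 * y j) = u1 ^ (d + 1) * (\<Prod>j\<le>d. y j)" by (simp add: prod.distrib)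
      also have "\<dots> = c * (\<Prod>j\<le>d. y j)" by (simp only: u1)
      also have "\<dots> = (- 1) ^ d"
      proof -
        have "(\<Prod>j\<le>d. y j) \<noteq> 0" using np by (metis norm_zero zero_neq_one)
        then show ?thesis by (simp only: c_def nonzero_divide_eq_eq) simp
      qed
      finally show ?thesis .
    qed
  qed (use d ny u1 sumy in \<open>auto simp: norm_mult sum_distrib_left[symmetric]\<close>)
  obtain \<rho> f where \<rho>: "norm \<rho> = 1" "unit_points d (\<lambda>j. \<rho> * (u1 * y j))" "f \<in> Bminus d"
    "\<And>z. f z = unit_points.num d (\<lambda>j. \<rho> * (u1 * y j)) (cnj z) / unit_points.den d (\<lambda>j. \<rho> * (u1 * y j)) (cnj z)"
    "circ (eta f 0) = \<rho> * (u1 * y 0)"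
    using marked_rotation[OF U1 eta] by metis
  have eq: "(\<lambda>j. \<rho> * (u1 * y j)) = circle_point (\<rho> * u1) p x"
    by (auto simp: fun_eq_iff y_def circle_point_def cayley_def)
  have "half_plane_chart (\<rho> * u1) p" using p \<rho>(1) u1(1) by unfold_locales (auto simp: norm_mult)
  then show thesis using that \<rho>(2-5) unfolding eq by (auto simp: y_def)
qed

section \<open>Counting critical points\<close>

text \<open>Conjugation permutes the roots with their multiplicities and fixes none of them, so half
  of them lie below the real line.\<close>

lemma real_poly_half_roots:
  fixes Q :: "complex poly"
  assumes real: "\<And>z. poly Q (cnj z) = cnj (poly Q z)"
    and nz: "\<And>t. poly Q (of_real t) \<noteq> 0" and deg: "degree Q = 2 * n"
  shows "(\<Sum>z | Im z < 0 \<and> poly Q z = 0. order z Q) = n"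
proof -
  define R where "R = smult (cnj (lead_coeff Q)) (\<Prod>x\<in>#image_mset cnj (proots Q). [:- x, 1:])"
  have Q0: "Q \<noteq> 0" using nz[of 0] by auto
  have "poly R z = poly Q z" for z
  proof -
    have p: "cnj (\<Prod>x\<in>#M. cnj z - x) = (\<Prod>x\<in>#M. z - cnj x)" for M by (induction M) auto
    have pp: "poly (\<Prod>x\<in>#M. [:- f x, 1:]) w = (\<Prod>x\<in>#M. w - f x)" for M w and f :: "complex \<Rightarrow> complex"
      by (induction M) (auto simp: algebra_simps)
    have "poly Q (cnj z) = lead_coeff Q * (\<Prod>x\<in>#proots Q. cnj z - x)"
      using pp[of "\<lambda>x. x" "proots Q" "cnj z"] arg_cong[OF complex_poly_decompose_multiset[of Q], of "\<lambda>q. poly q (cnj z)"] by simp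
    then have "cnj (poly Q (cnj z)) = cnj (lead_coeff Q) * (\<Prod>x\<in>#proots Q. z - cnj x)" using p by simp
    also have "\<dots> = poly R z" using pp[of cnj "proots Q" z] by (simp add: R_def multiset.map_comp o_def)
    finally show ?thesis using real by simp
  qed
  then have "R = Q" by (simp add: poly_eq_poly_eq_iff[symmetric] fun_eq_iff)
  moreover have "proots R = image_mset cnj (proots Q)"
  proof -
    have "proots R = proots (\<Prod>x\<in>#image_mset cnj (proots Q). [:- x, 1:])"
      unfolding R_def using Q0 by (intro proots_smult) auto
    also have "\<dots> = image_mset cnj (proots Q)"
    proof -
      have "proots (\<Prod>x\<in>#M. [:- x, 1:]) = M" for M :: "complex multiset"
      proof (induction M)
        case (add x M)
        have "(\<Prod>x\<in>#M. [:- x, 1:]) \<noteq> 0" by (auto simp: prod_mset_zero_iff)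
        then have "proots ([:- x, 1:] * (\<Prod>x\<in>#M. [:- x, 1:])) = proots [:- x, 1:] + proots (\<Prod>x\<in>#M. [:- x, 1:])"
          by (intro proots_mult) auto
        then show ?case using add by (simp del: mult_pCons_left)
      qed auto
      then show ?thesis .
    qed
    finally show ?thesis .
  qed
  ultimately have sym: "image_mset cnj (proots Q) = proots Q" by simp
  have "size (filter_mset (\<lambda>z. Im z > 0) (image_mset cnj (proots Q))) = size (filter_mset (\<lambda>z. Im z < 0) (proots Q))"
    by (simp add: filter_mset_image_mset)
  then have eq: "size (filter_mset (\<lambda>z. Im z > 0) (proots Q)) = size (filter_mset (\<lambda>z. Im z < 0) (proots Q))"
    unfolding sym .
  have noreal: "Im z \<noteq> 0" if "z \<in># proots Q" for z
  proof
    assume "Im z = 0"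
    then have "of_real (Re z) = z" by (simp add: complex_eq_iff)
    then show False using nz[of "Re z"] that Q0 by simp
  qed
  have "proots Q = filter_mset (\<lambda>z. Im z > 0) (proots Q) + filter_mset (\<lambda>z. \<not> Im z > 0) (proots Q)"
    by (rule multiset_partition)
  moreover have "filter_mset (\<lambda>z. \<not> Im z > 0) (proots Q) = filter_mset (\<lambda>z. Im z < 0) (proots Q)"
    using noreal by (intro filter_mset_cong) force+
  ultimately have "size (proots Q) = 2 * size (filter_mset (\<lambda>z. Im z < 0) (proots Q))"
    using eq by (metis mult_2 size_union)
  then have n: "size (filter_mset (\<lambda>z. Im z < 0) (proots Q)) = n" using deg by (simp add: size_proots_complex)
  have "size (filter_mset (\<lambda>z. Im z < 0) (proots Q)) =
      (\<Sum>z\<in>set_mset (filter_mset (\<lambda>z. Im z < 0) (proots Q)). count (filter_mset (\<lambda>z. Im z < 0) (proots Q)) z)"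
    by (simp add: size_multiset_overloaded_eq)
  also have "\<dots> = (\<Sum>z | Im z < 0 \<and> poly Q z = 0. order z Q)"
    using Q0 by (intro sum.cong) auto
  finally show ?thesis using n by simp
qed

text \<open>Up to a nonvanishing factor this is the derivative of the rational map
  \<open>w \<mapsto> w - M / (\<Sum>j. 1 / (w - X j))\<close> whose complex conjugate is the anti-Blaschke product.\<close>
definition crit_form :: "real \<Rightarrow> 'a set \<Rightarrow> ('a \<Rightarrow> real) \<Rightarrow> complex \<Rightarrow> complex" where
  "crit_form M J X w = (\<Sum>j\<in>J. 1 / (w - of_real (X j)))\<^sup>2 - of_real M * (\<Sum>j\<in>J. 1 / (w - of_real (X j))\<^sup>2)"

text \<open>Clearing denominators leaves a real polynomial \<open>Q\<close> of degree
  \<open>2 * n\<close>, where \<open>n\<close> is one less than the number of distinct points;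
  points indexed by \<open>J\<close> may coincide, as they do in the limit. The leading coefficient
  is \<open>card J * (card J - M)\<close>. At a real point Cauchy-Schwarz bounds the square of the
  sum by \<open>card J\<close> times the sum of squares, so \<open>card J < M\<close> excludes real
  roots. The local factorization is recorded in order to carry multiplicities through a change of
  variable.\<close>

lemma crit_form_zeros:
  fixes X :: "'a \<Rightarrow> real"
  assumes J: "finite J" "J \<noteq> {}" and M: "real (card J) < M"
  shows "finite {w. Im w < 0 \<and> crit_form M J X w = 0}"
    "(\<Sum>w | Im w < 0 \<and> crit_form M J X w = 0. zorder (crit_form M J X) w) = int (card (X ` J) - 1)"
    "\<And>w0. Im w0 < 0 \<Longrightarrow> \<exists>k S R. open S \<and> w0 \<in> S \<and> R holomorphic_on S \<and> R w0 \<noteq> 0 \<and>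
       zorder (crit_form M J X) w0 = int k \<and> (\<forall>w\<in>S. crit_form M J X w = (w - w0) ^ k * R w)"
proof -
  define K where "K = X ` J"
  define n where "n = card K - 1"
  define P where "P k = (\<Prod>l\<in>K - {k}. [:- of_real l, 1:] :: complex poly)" for k
  define F where "F = (\<Prod>l\<in>K. [:- of_real l, 1:] :: complex poly)"
  define S1 where "S1 = (\<Sum>j\<in>J. P (X j))"
  define S2 where "S2 = (\<Sum>j\<in>J. (P (X j))\<^sup>2)"
  define Q where "Q = S1\<^sup>2 - smult (of_real M) S2"
  have fK: "finite K" "K \<noteq> {}" using J by (auto simp: K_def)
  have PF: "F = [:- of_real k, 1:] * P k" if "k \<in> K" for k
    unfolding F_def P_def using fK that by (intro prod.remove) auto
  have dP: "degree (P k) = n" "lead_coeff (P k) = 1" if "k \<in> K" for k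
  proof -
    show "degree (P k) = n" using fK that by (simp add: P_def n_def degree_prod_sum_eq)
    show "lead_coeff (P k) = 1" unfolding P_def lead_coeff_prod by simp
  qed
  then have cP: "coeff (P k) n = 1" if "k \<in> K" for k using that by metis
  have XK: "X j \<in> K" if "j \<in> J" for j using that by (simp add: K_def)
  have c0: "card J > 0" using J by (simp add: card_gt_0_iff)
  have dS1: "degree S1 = n" "coeff S1 n = of_nat (card J)"
  proof -
    show c: "coeff S1 n = of_nat (card J)" unfolding S1_def coeff_sum using cP XK by simp
    have "degree S1 \<le> n" unfolding S1_def using dP XK J by (intro degree_sum_le) auto
    moreover have "n \<le> degree S1" using c c0 by (intro le_degree) auto
    ultimately show "degree S1 = n" by simp
  qed
  have cS1: "coeff (S1\<^sup>2) (2 * n) = of_nat (card J) ^ 2"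
    using coeff_mult_degree_sum[of S1 S1] dS1 by (simp add: power2_eq_square mult_2)
  have dS2: "degree S2 \<le> 2 * n" "coeff S2 (2 * n) = of_nat (card J)"
  proof -
    have "degree ((P (X j))\<^sup>2) \<le> 2 * n" if "j \<in> J" for j
      using degree_power_le[of "P (X j)" 2] dP[OF XK[OF that]] by (simp add: mult.commute)
    then show "degree S2 \<le> 2 * n" unfolding S2_def using J by (intro degree_sum_le) auto
    have "coeff ((P (X j))\<^sup>2) (2 * n) = 1" if "j \<in> J" for j
      using coeff_mult_degree_sum[of "P (X j)" "P (X j)"] dP[OF XK[OF that]] by (simp add: power2_eq_square mult_2)
    then show "coeff S2 (2 * n) = of_nat (card J)" unfolding S2_def coeff_sum by simp
  qed
  have dQ: "degree Q = 2 * n"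
  proof (rule antisym)
    have "degree (S1\<^sup>2) \<le> 2 * n" using degree_power_le[of S1 2] dS1 by (simp add: mult.commute)
    then show "degree Q \<le> 2 * n" unfolding Q_def using dS2(1)
      by (intro degree_diff_le) (auto intro: order_trans[OF degree_smult_le])
    have "coeff Q (2 * n) = of_real (real (card J) * (real (card J) - M))"
      unfolding Q_def using cS1 dS2(2) by (simp add: power2_eq_square algebra_simps)
    also have "\<dots> \<noteq> 0" unfolding of_real_eq_0_iff using c0 M by simp
    finally show "2 * n \<le> degree Q" by (rule le_degree)
  qed
  have polyP: "poly (P k) w = (\<Prod>l\<in>K - {k}. w - of_real l)" for k w
    by (simp add: P_def poly_prod)
  have cnjP: "poly (P k) (cnj w) = cnj (poly (P k) w)" for k w by (simp add: polyP)
  have realQ: "poly Q (cnj w) = cnj (poly Q w)" for w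
    by (simp add: Q_def S1_def S2_def poly_sum cnjP)
  have nzQ: "poly Q (of_real t) \<noteq> 0" for t
  proof -
    define f where "f j = (\<Prod>l\<in>K - {X j}. t - l)" for j
    have fP: "poly (P (X j)) (of_real t) = of_real (f j)" for j by (simp add: polyP f_def)
    have "poly Q (of_real t) = of_real ((\<Sum>j\<in>J. f j)\<^sup>2 - M * (\<Sum>j\<in>J. (f j)\<^sup>2))"
      by (simp add: Q_def S1_def S2_def poly_sum fP)
    moreover have "(\<Sum>j\<in>J. f j)\<^sup>2 - M * (\<Sum>j\<in>J. (f j)\<^sup>2) < 0"
    proof -
      have "\<exists>j\<in>J. f j \<noteq> 0"
      proof (cases "t \<in> K")
        case True
        then obtain j where "j \<in> J" "t = X j" by (auto simp: K_def)
        then show ?thesis using fK by (intro bexI[of _ j]) (auto simp: f_def)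
      next
        case False
        then show ?thesis using fK J by (auto simp: f_def)
      qed
      then have "(\<Sum>j\<in>J. (f j)\<^sup>2) > 0" using J by (auto intro!: sum_pos2)
      then have "(\<Sum>j\<in>J. (f j)\<^sup>2) * real (card J) < M * (\<Sum>j\<in>J. (f j)\<^sup>2)"
        using M by (simp add: mult.commute)
      then show ?thesis using sum_squared_le_sum_of_squares[of f J] by simp
    qed
    ultimately show ?thesis by (metis of_real_eq_0_iff less_irrefl)
  qed
  have Q0: "Q \<noteq> 0" using nzQ[of 0] by auto
  have Fnz: "poly F w \<noteq> 0" if "Im w < 0" for w
  proof -
    have "w - of_real l \<noteq> 0" for l using that by (auto simp: complex_eq_iff)
    then show ?thesis using fK by (simp add: F_def poly_prod prod_zero_iff)
  qed
  have form: "crit_form M J X w = poly Q w / (poly F w)\<^sup>2" if w: "Im w < 0" for w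
  proof -
    have e: "1 / (w - of_real (X j)) = poly (P (X j)) w / poly F w" if "j \<in> J" for j
    proof -
      have "w - of_real (X j) \<noteq> 0" using w by (auto simp: complex_eq_iff)
      moreover have "poly F w = (w - of_real (X j)) * poly (P (X j)) w"
        using arg_cong[OF PF[OF XK[OF that]], of "\<lambda>q. poly q w"] by (simp add: algebra_simps)
      ultimately show ?thesis using Fnz[OF w] by (simp add: divide_simps)
    qed
    have e2: "1 / (w - of_real (X j))\<^sup>2 = (poly (P (X j)) w)\<^sup>2 / (poly F w)\<^sup>2" if "j \<in> J" for j
      using arg_cong[OF e[OF that], of "\<lambda>z. z\<^sup>2"] by (simp add: power_divide)
    have "crit_form M J X w = (\<Sum>j\<in>J. poly (P (X j)) w / poly F w)\<^sup>2 -
        of_real M * (\<Sum>j\<in>J. (poly (P (X j)) w)\<^sup>2 / (poly F w)\<^sup>2)"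
      unfolding crit_form_def using e e2 by simp
    also have "\<dots> = poly Q w / (poly F w)\<^sup>2"
      by (simp add: Q_def S1_def S2_def poly_sum sum_divide_distrib[symmetric] power_divide diff_divide_distrib)
    finally show ?thesis .
  qed
  have zeros: "{w. Im w < 0 \<and> crit_form M J X w = 0} = {w. Im w < 0 \<and> poly Q w = 0}"
    using form Fnz by auto
  show "finite {w. Im w < 0 \<and> crit_form M J X w = 0}"
    unfolding zeros using poly_roots_finite[OF Q0] by (rule finite_subset[rotated]) auto
  have ord: "\<exists>R. R holomorphic_on {w. Im w < 0} \<and> R w0 \<noteq> 0 \<and>
       (\<forall>w\<in>{w. Im w < 0}. crit_form M J X w = (w - w0) ^ order w0 Q * R w)"
    and zo: "zorder (crit_form M J X) w0 = int (order w0 Q)" if w0: "Im w0 < 0" for w0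
  proof -
    obtain q where q: "Q = [:- w0, 1:] ^ order w0 Q * q" "\<not> [:- w0, 1:] dvd q"
      using order_decomp[OF Q0] by blast
    let ?R = "\<lambda>w. poly q w / (poly F w)\<^sup>2"
    have h: "?R holomorphic_on {w. Im w < 0}" using Fnz by (intro holomorphic_intros) auto
    have nz: "?R w0 \<noteq> 0" using q(2) Fnz[OF w0] by (simp add: poly_eq_0_iff_dvd)
    have eq: "crit_form M J X w = (w - w0) ^ order w0 Q * ?R w" if "Im w < 0" for w
    proof -
      have "poly Q w = (w - w0) ^ order w0 Q * poly q w" using arg_cong[OF q(1), of "\<lambda>p. poly p w"] by simp
      then show ?thesis using form[OF that] by simp
    qed
    then show "\<exists>R. R holomorphic_on {w. Im w < 0} \<and> R w0 \<noteq> 0 \<and>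
       (\<forall>w\<in>{w. Im w < 0}. crit_form M J X w = (w - w0) ^ order w0 Q * R w)"
      using h nz by (intro exI[of _ ?R]) auto
    show "zorder (crit_form M J X) w0 = int (order w0 Q)"
    proof (rule zorder_eqI[OF open_halfspace_Im_lt _ h nz])
      show "w0 \<in> {z. Im z < 0}" using w0 by simp
      show "crit_form M J X w = ?R w * (w - w0) powi int (order w0 Q)" if "w \<in> {z. Im z < 0}" for w
        using eq[of w] that by (simp add: mult.commute)
    qed
  qed
  show "\<exists>k S R. open S \<and> w0 \<in> S \<and> R holomorphic_on S \<and> R w0 \<noteq> 0 \<and>
       zorder (crit_form M J X) w0 = int k \<and> (\<forall>w\<in>S. crit_form M J X w = (w - w0) ^ k * R w)" if w0: "Im w0 < 0" for w0
    using ord[OF w0] zo[OF w0] w0 open_halfspace_Im_lt[of 0]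
    by (intro exI[of _ "order w0 Q"] exI[of _ "{w. Im w < 0}"]) auto
  have "(\<Sum>w | Im w < 0 \<and> crit_form M J X w = 0. zorder (crit_form M J X) w) =
      (\<Sum>w | Im w < 0 \<and> poly Q w = 0. int (order w Q))"
    unfolding zeros using zo by (intro sum.cong) auto
  also have "\<dots> = int n" using real_poly_half_roots[OF realQ nzQ dQ] by (metis of_nat_sum)
  finally show "(\<Sum>w | Im w < 0 \<and> crit_form M J X w = 0. zorder (crit_form M J X) w) = int (card (X ` J) - 1)"
    by (simp add: n_def K_def)
qed

lemma crit_form_holomorphic: "crit_form M J X holomorphic_on {w. Im w < 0}"
proof -
  have "w - of_real t \<noteq> 0" if "Im w < 0" for w t using that by (auto simp: complex_eq_iff)
  then show ?thesis unfolding crit_form_def by (intro holomorphic_intros) auto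
qed

section \<open>Stability of the zero count under degeneration\<close>

lemma rouche_ball:
  assumes S: "open S" "convex S" and fg: "f holomorphic_on S" "g holomorphic_on S"
    and fin: "finite {z \<in> S. f z = 0}" "finite {z \<in> S. g z = 0}"
    and r: "r > 0" "cball c r \<subseteq> S"
    and less: "\<And>z. z \<in> sphere c r \<Longrightarrow> norm (g z - f z) < norm (f z)"
  shows "(\<Sum>z | z \<in> ball c r \<and> g z = 0. zorder g z) = (\<Sum>z | z \<in> ball c r \<and> f z = 0. zorder f z)"
    "\<And>z. z \<in> sphere c r \<Longrightarrow> g z \<noteq> 0" "\<And>z. z \<in> sphere c r \<Longrightarrow> f z \<noteq> 0"
proof -
  show nz: "\<And>z. z \<in> sphere c r \<Longrightarrow> g z \<noteq> 0" "\<And>z. z \<in> sphere c r \<Longrightarrow> f z \<noteq> 0"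
    using less by (force simp: norm_minus_commute)+
  let ?\<gamma> = "circlepath c r"
  have img: "path_image ?\<gamma> = sphere c r" using r by simp
  have out: "winding_number ?\<gamma> z = 0" if "z \<notin> cball c r" for z
    using that r by (intro winding_number_zero_outside[of _ "cball c r"]) auto
  have out': "winding_number ?\<gamma> z = 0" if "z \<notin> S" for z using out that r(2) by blast
  have sub: "sphere c r \<subseteq> S" using r(2) sphere_cball by blast
  have "(\<Sum>p\<in>{p \<in> S. f p + (g p - f p) = 0}. winding_number ?\<gamma> p * zorder (\<lambda>p. f p + (g p - f p)) p) =
    (\<Sum>p\<in>{p \<in> S. f p = 0}. winding_number ?\<gamma> p * zorder f p)"
    using S fg fin less out' sub unfolding img[symmetric]
    by (intro Rouche_theorem) (auto intro!: holomorphic_intros convex_connected)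
  then have eq: "(\<Sum>p\<in>{p \<in> S. g p = 0}. winding_number ?\<gamma> p * zorder g p) =
    (\<Sum>p\<in>{p \<in> S. f p = 0}. winding_number ?\<gamma> p * zorder f p)" by simp
  have red: "(\<Sum>p\<in>{p \<in> S. h p = 0}. winding_number ?\<gamma> p * zorder h p) =
      of_int (\<Sum>z | z \<in> ball c r \<and> h z = 0. zorder h z)"
    if h: "finite {z \<in> S. h z = 0}" "\<And>z. z \<in> sphere c r \<Longrightarrow> h z \<noteq> 0" for h
  proof -
    have "(\<Sum>p\<in>{p \<in> S. h p = 0}. winding_number ?\<gamma> p * zorder h p) =
      (\<Sum>z | z \<in> ball c r \<and> h z = 0. winding_number ?\<gamma> z * zorder h z)"
    proof (intro sum.mono_neutral_right h(1) ballI)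
      show "{z. z \<in> ball c r \<and> h z = 0} \<subseteq> {p \<in> S. h p = 0}" using r ball_subset_cball by blast
      fix z assume z: "z \<in> {p \<in> S. h p = 0} - {z. z \<in> ball c r \<and> h z = 0}"
      then have "z \<notin> cball c r" using h(2)[of z] by (auto simp: dist_norm)
      then show "winding_number ?\<gamma> z * zorder h z = 0" using out by simp
    qed
    also have "\<dots> = (\<Sum>z | z \<in> ball c r \<and> h z = 0. of_int (zorder h z))"
      by (intro sum.cong refl) (auto simp: winding_number_circlepath dist_norm norm_minus_commute)
    finally show ?thesis by simp
  qed
  show "(\<Sum>z | z \<in> ball c r \<and> g z = 0. zorder g z) = (\<Sum>z | z \<in> ball c r \<and> f z = 0. zorder f z)"
  proof -
    have "of_int (\<Sum>z | z \<in> ball c r \<and> g z = 0. zorder g z) =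
        (of_int (\<Sum>z | z \<in> ball c r \<and> f z = 0. zorder f z) :: complex)"
      using eq red[of f, OF fin(1) nz(2)] red[of g, OF fin(2) nz(1)] by metis
    then show ?thesis by (simp only: of_int_eq_iff)
  qed
qed

lemma uniform_limit_sum:
  fixes f :: "'j \<Rightarrow> 'a \<Rightarrow> 'b \<Rightarrow> complex"
  assumes "\<And>j. j \<in> J \<Longrightarrow> uniform_limit C (f j) (l j) F"
  shows "uniform_limit C (\<lambda>n w. \<Sum>j\<in>J. f j n w) (\<lambda>w. \<Sum>j\<in>J. l j w) F"
  using assms by (induction J rule: infinite_finite_induct) (auto intro!: uniform_limit_intros)

text \<open>On a compact set below the real line the kernels are controlled by the distance to the
  line. Those of escaping points tend to 0: such points leave the sums, while the coefficient
  \<open>M\<close> stays.\<close>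

lemma crit_form_uniform_limit:
  fixes X :: "nat \<Rightarrow> 'a \<Rightarrow> real"
  assumes J: "finite J" "J' \<subseteq> J" and C: "compact C" "C \<subseteq> {w. Im w < 0}"
    and conv: "\<And>j. j \<in> J' \<Longrightarrow> (\<lambda>n. X n j) \<longlonglongrightarrow> Y j"
    and esc: "\<And>j. j \<in> J - J' \<Longrightarrow> filterlim (\<lambda>n. \<bar>X n j\<bar>) at_top sequentially"
  shows "uniform_limit C (\<lambda>n. crit_form M J (X n)) (crit_form M J' Y) sequentially"
proof (cases "C = {}")
  case False
  obtain w0 where w0: "w0 \<in> C" "\<And>w. w \<in> C \<Longrightarrow> Im w \<le> Im w0"
    using continuous_attains_sup[OF C(1) False linear_continuous_on[OF bounded_linear_Im]] by blast
  define m where "m = - Im w0"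
  have m: "m > 0" "\<And>w. w \<in> C \<Longrightarrow> Im w \<le> - m" using w0 C(2) by (auto simp: m_def)
  obtain B where B: "\<And>w. w \<in> C \<Longrightarrow> norm w \<le> B" using compact_imp_bounded[OF C(1)] by (auto simp: bounded_iff)
  have dist: "norm (w - of_real a) \<ge> m" if "w \<in> C" for w a
    using abs_Im_le_cmod[of "w - of_real a"] m(2)[OF that] by simp
  have nz: "w - of_real a \<noteq> 0" if "w \<in> C" for w a using dist[OF that, of a] m(1) by auto
  define l where "l j w = (if j \<in> J' then 1 / (w - of_real (Y j)) else 0)" for j and w :: complex
  have L: "uniform_limit C (\<lambda>n w. 1 / (w - of_real (X n j))) (l j) sequentially" if j: "j \<in> J" for j
  proof (cases "j \<in> J'")
    case True
    show ?thesis
    proof (rule uniform_limitI)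
      fix e :: real assume e: "e > 0"
      have "\<forall>\<^sub>F n in sequentially. dist (X n j) (Y j) < e * m\<^sup>2"
        using conv[OF True] e m by (intro tendstoD) auto
      then show "\<forall>\<^sub>F n in sequentially. \<forall>w\<in>C. dist (1 / (w - of_real (X n j))) (l j w) < e"
      proof eventually_elim
        case (elim n)
        show ?case
        proof
          fix w assume w: "w \<in> C"
          have "1 / (w - of_real (X n j)) - 1 / (w - of_real (Y j)) =
              of_real (X n j - Y j) / ((w - of_real (X n j)) * (w - of_real (Y j)))"
            using nz[OF w] by (simp add: divide_simps)
          then have "dist (1 / (w - of_real (X n j))) (l j w) =
              \<bar>X n j - Y j\<bar> / (norm (w - of_real (X n j)) * norm (w - of_real (Y j)))"
            using True by (simp add: l_def dist_norm norm_divide norm_mult del: of_real_diff)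
          also have "\<dots> \<le> \<bar>X n j - Y j\<bar> / (m * m)"
            using dist[OF w] m(1) nz[OF w] by (intro divide_left_mono mult_mono mult_pos_pos) auto
          also have "\<dots> < e" using elim m(1) by (simp add: divide_less_eq dist_real_def power2_eq_square)
          finally show "dist (1 / (w - of_real (X n j))) (l j w) < e" .
        qed
      qed
    qed
  next
    case False
    show ?thesis
    proof (rule uniform_limitI)
      fix e :: real assume e: "e > 0"
      have "\<forall>\<^sub>F n in sequentially. \<bar>X n j\<bar> > B + 1 / e"
        using esc[of j] False j by (simp add: filterlim_at_top_dense)
      then show "\<forall>\<^sub>F n in sequentially. \<forall>w\<in>C. dist (1 / (w - of_real (X n j))) (l j w) < e"
      proof eventually_elim
        case (elim n)
        show ?case
        proof
          fix w assume w: "w \<in> C"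
          have "norm (w - of_real (X n j)) \<ge> \<bar>X n j\<bar> - norm w"
            using norm_triangle_ineq2[of "of_real (X n j)" w] by (simp add: norm_minus_commute)
          then have big: "norm (w - of_real (X n j)) > 1 / e" using elim B[OF w] by simp
          moreover have "1 / e > 0" using e by simp
          ultimately have "norm (w - of_real (X n j)) > 0" by linarith
          then have "1 / norm (w - of_real (X n j)) < e" using big e by (simp add: field_simps)
          then show "dist (1 / (w - of_real (X n j))) (l j w) < e"
            using False by (simp add: l_def norm_divide)
        qed
      qed
    qed
  qed
  have lc: "continuous_on C (l j)" for j
    unfolding l_def using nz by (cases "j \<in> J'") (auto intro!: continuous_intros)
  have sq: "uniform_limit C (\<lambda>n w. f n w * f n w) (\<lambda>w. g w * g w) sequentially"
    if "uniform_limit C f g sequentially" "continuous_on C g" for f :: "nat \<Rightarrow> complex \<Rightarrow> complex" and g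
    using that compact_imp_bounded[OF compact_continuous_image[OF that(2) C(1)]]
    by (intro uniform_lim_mult)
  have "uniform_limit C (\<lambda>n w. (\<Sum>j\<in>J. 1 / (w - of_real (X n j))) * (\<Sum>j\<in>J. 1 / (w - of_real (X n j)))
       - of_real M * (\<Sum>j\<in>J. 1 / (w - of_real (X n j)) * (1 / (w - of_real (X n j)))))
     (\<lambda>w. (\<Sum>j\<in>J. l j w) * (\<Sum>j\<in>J. l j w) - of_real M * (\<Sum>j\<in>J. l j w * l j w)) sequentially"
    using L lc
    by (intro uniform_limit_minus sq uniform_limit_sum continuous_on_sum
        bounded_linear.uniform_limit[OF bounded_linear_mult_right]) auto
  moreover have "(\<Sum>j\<in>J. l j w) * (\<Sum>j\<in>J. l j w) - of_real M * (\<Sum>j\<in>J. l j w * l j w) = crit_form M J' Y w" for w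
  proof -
    have JJ: "J \<inter> {j. j \<in> J'} = J'" using J by auto
    have 1: "(\<Sum>j\<in>J. l j w) = (\<Sum>j\<in>J'. 1 / (w - of_real (Y j)))"
      unfolding l_def sum.If_cases[OF J(1)] JJ by simp
    have "(\<Sum>j\<in>J. l j w * l j w) = (\<Sum>j\<in>J. if j \<in> J' then 1 / (w - of_real (Y j))\<^sup>2 else 0)"
      by (intro sum.cong) (auto simp: l_def power2_eq_square)
    also have "\<dots> = (\<Sum>j\<in>J'. 1 / (w - of_real (Y j))\<^sup>2)"
      unfolding sum.If_cases[OF J(1)] JJ by simp
    finally show ?thesis unfolding 1 crit_form_def by (simp add: power2_eq_square)
  qed
  ultimately show ?thesis unfolding crit_form_def by (simp add: power2_eq_square)
qed simp

text \<open>The Apollonius condition describes the hyperbolic disk about \<open>- \<i>\<close> in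
  the lower half-plane; its Euclidean centre and radius are wanted because Rouche's theorem is
  applied on a round circle.\<close>

lemma lower_disk:
  assumes "0 < \<rho>" "\<rho> < 1"
  defines "c \<equiv> - \<i> * of_real ((1 + \<rho>\<^sup>2) / (1 - \<rho>\<^sup>2))" and "r \<equiv> 2 * \<rho> / (1 - \<rho>\<^sup>2)"
  shows "r > 0" "norm (w + \<i>) \<le> \<rho> * norm (w - \<i>) \<longleftrightarrow> w \<in> cball c r"
    "norm (w + \<i>) < \<rho> * norm (w - \<i>) \<longleftrightarrow> w \<in> ball c r" "cball c r \<subseteq> {w. Im w < 0}"
proof -
  have r1: "1 - \<rho>\<^sup>2 > 0" using assms by (simp add: abs_square_less_1)
  show r0: "r > 0" using r1 assms by simp
  have key: "(norm (w + \<i>))\<^sup>2 - (\<rho> * norm (w - \<i>))\<^sup>2 = (1 - \<rho>\<^sup>2) * ((dist c w)\<^sup>2 - r\<^sup>2)" for w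
  proof -
    define k where "k = (1 + \<rho>\<^sup>2) / (1 - \<rho>\<^sup>2)"
    have kr: "k * (1 - \<rho>\<^sup>2) = 1 + \<rho>\<^sup>2" using r1 by (simp add: k_def)
    have rr: "k\<^sup>2 - r\<^sup>2 = 1"
    proof -
      have "k\<^sup>2 - r\<^sup>2 = ((1 + \<rho>\<^sup>2)\<^sup>2 - (2 * \<rho>)\<^sup>2) / (1 - \<rho>\<^sup>2)\<^sup>2"
        by (simp add: k_def r_def power_divide diff_divide_distrib)
      also have "(1 + \<rho>\<^sup>2)\<^sup>2 - (2 * \<rho>)\<^sup>2 = (1 - \<rho>\<^sup>2)\<^sup>2" by (simp add: power2_eq_square algebra_simps)
      finally show ?thesis using r1 by simp
    qed
    have "(dist c w)\<^sup>2 - r\<^sup>2 = (Re w)\<^sup>2 + (Im w + k)\<^sup>2 - r\<^sup>2"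
      unfolding dist_norm cmod_power2 c_def k_def[symmetric] by (simp add: power2_eq_square algebra_simps)
    also have "\<dots> = (Re w)\<^sup>2 + (Im w)\<^sup>2 + 2 * k * Im w + 1" using rr by (simp add: power2_eq_square algebra_simps)
    finally have "(1 - \<rho>\<^sup>2) * ((dist c w)\<^sup>2 - r\<^sup>2) =
        (1 - \<rho>\<^sup>2) * ((Re w)\<^sup>2 + (Im w)\<^sup>2 + 1) + 2 * (k * (1 - \<rho>\<^sup>2)) * Im w" by (simp add: algebra_simps)
    also have "\<dots> = (norm (w + \<i>))\<^sup>2 - (\<rho> * norm (w - \<i>))\<^sup>2"
      unfolding kr power_mult_distrib cmod_power2 by (simp add: power2_eq_square algebra_simps)
    finally show ?thesis by simp
  qed
  have nn: "0 \<le> \<rho> * norm (w - \<i>)" for w using assms by simp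
  have le: "norm (w + \<i>) \<le> \<rho> * norm (w - \<i>) \<longleftrightarrow> dist c w \<le> r" for w
  proof -
    have "norm (w + \<i>) \<le> \<rho> * norm (w - \<i>) \<longleftrightarrow> (norm (w + \<i>))\<^sup>2 \<le> (\<rho> * norm (w - \<i>))\<^sup>2"
      using power_mono_iff[OF norm_ge_zero nn, of 2 "w + \<i>" w] by simp
    also have "\<dots> \<longleftrightarrow> (1 - \<rho>\<^sup>2) * ((dist c w)\<^sup>2 - r\<^sup>2) \<le> 0" using key[of w] by auto
    also have "\<dots> \<longleftrightarrow> (dist c w)\<^sup>2 \<le> r\<^sup>2" using r1 by (simp add: mult_le_0_iff)
    also have "\<dots> \<longleftrightarrow> dist c w \<le> r" using r0 power_mono_iff[OF zero_le_dist, of r 2 c w] by simp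
    finally show ?thesis .
  qed
  have lt: "norm (w + \<i>) < \<rho> * norm (w - \<i>) \<longleftrightarrow> dist c w < r" for w
  proof -
    have "norm (w + \<i>) < \<rho> * norm (w - \<i>) \<longleftrightarrow> (norm (w + \<i>))\<^sup>2 < (\<rho> * norm (w - \<i>))\<^sup>2"
      using power_mono_iff[OF nn norm_ge_zero, of 2 w "w + \<i>"] by (metis linorder_not_le zero_less_numeral)
    also have "\<dots> \<longleftrightarrow> (1 - \<rho>\<^sup>2) * ((dist c w)\<^sup>2 - r\<^sup>2) < 0" using key[of w] by auto
    also have "\<dots> \<longleftrightarrow> (dist c w)\<^sup>2 < r\<^sup>2" using r1 by (simp add: mult_less_0_iff)
    also have "\<dots> \<longleftrightarrow> dist c w < r" using power_mono_iff[OF less_imp_le[OF r0] zero_le_dist, of 2 c w] by (metis linorder_not_le zero_less_numeral)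
    finally show ?thesis .
  qed
  show "norm (w + \<i>) \<le> \<rho> * norm (w - \<i>) \<longleftrightarrow> w \<in> cball c r"
    "norm (w + \<i>) < \<rho> * norm (w - \<i>) \<longleftrightarrow> w \<in> ball c r" using le lt by auto
  show "cball c r \<subseteq> {w. Im w < 0}"
  proof
    fix w assume "w \<in> cball c r"
    then have "norm (w + \<i>) \<le> \<rho> * norm (w - \<i>)" using le by simp
    moreover from this have "w \<noteq> \<i>" by auto
    then have "\<rho> * norm (w - \<i>) < norm (w - \<i>)" using assms by simp
    ultimately have "norm (w + \<i>) < norm (w - \<i>)" by linarith
    then have "(norm (w + \<i>))\<^sup>2 < (norm (w - \<i>))\<^sup>2" by (intro power_strict_mono) auto
    then show "w \<in> {w. Im w < 0}" unfolding cmod_power2 by (simp add: power2_eq_square algebra_simps)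
  qed
qed

text \<open>The ratio \<rho> is chosen so that all zeros of the limiting form are interior to the
  disk; the limit is then bounded below on the circle and uniform convergence gives Rouche's
  inequality. The lower half-plane appears because \<open>f\<close> is a holomorphic function of
  \<open>cnj z\<close>.\<close>

lemma crit_form_count_eventually:
  fixes X :: "nat \<Rightarrow> 'a \<Rightarrow> real"
  assumes J: "finite J" "J' \<subseteq> J" "J' \<noteq> {}" and M: "real (card J) < M"
    and conv: "\<And>j. j \<in> J' \<Longrightarrow> (\<lambda>n. X n j) \<longlonglongrightarrow> Y j"
    and esc: "\<And>j. j \<in> J - J' \<Longrightarrow> filterlim (\<lambda>n. \<bar>X n j\<bar>) at_top sequentially"
  obtains \<rho> where "0 < \<rho>" "\<rho> < 1"
    "\<forall>\<^sub>F n in sequentially. (\<Sum>w | Im w < 0 \<and> norm (w + \<i>) \<le> \<rho> * norm (w - \<i>) \<and> crit_form M J (X n) w = 0.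
        zorder (crit_form M J (X n)) w) = int (card (Y ` J') - 1)"
proof -
  let ?N = "crit_form M J' Y"
  have J': "finite J'" using J finite_subset by auto
  have M': "real (card J') < M" using card_mono[OF J(1,2)] M by linarith
  have JN: "J \<noteq> {}" using J by auto
  let ?Z = "{w. Im w < 0 \<and> ?N w = 0}"
  have fZ: "finite ?Z" by (rule crit_form_zeros(1)[OF J' J(3) M'])
  define q where "q w = norm (w + \<i>) / norm (w - \<i>)" for w
  have q1: "q w < 1" if "Im w < 0" for w
  proof -
    have "(norm (w + \<i>))\<^sup>2 < (norm (w - \<i>))\<^sup>2"
      unfolding cmod_power2 using that by (simp add: power2_eq_square algebra_simps)
    then have "norm (w + \<i>) < norm (w - \<i>)" by (rule power2_less_imp_less) simp
    moreover then have "0 < norm (w - \<i>)" using norm_ge_zero[of "w + \<i>"] by linarith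
    ultimately show ?thesis by (simp add: q_def)
  qed
  obtain \<rho> where \<rho>: "0 < \<rho>" "\<rho> < 1" "\<And>w. w \<in> ?Z \<Longrightarrow> q w < \<rho>"
  proof -
    let ?S = "insert 0 (q ` ?Z)"
    have "Max ?S < 1" using fZ q1 by (subst Max_less_iff) auto
    moreover have "Max ?S \<ge> 0" using fZ by (intro Max_ge) auto
    moreover have "q w \<le> Max ?S" if "w \<in> ?Z" for w using fZ that by (intro Max_ge) auto
    ultimately show thesis using that[of "(Max ?S + 1) / 2"] by fastforce
  qed
  define c where "c = - \<i> * of_real ((1 + \<rho>\<^sup>2) / (1 - \<rho>\<^sup>2))"
  define r where "r = 2 * \<rho> / (1 - \<rho>\<^sup>2)"
  note D = lower_disk[OF \<rho>(1,2), folded c_def r_def]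
  have Zball: "?Z = {w. w \<in> ball c r \<and> ?N w = 0}"
  proof -
    have "w \<in> ball c r" if "w \<in> ?Z" for w
    proof -
      have "norm (w - \<i>) > 0" using that by (auto simp: complex_eq_iff)
      then show ?thesis unfolding D(3)[symmetric] using \<rho>(3)[OF that] by (simp add: q_def divide_less_eq)
    qed
    moreover have "Im w < 0" if "w \<in> ball c r" for w
      using D(4) that ball_subset_cball[of c r] by blast
    ultimately show ?thesis by blast
  qed
  have sub: "sphere c r \<subseteq> {w. Im w < 0}" using D(4) sphere_cball[of c r] by blast
  have sphere_nz: "?N w \<noteq> 0" if "w \<in> sphere c r" for w
  proof
    assume "?N w = 0"
    then have "w \<in> ?Z" using that sub by auto
    then show False unfolding Zball using that by simp
  qed
  have "continuous_on (sphere c r) (\<lambda>w. norm (?N w))"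
    using holomorphic_on_imp_continuous_on[OF holomorphic_on_subset[OF crit_form_holomorphic sub]]
    by (intro continuous_intros)
  then obtain w1 where w1: "w1 \<in> sphere c r" "\<And>w. w \<in> sphere c r \<Longrightarrow> norm (?N w1) \<le> norm (?N w)"
    using continuous_attains_inf[of "sphere c r" "\<lambda>w. norm (?N w)"] D(1) by fastforce
  have pos: "norm (?N w1) > 0" using sphere_nz[OF w1(1)] by simp
  have "\<forall>\<^sub>F n in sequentially. \<forall>w\<in>sphere c r. dist (crit_form M J (X n) w) (?N w) < norm (?N w1)"
    using crit_form_uniform_limit[OF J(1,2) _ sub conv esc, where M = M] pos by (intro uniform_limitD) auto
  then have "\<forall>\<^sub>F n in sequentially. (\<Sum>w | Im w < 0 \<and> norm (w + \<i>) \<le> \<rho> * norm (w - \<i>) \<and> crit_form M J (X n) w = 0.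
        zorder (crit_form M J (X n)) w) = int (card (Y ` J') - 1)"
  proof eventually_elim
    case (elim n)
    have less: "norm (crit_form M J (X n) w - ?N w) < norm (?N w)" if "w \<in> sphere c r" for w
      using elim that w1(2)[OF that] by (force simp: dist_norm)
    have S: "{w \<in> {w. Im w < 0}. crit_form M K T w = 0} = {w. Im w < 0 \<and> crit_form M K T w = 0}"
      for K :: "'a set" and T by auto
    have fin: "finite {w \<in> {w. Im w < 0}. ?N w = 0}" "finite {w \<in> {w. Im w < 0}. crit_form M J (X n) w = 0}"
      unfolding S using fZ crit_form_zeros(1)[OF J(1) JN M] by auto
    note R = rouche_ball[OF open_halfspace_Im_lt convex_halfspace_Im_lt crit_form_holomorphic
        crit_form_holomorphic fin D(1,4) less]
    have "{w. Im w < 0 \<and> norm (w + \<i>) \<le> \<rho> * norm (w - \<i>) \<and> crit_form M J (X n) w = 0} =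
        {w. w \<in> ball c r \<and> crit_form M J (X n) w = 0}"
    proof -
      have "w \<in> ball c r" if "w \<in> cball c r" "crit_form M J (X n) w = 0" for w
        using R(2)[of w] that by (auto simp: less_le)
      moreover have "Im w < 0" if "w \<in> ball c r" for w
        using D(4) that ball_subset_cball[of c r] by blast
      ultimately show ?thesis unfolding D(2) using ball_subset_cball[of c r] by blast
    qed
    then have "(\<Sum>w | Im w < 0 \<and> norm (w + \<i>) \<le> \<rho> * norm (w - \<i>) \<and> crit_form M J (X n) w = 0.
        zorder (crit_form M J (X n)) w) = (\<Sum>w\<in>?Z. zorder ?N w)"
      using R(1) unfolding Zball by simp
    also have "\<dots> = int (card (Y ` J') - 1)" by (rule crit_form_zeros(2)[OF J' J(3) M'])
    finally show ?case .
  qed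
  then show thesis using that \<rho> by blast
qed

section \<open>The normalised map and its critical points in the chart\<close>

locale point_config = half_plane_chart u p + unit_points d "circle_point u p x"
  for u p d x +
  fixes f :: "complex \<Rightarrow> complex"
  assumes f_eq: "f z = num (cnj z) / den (cnj z)" and d2: "d \<ge> 2"
begin

abbreviation Z where "Z \<equiv> circle_point u p x"

lemma Z_simps: "Z 0 = u" "j \<in> {1..d} \<Longrightarrow> Z j = A (of_real (x j))"
  by (auto simp: circle_point_def)

lemma f_cnj: "(\<lambda>w. f (cnj w)) = (\<lambda>w. num w / den w)"
  by (simp add: f_eq fun_eq_iff)

lemma norm_dzbar: "k \<le> d \<Longrightarrow> norm (dzbar f (Z k)) = real d"
proof -
  assume k: "k \<le> d"
  define D where "D = of_nat d * (Z k)\<^sup>2"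
  have "((\<lambda>w. num w / den w) has_derivative (\<lambda>h. D * h)) (at (cnj (Z k)))"
    using has_deriv_self[OF k] by (simp add: D_def has_field_derivative_def)
  moreover have "(cnj has_derivative cnj) (at (Z k))"
    by (rule bounded_linear_imp_has_derivative[OF bounded_linear_cnj])
  ultimately have "((\<lambda>z. num (cnj z) / den (cnj z)) has_derivative (\<lambda>h. D * cnj h)) (at (Z k))"
    using has_derivative_compose[of cnj cnj "Z k" UNIV "\<lambda>w. num w / den w" "\<lambda>h. D * h"] by simp
  moreover have "f = (\<lambda>z. num (cnj z) / den (cnj z))" using f_eq by (simp add: fun_eq_iff)
  ultimately have "(f has_derivative (\<lambda>h. D * cnj h)) (at (Z k))" by simp
  then have "frechet_derivative f (at (Z k)) = (\<lambda>h. D * cnj h)" by (rule frechet_derivative_at[symmetric])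
  moreover have "\<i> * (D * cnj \<i>) = D" by (simp add: complex_eq_iff)
  ultimately have "dzbar f (Z k) = D" by (simp add: dzbar_def del: complex_cnj_i)
  then show ?thesis using norm_\<zeta>[OF k] by (simp add: D_def norm_mult norm_power)
qed

lemma fixed_points: "norm z = 1 \<Longrightarrow> f z = z \<longleftrightarrow> (\<exists>k\<le>d. z = Z k)"
  using fixed_iff f_eq by simp

lemma rep_fix_eq: "rep_fix f = Z ` {..d}"
  using fixed_points norm_\<zeta> norm_dzbar d2 unfolding rep_fix_def by (fastforce simp: image_iff)

text \<open>A fixed point of multiplication by \<open>- d\<close> on the circle goes under
  \<open>eta f\<close> to a fixed point of \<open>f\<close>, and there the derivative has modulus
  \<open>d\<close>. Since \<open>eta f\<close> commutes with integer translations, the lift does no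
  harm.\<close>

lemma in_BminusK:
  assumes eta: "conjugacy_family d eta" and f: "f \<in> Bminus d"
  shows "f \<in> BminusK d eta (ln (real d))"
proof -
  have step: "\<And>t. eta f (t + 1) = eta f t + 1"
    and conj: "\<And>t. circ (eta f (- real d * t)) = f (circ (eta f t))"
    using eta f unfolding conjugacy_family_def by blast+
  have shift: "eta f (t + of_int k) = eta f t + of_int k" for t k
  proof (induction k rule: int_induct[of _ 0])
    case (step1 i)
    then show ?case using step[of "t + of_int i"] by (simp add: add.assoc)
  next
    case (step2 i)
    then show ?case using step[of "t + of_int (i - 1)"] by (simp add: add.assoc)
  qed simp
  have "ln (norm (dzbar f (circ (eta f t)))) \<le> ln (real d)" if t: "- real d * t - t \<in> \<int>" for t
  proof -
    obtain k where "- real d * t - t = of_int k" using t by (auto elim: Ints_cases)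
    then have "- real d * t = t + of_int k" by simp
    then have "f (circ (eta f t)) = circ (eta f t)"
      using conj[of t] shift[of t k] by (simp add: circ_add)
    then obtain k where "k \<le> d" "circ (eta f t) = Z k" using fixed_points by auto
    then show ?thesis using norm_dzbar by simp
  qed
  then show ?thesis using f by (simp add: BminusK_def)
qed

text \<open>The right side is twice the sine of the angle between \<open>w - x j\<close> and the
  real line. Thus in a Stolz angle at \<open>x j\<close> this end and the marked end are seen at a
  definite distance from each other.\<close>

lemma visual_diff:
  assumes w: "Im w > 0" and j: "j \<in> {1..d}"
  shows "norm ((Z 0 - A w) / (1 - Z 0 * cnj (A w)) - (Z j - A w) / (1 - Z j * cnj (A w))) =
    2 * Im w / norm (w - of_real (x j))"
    and "k \<le> d \<Longrightarrow> norm ((Z k - A w) / (1 - Z k * cnj (A w))) = 1"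
proof -
  define z where "z = A w"
  have z1: "norm z < 1" unfolding z_def using A_ball[OF w] .
  have mod: "norm (1 - Z k * cnj z) = norm (Z k - z)" and nz: "1 - Z k * cnj z \<noteq> 0" if "k \<le> d" for k
  proof -
    have "1 - Z k * cnj z = Z k * cnj (Z k - z)" using \<zeta>_cnj[OF that] by (simp add: algebra_simps)
    then show "norm (1 - Z k * cnj z) = norm (Z k - z)"
      using norm_\<zeta>[OF that] by (metis norm_mult mult_1 complex_mod_cnj)
    moreover have "Z k \<noteq> z" using norm_\<zeta>[OF that] z1 by (metis less_irrefl)
    ultimately show "1 - Z k * cnj z \<noteq> 0" by (metis norm_eq_zero right_minus_eq)
  qed
  show "norm ((Z k - A w) / (1 - Z k * cnj (A w))) = 1" if "k \<le> d" for k
    unfolding z_def[symmetric] norm_divide mod[OF that, symmetric] using nz[OF that] by simp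
  have j0: "0 \<le> d" "j \<le> d" using j by auto
  have "(Z 0 - z) / (1 - Z 0 * cnj z) - (Z j - z) / (1 - Z j * cnj z) =
      (Z 0 - Z j) * (1 - z * cnj z) / ((1 - Z 0 * cnj z) * (1 - Z j * cnj z))"
    using nz[OF j0(1)] nz[OF j0(2)] by (simp add: divide_simps) (simp add: algebra_simps)
  also have "1 - z * cnj z = of_real (1 - (norm z)\<^sup>2)" by (simp only: complex_norm_square[symmetric]) simp
  finally have "norm ((Z 0 - z) / (1 - Z 0 * cnj z) - (Z j - z) / (1 - Z j * cnj z)) =
      norm (Z 0 - Z j) * \<bar>1 - (norm z)\<^sup>2\<bar> / (norm (Z 0 - z) * norm (Z j - z))"
    using mod[OF j0(1)] mod[OF j0(2)] by (simp only: norm_divide norm_mult norm_of_real)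
  also have "\<bar>1 - (norm z)\<^sup>2\<bar> = 4 * Im w * Im p / (norm (w - cnj p))\<^sup>2"
    using one_minus_norm_A[of w] w Im_p by (simp add: z_def)
  finally have diff: "norm ((Z 0 - z) / (1 - Z 0 * cnj z) - (Z j - z) / (1 - Z j * cnj z)) =
      norm (Z 0 - Z j) * (4 * Im w * Im p / (norm (w - cnj p))\<^sup>2) / (norm (Z 0 - z) * norm (Z j - z))" .
  have dists: "norm (Z 0 - Z j) = 2 * Im p / norm (of_real (x j) - cnj p)"
    "norm (Z 0 - z) = 2 * Im p / norm (w - cnj p)"
    "norm (Z j - z) = 2 * Im p * norm (w - of_real (x j)) / (norm (of_real (x j) - cnj p) * norm (w - cnj p))"
  proof -
    have pp: "norm (p - cnj p) = 2 * Im p" using Im_p by (simp add: complex_diff_cnj norm_mult)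
    show "norm (Z 0 - Z j) = 2 * Im p / norm (of_real (x j) - cnj p)"
      using A_diff_u[of "of_real (x j)"] j pp norm_u unfolding Z_simps(1) Z_simps(2)[OF j]
      by (subst norm_minus_commute) (simp add: norm_mult norm_divide)
    show "norm (Z 0 - z) = 2 * Im p / norm (w - cnj p)"
      using A_diff_u[of w] w pp norm_u unfolding Z_simps(1) z_def
      by (subst norm_minus_commute) (simp add: norm_mult norm_divide)
    show "norm (Z j - z) = 2 * Im p * norm (w - of_real (x j)) / (norm (of_real (x j) - cnj p) * norm (w - cnj p))"
      using A_diff[of "of_real (x j)" w] w pp norm_u unfolding Z_simps(2)[OF j] z_def
      by (simp add: norm_mult norm_divide norm_minus_commute)
  qed
  note diff
  also have "norm (Z 0 - Z j) * (4 * Im w * Im p / (norm (w - cnj p))\<^sup>2) / (norm (Z 0 - z) * norm (Z j - z)) =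
     2 * Im p / norm (of_real (x j) - cnj p) * (4 * Im w * Im p / (norm (w - cnj p))\<^sup>2) /
     (2 * Im p / norm (w - cnj p) * (2 * Im p * norm (w - of_real (x j)) / (norm (of_real (x j) - cnj p) * norm (w - cnj p))))"
    unfolding dists ..
  also have "\<dots> = 2 * Im w / norm (w - of_real (x j))"
  proof -
    have "norm (w - cnj p) \<noteq> 0" "norm (of_real (x j) - cnj p) \<noteq> 0" "norm (w - of_real (x j)) \<noteq> 0"
      using denom_nz[of w] denom_nz[of "of_real (x j)"] w by auto
    then show ?thesis using Im_p by (simp add: divide_simps power2_eq_square)
  qed
  finally show "norm ((Z 0 - A w) / (1 - Z 0 * cnj (A w)) - (Z j - A w) / (1 - Z j * cnj (A w))) =
    2 * Im w / norm (w - of_real (x j))" unfolding z_def .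
qed

text \<open>If two of \<open>d + 1\<close> unit vectors differ by at least \<delta>, the
  parallelogram law bounds their sum by \<open>sqrt (4 - \<delta>\<^sup>2)\<close>, and the others
  add at most \<open>d - 1\<close>. The mean therefore keeps a distance from the circle that depends
  only on \<open>d\<close> and \<delta>.\<close>

lemma displacement_bound:
  assumes w: "Im w > 0" and j: "j \<in> {1..d}" and \<delta>: "\<delta> > 0" "2 * Im w \<ge> \<delta> * norm (w - of_real (x j))"
  defines "\<rho> \<equiv> (real d - 1 + sqrt (4 - \<delta>\<^sup>2)) / real (d + 1)"
  shows "hdist (f (A w)) (A w) \<le> ln ((1 + \<rho>) / (1 - \<rho>))" "\<rho> < 1"
proof -
  define t where "t k = (Z k - A w) / (1 - Z k * cnj (A w))" for k
  define r where "r = norm (\<Sum>k\<le>d. t k) / real (d + 1)"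
  have t1: "norm (t k) = 1" if "k \<le> d" for k using visual_diff(2)[OF w j that] by (simp add: t_def)
  have wx: "norm (w - of_real (x j)) > 0" using w by (auto simp: complex_eq_iff)
  have td: "norm (t 0 - t j) \<ge> \<delta>"
    unfolding t_def visual_diff(1)[OF w j] using \<delta> wx by (simp add: le_divide_eq)
  have par: "(norm (t 0 + t j))\<^sup>2 + (norm (t 0 - t j))\<^sup>2 = 4"
  proof -
    have "(norm (t 0 + t j))\<^sup>2 + (norm (t 0 - t j))\<^sup>2 = 2 * (norm (t 0))\<^sup>2 + 2 * (norm (t j))\<^sup>2"
      unfolding cmod_power2 by (simp add: power2_eq_square algebra_simps)
    then show ?thesis using t1[of 0] t1[of j] j by simp
  qed
  moreover have "\<delta>\<^sup>2 \<le> (norm (t 0 - t j))\<^sup>2" using td \<delta> by (intro power_mono) auto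
  ultimately have s: "(norm (t 0 + t j))\<^sup>2 \<le> 4 - \<delta>\<^sup>2" by linarith
  then have sq: "norm (t 0 + t j) \<le> sqrt (4 - \<delta>\<^sup>2)" by (rule real_le_rsqrt)
  have lt2: "sqrt (4 - \<delta>\<^sup>2) < 2" using \<delta> by (intro real_less_lsqrt) auto
  then show \<rho>1: "\<rho> < 1" unfolding \<rho>_def using d2 by (simp add: divide_less_eq)
  have "(\<Sum>k\<le>d. t k) = t 0 + t j + (\<Sum>k\<in>{..d} - {0, j}. t k)"
  proof -
    have "{..d} = insert 0 (insert j ({..d} - {0, j}))" using j by auto
    then have "(\<Sum>k\<le>d. t k) = (\<Sum>k\<in>insert 0 (insert j ({..d} - {0, j})). t k)" by simp
    also have "\<dots> = t 0 + (t j + (\<Sum>k\<in>{..d} - {0, j}. t k))" using j by (subst sum.insert; simp)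
    finally show ?thesis by (simp add: add.assoc)
  qed
  then have "norm (\<Sum>k\<le>d. t k) \<le> norm (t 0 + t j) + norm (\<Sum>k\<in>{..d} - {0, j}. t k)"
    by (simp add: norm_triangle_ineq)
  also have "norm (\<Sum>k\<in>{..d} - {0, j}. t k) \<le> (\<Sum>k\<in>{..d} - {0, j}. 1)"
    using t1 by (intro sum_norm_le) auto
  also have "(\<Sum>k\<in>{..d} - {0, j}. 1) = real d - 1"
    using j by (simp add: card_Diff_subset of_nat_diff)
  finally have r: "r \<le> \<rho>" unfolding r_def \<rho>_def using sq by (intro divide_right_mono) auto
  have r0: "r \<ge> 0" by (simp add: r_def)
  have "hdist (f (A w)) (A w) = ln ((1 + r) / (1 - r))"
    unfolding hdist_def Let_def displacement[where f = f and z = "A w", OF A_ball[OF w] f_eq] r_def t_def ..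
  also have "\<dots> \<le> ln ((1 + \<rho>) / (1 - \<rho>))"
    using r r0 \<rho>1 by (intro ln_mono frac_le divide_pos_pos) auto
  finally show "hdist (f (A w)) (A w) \<le> ln ((1 + \<rho>) / (1 - \<rho>))" .
qed

text \<open>Here \<open>cnj \<mu>\<close> is the chart coordinate of \<open>cnj \<zeta>\<close>,
  recentred at \<open>x0\<close> and rescaled by \<open>s\<close>. In this coordinate
  \<open>Z j / (1 - Z j * \<zeta>)\<close> becomes \<open>k * (E j - 1)\<close> with a multiple
  \<open>E j\<close> of a Cauchy kernel, and \<open>d + 1\<close> times the sum of squares minus the
  square of the sum is, like a variance, unchanged by the translation by \<open>- 1\<close>. The
  marked end has \<open>E 0 = 0\<close> and is left only in the coefficient
  \<open>d + 1\<close>.\<close>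

lemma deriv_crit_form:
  fixes x0 s :: real
  assumes s: "s > 0" and \<zeta>: "norm \<zeta> < 1"
  defines "X \<equiv> \<lambda>j. (x j - x0) / s"
    and "\<mu> \<equiv> (p + (p - cnj p) / (\<zeta> * u - 1) - of_real x0) / of_real s"
    and "H \<equiv> - (u\<^sup>2 * (p - cnj p)\<^sup>2 / (\<zeta> * u - 1) ^ 4 / of_real s ^ 2 / (of_nat (d + 1) + \<zeta> * tsum \<zeta>)\<^sup>2)"
  shows "deriv (\<lambda>w. num w / den w) \<zeta> = H * crit_form (real (d + 1)) {1..d} X \<mu>" "H \<noteq> 0"
    "Im \<mu> < 0" "A (of_real x0 + of_real s * cnj \<mu>) = cnj \<zeta>"
proof -
  obtain v where v: "Im v > 0" "A v = cnj \<zeta>" using A_surj[of "cnj \<zeta>"] \<zeta> by auto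
  define w where "w = cnj v"
  define W where "W = w - p"
  define k where "k = u * W / (p - cnj p)"
  have wv: "w - p = cnj (v - cnj p)" by (simp add: w_def)
  have Wnz: "W \<noteq> 0" unfolding W_def wv using denom_nz[of v] v(1) by (metis complex_cnj_zero_iff less_imp_le)
  have \<zeta>u: "\<zeta> * u = (w - cnj p) / W"
  proof -
    have "\<zeta> = cnj u * (w - cnj p) / W"
      using arg_cong[OF v(2), of cnj] by (simp add: cayley_def w_def W_def)
    then show ?thesis using u_cnj by (simp add: mult_ac)
  qed
  have \<zeta>u1: "\<zeta> * u - 1 = (p - cnj p) / W"
    unfolding \<zeta>u using Wnz by (simp add: W_def divide_simps)
  have W': "W = (p - cnj p) / (\<zeta> * u - 1)" unfolding \<zeta>u1 using p_cnj_nz Wnz by simp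
  have \<mu>: "\<mu> = (w - of_real x0) / of_real s" unfolding \<mu>_def W'[symmetric] by (simp add: W_def)
  show "Im \<mu> < 0" unfolding \<mu> using v(1) s by (simp add: w_def)
  show "A (of_real x0 + of_real s * cnj \<mu>) = cnj \<zeta>"
    unfolding \<mu> using s v(2) by (simp add: w_def)
  define E where "E j = (if j = 0 then 0 else W / (w - of_real (x j)))" for j
  have wx: "w - of_real t \<noteq> 0" for t using v(1) by (auto simp: w_def complex_eq_iff)
  have T: "Z j / (1 - Z j * \<zeta>) = k * (E j - 1)" if j: "j \<le> d" for j
  proof (cases "j = 0")
    case True
    have "1 - u * \<zeta> = - ((p - cnj p) / W)" using \<zeta>u1 by (simp add: algebra_simps)
    then show ?thesis using True p_cnj_nz Wnz by (simp add: E_def k_def Z_simps)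
  next
    case False
    have xp: "of_real (x j) - cnj p \<noteq> 0" using denom_nz[of "of_real (x j)"] by simp
    have Zj: "Z j = u * (of_real (x j) - p) / (of_real (x j) - cnj p)"
      using False by (simp add: circle_point_def cayley_def)
    have "1 - Z j * \<zeta> = 1 - (of_real (x j) - p) / (of_real (x j) - cnj p) * (\<zeta> * u)"
      unfolding Zj by simp
    also have "\<dots> = (p - cnj p) * (w - of_real (x j)) / ((of_real (x j) - cnj p) * W)"
      unfolding \<zeta>u using xp Wnz by (simp add: divide_simps) (simp add: W_def algebra_simps)
    finally have den: "1 - Z j * \<zeta> = (p - cnj p) * (w - of_real (x j)) / ((of_real (x j) - cnj p) * W)" .
    have "k * (E j - 1) = u * W * (of_real (x j) - p) / ((p - cnj p) * (w - of_real (x j)))"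
      unfolding k_def E_def using False wx[of "x j"] p_cnj_nz by (simp add: divide_simps) (simp add: W_def)
    then show ?thesis unfolding den unfolding Zj using xp Wnz p_cnj_nz wx[of "x j"] by (simp add: divide_simps)
  qed
  define e1 e2 where "e1 = (\<Sum>j\<in>{1..d}. 1 / (w - of_real (x j)))"
    and "e2 = (\<Sum>j\<in>{1..d}. 1 / (w - of_real (x j))\<^sup>2)"
  have ins: "{..d} = insert 0 {1..d}" by auto
  have sE: "(\<Sum>j\<le>d. E j) = W * e1" "(\<Sum>j\<le>d. (E j)\<^sup>2) = W\<^sup>2 * e2"
    unfolding ins e1_def e2_def by (simp_all add: E_def sum_distrib_left power_divide)
  have ts: "tsum \<zeta> = k * (W * e1 - of_nat (d + 1))"
  proof -
    have "tsum \<zeta> = (\<Sum>j\<le>d. k * (E j - 1))" unfolding tsum_def using T by (intro sum.cong) auto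
    also have "\<dots> = k * (W * e1 - of_nat (d + 1))" by (simp add: sum_distrib_left[symmetric] sum_subtractf sE)
    finally show ?thesis .
  qed
  have t2: "(\<Sum>j\<le>d. (Z j)\<^sup>2 / (1 - Z j * \<zeta>)\<^sup>2) = k\<^sup>2 * (W\<^sup>2 * e2 - 2 * (W * e1) + of_nat (d + 1))"
  proof -
    have "(\<Sum>j\<le>d. (Z j)\<^sup>2 / (1 - Z j * \<zeta>)\<^sup>2) = (\<Sum>j\<le>d. k\<^sup>2 * ((E j)\<^sup>2 - 2 * E j + 1))"
    proof (intro sum.cong refl)
      fix j assume "j \<in> {..d}"
      then have "(Z j / (1 - Z j * \<zeta>))\<^sup>2 = (k * (E j - 1))\<^sup>2" using T by simp
      then show "(Z j)\<^sup>2 / (1 - Z j * \<zeta>)\<^sup>2 = k\<^sup>2 * ((E j)\<^sup>2 - 2 * E j + 1)"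
        by (simp add: power_divide power2_eq_square algebra_simps)
    qed
    also have "\<dots> = k\<^sup>2 * (W\<^sup>2 * e2 - 2 * (W * e1) + of_nat (d + 1))"
      unfolding sum_distrib_left[symmetric] sum.distrib sum_subtractf sE by simp
    finally show ?thesis .
  qed
  have cf: "crit_form (real (d + 1)) {1..d} X \<mu> = of_real s ^ 2 * (e1\<^sup>2 - of_nat (d + 1) * e2)"
  proof -
    have m: "1 / (\<mu> - of_real (X j)) = of_real s * (1 / (w - of_real (x j)))" for j
    proof -
      have "\<mu> - of_real (X j) = (w - of_real (x j)) / of_real s"
        using s by (simp add: \<mu> X_def diff_divide_distrib[symmetric])
      then show ?thesis by simp
    qed
    have m2: "1 / (\<mu> - of_real (X j))\<^sup>2 = of_real s ^ 2 * (1 / (w - of_real (x j))\<^sup>2)" for j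
      using arg_cong[OF m[of j], of "\<lambda>z. z\<^sup>2"] by (simp add: power_divide power_mult_distrib)
    show ?thesis unfolding crit_form_def m m2 e1_def e2_def sum_distrib_left[symmetric]
      by (simp add: power_mult_distrib algebra_simps)
  qed
  let ?D = "of_nat (d + 1) + \<zeta> * tsum \<zeta>"
  have D0: "?D \<noteq> 0" using inv_sum(2)[OF \<zeta>] .
  have kW: "u\<^sup>2 * (p - cnj p)\<^sup>2 / (\<zeta> * u - 1) ^ 4 = k\<^sup>2 * W\<^sup>2"
    unfolding \<zeta>u1 k_def using p_cnj_nz Wnz by (simp add: power_divide power_mult_distrib divide_simps eval_nat_numeral)
  have k0: "k \<noteq> 0" unfolding k_def using u_nz Wnz p_cnj_nz by simp
  show "H \<noteq> 0" unfolding H_def kW using D0 k0 Wnz s by simp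
  have "deriv (\<lambda>w. num w / den w) \<zeta> = (of_nat (d + 1) * (k\<^sup>2 * (W\<^sup>2 * e2 - 2 * (W * e1) + of_nat (d + 1))) - (tsum \<zeta>)\<^sup>2) / ?D\<^sup>2"
    unfolding deriv_quotient[OF \<zeta>] t2 ..
  also have "of_nat (d + 1) * (k\<^sup>2 * (W\<^sup>2 * e2 - 2 * (W * e1) + of_nat (d + 1))) - (tsum \<zeta>)\<^sup>2 =
      - (k\<^sup>2 * W\<^sup>2 * (e1\<^sup>2 - of_nat (d + 1) * e2))"
    unfolding ts by (simp add: power2_eq_square algebra_simps)
  also have "\<dots> / ?D\<^sup>2 = H * crit_form (real (d + 1)) {1..d} X \<mu>"
    unfolding cf H_def kW using s D0 by simp
  finally show "deriv (\<lambda>w. num w / den w) \<zeta> = H * crit_form (real (d + 1)) {1..d} X \<mu>" .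
qed

lemma crit_mult_eq:
  fixes x0 s :: real
  assumes s: "s > 0" and \<omega>: "Im \<omega> < 0"
  defines "N \<equiv> crit_form (real (d + 1)) {1..d} (\<lambda>j. (x j - x0) / s)"
    and "c \<equiv> A (of_real x0 + of_real s * cnj \<omega>)"
  shows "c \<in> crit_pts f \<longleftrightarrow> N \<omega> = 0" "int (crit_mult f c) = zorder N \<omega>" "norm c < 1"
proof -
  define \<mu> where "\<mu> \<zeta> = (p + (p - cnj p) / (\<zeta> * u - 1) - of_real x0) / of_real s" for \<zeta>
  define H where "H \<zeta> = - (u\<^sup>2 * (p - cnj p)\<^sup>2 / (\<zeta> * u - 1) ^ 4 / of_real s ^ 2 / (of_nat (d + 1) + \<zeta> * tsum \<zeta>)\<^sup>2)" for \<zeta>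
  note D = deriv_crit_form(1)[OF s, of _ x0, folded \<mu>_def H_def N_def]
    deriv_crit_form(2)[OF s, folded H_def] deriv_crit_form(3,4)[OF s, of _ x0, folded \<mu>_def]
  have imp: "Im (of_real x0 + of_real s * cnj \<omega>) > 0" using s \<omega> by (simp add: mult_pos_neg)
  show c1: "norm c < 1" unfolding c_def by (rule A_ball[OF imp])
  define \<zeta>0 where "\<zeta>0 = cnj c"
  have z1: "norm \<zeta>0 < 1" using c1 by (simp add: \<zeta>0_def)
  have \<mu>0: "\<mu> \<zeta>0 = \<omega>"
  proof -
    have "A (of_real x0 + of_real s * cnj (\<mu> \<zeta>0)) = A (of_real x0 + of_real s * cnj \<omega>)"
      using D(4)[OF z1] by (simp add: \<zeta>0_def c_def)
    moreover have "Im (of_real x0 + of_real s * cnj (\<mu> \<zeta>0)) \<ge> 0" using D(3)[OF z1] s by (simp add: mult_nonneg_nonpos)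
    ultimately have "of_real x0 + of_real s * cnj (\<mu> \<zeta>0) = of_real x0 + of_real s * cnj \<omega>"
      using A_inj imp by (meson less_imp_le)
    then show ?thesis using s by simp
  qed
  show "c \<in> crit_pts f \<longleftrightarrow> N \<omega> = 0"
    unfolding crit_pts_def f_cnj using c1 D(1,2)[OF z1] \<mu>0 by (simp add: \<zeta>0_def)
  have card: "real (card {1..d}) < real (d + 1)" by simp
  have J: "finite {1..d}" "{1..d} \<noteq> {}" using d2 by auto
  obtain k S R where R: "open S" "\<omega> \<in> S" "R holomorphic_on S" "R \<omega> \<noteq> 0"
    "zorder N \<omega> = int k" "\<And>w. w \<in> S \<Longrightarrow> N w = (w - \<omega>) ^ k * R w"
    using crit_form_zeros(3)[OF J card \<omega>, of "\<lambda>j. (x j - x0) / s", folded N_def] by metis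
  have nz: "\<zeta> * u - 1 \<noteq> 0" if "norm \<zeta> < 1" for \<zeta>
  proof
    assume "\<zeta> * u - 1 = 0"
    then have "norm (\<zeta> * u) = 1" by simp
    then show False using that norm_u by (simp add: norm_mult)
  qed
  have hol\<mu>: "\<mu> holomorphic_on ball 0 1" unfolding \<mu>_def using nz s by (intro holomorphic_intros) auto
  have fnz: "1 - Z j * \<zeta> \<noteq> 0" if "norm \<zeta> < 1" "j \<le> d" for \<zeta> j
    using full_nz[OF that(1)] that(2) by (auto simp: full_def)
  have holt: "tsum holomorphic_on ball 0 1"
    unfolding tsum_def using fnz by (intro holomorphic_intros) auto
  have holH: "H holomorphic_on ball 0 1"
    unfolding H_def using nz s inv_sum(2) by (intro holomorphic_intros holt) auto
  \<comment> \<open>Difference quotient of the Moebius map \<mu> at \<open>\<zeta>0\<close>. It is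
    nonzero there, so composing with \<mu> preserves the order of vanishing.\<close>
  define \<theta> where "\<theta> \<zeta> = - ((p - cnj p) * u / ((\<zeta> * u - 1) * (\<zeta>0 * u - 1) * of_real s))" for \<zeta>
  have \<mu>d: "\<mu> \<zeta> - \<omega> = (\<zeta> - \<zeta>0) * \<theta> \<zeta>" if "norm \<zeta> < 1" for \<zeta>
    unfolding \<mu>0[symmetric] \<mu>_def \<theta>_def using nz[OF that] nz[OF z1] s
    by (simp add: divide_simps) (simp add: algebra_simps)
  have \<theta>0: "\<theta> \<zeta>0 \<noteq> 0" unfolding \<theta>_def using p_cnj_nz u_nz nz[OF z1] s by simp
  have hol\<theta>: "\<theta> holomorphic_on ball 0 1" unfolding \<theta>_def using nz z1 s by (intro holomorphic_intros) auto
  define B where "B = ball 0 1 \<inter> \<mu> -` S"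
  have B: "open B" "B \<subseteq> ball 0 1" "\<zeta>0 \<in> B"
    unfolding B_def using continuous_open_preimage[OF holomorphic_on_imp_continuous_on[OF hol\<mu>] open_ball R(1)]
      z1 \<mu>0 R(2) by auto
  have "zorder (deriv (\<lambda>w. f (cnj w))) \<zeta>0 = int k"
  proof (rule zorder_eqI[OF B(1,3), where g = "\<lambda>\<zeta>. H \<zeta> * (\<theta> \<zeta>) ^ k * R (\<mu> \<zeta>)"])
    have "(R \<circ> \<mu>) holomorphic_on B"
      using holomorphic_on_subset[OF hol\<mu> B(2)] R(3) by (rule holomorphic_on_compose_gen) (auto simp: B_def)
    then show "(\<lambda>\<zeta>. H \<zeta> * (\<theta> \<zeta>) ^ k * R (\<mu> \<zeta>)) holomorphic_on B"
      using holomorphic_on_subset[OF holH B(2)] holomorphic_on_subset[OF hol\<theta> B(2)]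
      by (auto intro!: holomorphic_intros simp: o_def)
    show "H \<zeta>0 * (\<theta> \<zeta>0) ^ k * R (\<mu> \<zeta>0) \<noteq> 0" using D(2)[OF z1] \<theta>0 R(4) \<mu>0 by simp
    fix \<zeta> assume \<zeta>: "\<zeta> \<in> B" "\<zeta> \<noteq> \<zeta>0"
    then have n1: "norm \<zeta> < 1" and S: "\<mu> \<zeta> \<in> S" using B(2) by (auto simp: B_def)
    show "deriv (\<lambda>w. f (cnj w)) \<zeta> = H \<zeta> * (\<theta> \<zeta>) ^ k * R (\<mu> \<zeta>) * (\<zeta> - \<zeta>0) powi int k"
      unfolding f_cnj D(1)[OF n1] R(6)[OF S] \<mu>d[OF n1] by (simp add: power_mult_distrib mult_ac)
  qed
  then show "int (crit_mult f c) = zorder N \<omega>" unfolding crit_mult_def \<zeta>0_def[symmetric] R(5) by simp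
qed

text \<open>The chart is an isometry, and rescaling and conjugation take the ball about
  \<open>Complex x0 s\<close> to the disk about \<open>- \<i>\<close> of \<open>lower_disk\<close>.
  The radius is the hyperbolic counterpart of the ratio \<rho>, so it is the same at every scale
  \<open>s\<close>.\<close>

lemma crit_count_eq:
  fixes x0 s \<rho> :: real
  assumes s: "s > 0" and \<rho>: "0 < \<rho>" "\<rho> < 1"
  defines "N \<equiv> crit_form (real (d + 1)) {1..d} (\<lambda>j. (x j - x0) / s)"
  shows "int (crit_count_near f (A (Complex x0 s)) (ln ((1 + \<rho>) / (1 - \<rho>)))) =
    (\<Sum>\<omega> | Im \<omega> < 0 \<and> norm (\<omega> + \<i>) \<le> \<rho> * norm (\<omega> - \<i>) \<and> N \<omega> = 0. zorder N \<omega>)"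
proof -
  define g where "g \<omega> = A (of_real x0 + of_real s * cnj \<omega>)" for \<omega>
  note C = crit_mult_eq[OF s, of _ x0, folded N_def g_def]
  let ?R = "ln ((1 + \<rho>) / (1 - \<rho>))"
  have im: "Im (of_real x0 + of_real s * cnj \<omega>) > 0" if "Im \<omega> < 0" for \<omega>
    using s that by (simp add: mult_pos_neg)
  have near: "hdist (g \<omega>) (A (Complex x0 s)) \<le> ?R \<longleftrightarrow> norm (\<omega> + \<i>) \<le> \<rho> * norm (\<omega> - \<i>)" if \<omega>: "Im \<omega> < 0" for \<omega>
  proof -
    define r where "r = norm (\<omega> + \<i>) / norm (\<omega> - \<i>)"
    have d0: "norm (\<omega> - \<i>) > 0" using \<omega> by (auto simp: complex_eq_iff)
    have "(norm (\<omega> + \<i>))\<^sup>2 < (norm (\<omega> - \<i>))\<^sup>2"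
      unfolding cmod_power2 using \<omega> by (simp add: power2_eq_square algebra_simps)
    then have "norm (\<omega> + \<i>) < norm (\<omega> - \<i>)" by (rule power2_less_imp_less) simp
    then have r: "0 \<le> r" "r < 1" using d0 by (auto simp: r_def)
    have 1: "of_real x0 + of_real s * cnj \<omega> - Complex x0 s = of_real s * cnj (\<omega> + \<i>)"
      "of_real x0 + of_real s * cnj \<omega> - cnj (Complex x0 s) = of_real s * cnj (\<omega> - \<i>)"
      by (simp_all add: complex_eq_iff algebra_simps)
    have "norm (g \<omega> - A (Complex x0 s)) / norm (1 - cnj (A (Complex x0 s)) * g \<omega>) = r"
      unfolding g_def using hdist_A[of "of_real x0 + of_real s * cnj \<omega>" "Complex x0 s"] im[OF \<omega>] s
      unfolding 1 norm_mult complex_mod_cnj by (simp add: r_def)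
    then have "hdist (g \<omega>) (A (Complex x0 s)) = ln ((1 + r) / (1 - r))" by (simp add: hdist_def Let_def)
    then have "hdist (g \<omega>) (A (Complex x0 s)) \<le> ?R \<longleftrightarrow> (1 + r) / (1 - r) \<le> (1 + \<rho>) / (1 - \<rho>)"
      using r \<rho> by (simp add: ln_le_cancel_iff)
    also have "\<dots> \<longleftrightarrow> r \<le> \<rho>" using r \<rho> by (simp add: divide_simps) (simp add: algebra_simps)
    also have "\<dots> \<longleftrightarrow> norm (\<omega> + \<i>) \<le> \<rho> * norm (\<omega> - \<i>)" using d0 by (simp add: r_def divide_le_eq)
    finally show ?thesis .
  qed
  let ?S = "{\<omega>. Im \<omega> < 0 \<and> norm (\<omega> + \<i>) \<le> \<rho> * norm (\<omega> - \<i>) \<and> N \<omega> = 0}"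
  have "bij_betw g ?S {c \<in> crit_pts f. hdist c (A (Complex x0 s)) \<le> ?R}"
  proof (intro bij_betw_imageI inj_onI equalityI subsetI)
    fix a b assume ab: "a \<in> ?S" "b \<in> ?S" "g a = g b"
    have "of_real x0 + of_real s * cnj a = of_real x0 + of_real s * cnj b"
      by (rule A_inj) (use im ab in \<open>auto simp: g_def less_imp_le\<close>)
    then show "a = b" using s by simp
  next
    fix c assume "c \<in> g ` ?S"
    then show "c \<in> {c \<in> crit_pts f. hdist c (A (Complex x0 s)) \<le> ?R}" using near C(1) by auto
  next
    fix c assume c: "c \<in> {c \<in> crit_pts f. hdist c (A (Complex x0 s)) \<le> ?R}"
    then have "norm c < 1" by (auto simp: crit_pts_def)
    then obtain v where v: "Im v > 0" "A v = c" using A_surj by blast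
    define \<omega> where "\<omega> = cnj ((v - of_real x0) / of_real s)"
    have w: "Im \<omega> < 0" "g \<omega> = c" using v s by (auto simp: \<omega>_def g_def)
    then have "\<omega> \<in> ?S" using near[OF w(1)] C(1)[OF w(1)] c by auto
    then show "c \<in> g ` ?S" using w(2) by blast
  qed
  then have "crit_count_near f (A (Complex x0 s)) ?R = (\<Sum>\<omega>\<in>?S. crit_mult f (g \<omega>))"
    unfolding crit_count_near_def by (rule sum.reindex_bij_betw[symmetric])
  then have "int (crit_count_near f (A (Complex x0 s)) ?R) = (\<Sum>\<omega>\<in>?S. int (crit_mult f (g \<omega>)))" by simp
  also have "\<dots> = (\<Sum>\<omega>\<in>?S. zorder N \<omega>)" using C(2) by (intro sum.cong) auto
  finally show ?thesis .
qed

end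

section \<open>The embedded tree\<close>

lemma geo_open_endpoints:
  assumes p: "norm p < 1" and q: "norm q \<le> 1" and ne: "p \<noteq> q"
  shows "p \<notin> geo_open p q" "q \<notin> geo_open p q"
proof -
  define a where "a = moeb (- p) q"
  have a0: "a \<noteq> 0"
  proof
    assume "a = 0"
    then have "q = moeb p 0" using moeb_inverse[OF p q] by (simp add: a_def)
    then show False using ne by (simp add: moeb_def)
  qed
  have na: "norm a \<le> 1" unfolding a_def by (rule moeb_minus_cball[OF p q])
  have inv: "moeb (- p) (moeb p w) = w" if "norm w \<le> 1" for w
    using moeb_inverse[of "- p" w] p that by simp
  have *: "moeb (- p) (moeb p (of_real s * a)) = of_real s * a" if "0 < s" "s < 1" for s
    using that na by (intro inv) (simp add: norm_mult mult_le_one)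
  show "p \<notin> geo_open p q"
  proof
    assume "p \<in> geo_open p q"
    then obtain s where s: "0 < s" "s < 1" "p = moeb p (of_real s * a)" by (auto simp: geo_open_alt a_def)
    then have "moeb (- p) p = of_real s * a" using * by metis
    then show False using a0 s by (simp add: moeb_def)
  qed
  show "q \<notin> geo_open p q"
  proof
    assume "q \<in> geo_open p q"
    then obtain s where s: "0 < s" "s < 1" "q = moeb p (of_real s * a)" by (auto simp: geo_open_alt a_def)
    then have "a = of_real s * a" using * unfolding a_def by metis
    then show False using a0 s by simp
  qed
qed

text \<open>The bound on \<epsilon> leaves room for a half-disk of radius
  \<open>(real d + 1) * \<epsilon> ^ h b\<close> around the subtree of each branch point
  \<open>b\<close>; see \<open>scale_gap\<close>.\<close>

locale tree_embedding = planar_tree V r p h d lab + half_plane_chart u q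
  for V :: "'v set" and r p h d lab u q +
  fixes \<epsilon> :: real
  assumes eps: "\<epsilon> > 0" "(real d + 2) * \<epsilon> \<le> 1" and d2: "d \<ge> 2"
begin

lemma eps_half: "\<epsilon> \<le> 1 / 2"
proof -
  have "2 * \<epsilon> \<le> (real d + 2) * \<epsilon>" using eps by (intro mult_right_mono) auto
  also have "\<dots> \<le> 1" by (rule eps(2))
  finally show ?thesis by simp
qed

definition branch :: "'v set" where
  "branch = V - {r} - leaves"

definition hpt :: "'v \<Rightarrow> complex" where
  "hpt v = Complex (xpos \<epsilon> (lo v)) (if v \<in> leaves then 0 else \<epsilon> ^ h v)"

definition emb :: "'v \<Rightarrow> complex" where
  "emb v = (if v = r then u else A (hpt v))"

lemma branchD: "v \<in> branch \<Longrightarrow> v \<in> V" "v \<in> branch \<Longrightarrow> v \<noteq> r" "v \<in> branch \<Longrightarrow> v \<notin> leaves"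
  by (auto simp: branch_def)

lemma parent_branch: "v \<in> V \<Longrightarrow> v \<noteq> r \<Longrightarrow> p v \<noteq> r \<Longrightarrow> p v \<in> branch"
  using parent_in[of v] by (auto simp: branch_def leaves_def children_def)

lemma Im_hpt: "Im (hpt v) \<ge> 0" "v \<in> branch \<Longrightarrow> Im (hpt v) > 0" "v \<in> branch \<Longrightarrow> Im (hpt v) = \<epsilon> ^ h v"
  using eps branchD by (auto simp: hpt_def)

lemma emb_branch: "v \<in> branch \<Longrightarrow> emb v = A (hpt v)" "v \<in> branch \<Longrightarrow> norm (emb v) < 1"
  using A_ball[OF Im_hpt(2)] branchD by (auto simp: emb_def)

lemma emb_cball: "norm (emb v) \<le> 1"
  using A_cball[OF Im_hpt(1)] norm_u by (auto simp: emb_def)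

lemma emb_end: "v \<in> leaves \<or> v = r \<Longrightarrow> norm (emb v) = 1"
  using A_sphere[of "hpt v"] norm_u by (auto simp: emb_def hpt_def)

text \<open>A fence around the subtree of \<open>b\<close>: positive inside the circle of radius
  \<open>(real d + 1) * \<epsilon> ^ h b\<close> centred below \<open>b\<close>. In units of
  \<open>\<epsilon> ^ h b\<close> the subtree extends at most \<open>d\<close> sideways and 1
  upwards, while every other vertex is at least \<open>1 / \<epsilon>\<close>, hence
  \<open>d + 2\<close>, away from the centre.\<close>

definition dform :: "'v \<Rightarrow> complex \<Rightarrow> real" where
  "dform b = hform (- 1) (2 * xpos \<epsilon> (lo b)) (((real d + 1) * \<epsilon> ^ h b)\<^sup>2 - (xpos \<epsilon> (lo b))\<^sup>2)"

text \<open>\<open>hform_geo\<close> speaks of positivity only; the negated form provides the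
  convexity of the outside of a fence.\<close>

lemma dform_uminus: "hform 1 (- (2 * xpos \<epsilon> (lo b))) (- (((real d + 1) * \<epsilon> ^ h b)\<^sup>2 - (xpos \<epsilon> (lo b))\<^sup>2)) z = - dform b z"
  if "norm z \<le> 1" "z = A w \<and> Im w \<ge> 0 \<or> z = u" for w
proof -
  have neg: "hform (- a) (- b) (- c) z = - hform a b c z" for a b c
    using that(2)
  proof
    assume w: "z = A w \<and> Im w \<ge> 0"
    have "(norm (w - cnj q))\<^sup>2 > 0" using denom_nz[of w] w by simp
    moreover have "hform (- a) (- b) (- c) z * (norm (w - cnj q))\<^sup>2 = - (hform a b c z * (norm (w - cnj q))\<^sup>2)"
      using hform_A[of w "- a" "- b" "- c"] hform_A[of w a b c] w by (simp add: qform_def)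
    ultimately show ?thesis by (metis mult_minus_left mult_right_cancel less_irrefl)
  qed (simp add: hform_u)
  show ?thesis using neg[of "- 1" "2 * xpos \<epsilon> (lo b)"] unfolding dform_def minus_minus .
qed

lemma qform_disk: "qform (- 1) (2 * c) (\<rho>\<^sup>2 - c\<^sup>2) w = \<rho>\<^sup>2 - ((Re w - c)\<^sup>2 + (Im w)\<^sup>2)"
  unfolding qform_def cmod_power2 by (simp add: power2_eq_square algebra_simps)

lemma dform_sign:
  assumes "v \<in> V" "v \<noteq> r"
  shows "dform b (emb v) > 0 \<longleftrightarrow> (Re (hpt v) - xpos \<epsilon> (lo b))\<^sup>2 + (Im (hpt v))\<^sup>2 < ((real d + 1) * \<epsilon> ^ h b)\<^sup>2"
    "dform b (emb v) \<ge> 0 \<longleftrightarrow> (Re (hpt v) - xpos \<epsilon> (lo b))\<^sup>2 + (Im (hpt v))\<^sup>2 \<le> ((real d + 1) * \<epsilon> ^ h b)\<^sup>2"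
  using assms hform_sign[OF Im_hpt(1)] by (auto simp: dform_def emb_def qform_disk)

lemma Im_hpt_le: "Im (hpt v) \<le> \<epsilon> ^ h v"
  using eps by (simp add: hpt_def)

lemma scale_mono: "h b \<le> h v \<Longrightarrow> \<epsilon> ^ h v \<le> \<epsilon> ^ h b"
  using eps eps_half by (intro power_decreasing) auto

lemma dform_inside:
  assumes b: "b \<in> branch" and v: "v \<in> desc b"
  shows "dform b (emb v) > 0"
proof -
  have vr: "v \<in> V" "v \<noteq> r" using desc_in[OF v] desc_root_eq[of b] v branchD(2)[OF b] by auto
  have "lo v \<in> below b" using lo_in[OF vr] below_mono[OF v] by auto
  then have "\<bar>xpos \<epsilon> (lo v) - xpos \<epsilon> (lo b)\<bar> \<le> real d * \<epsilon> ^ h b"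
    using eps eps_half b lo_in[of b] branchD by (intro xpos_near[of \<epsilon> b]) auto
  then have 1: "(Re (hpt v) - xpos \<epsilon> (lo b))\<^sup>2 \<le> (real d * \<epsilon> ^ h b)\<^sup>2"
    by (simp add: hpt_def power2_le_iff_abs_le abs_le_square_iff[symmetric])
  have "Im (hpt v) \<le> \<epsilon> ^ h b" using Im_hpt_le[of v] scale_mono[OF height_desc_le[OF v]] by simp
  then have 2: "(Im (hpt v))\<^sup>2 \<le> (\<epsilon> ^ h b)\<^sup>2" using Im_hpt(1) by (intro power_mono) auto
  have "((real d + 1) * \<epsilon> ^ h b)\<^sup>2 = (real d * \<epsilon> ^ h b)\<^sup>2 + (\<epsilon> ^ h b)\<^sup>2 + 2 * real d * (\<epsilon> ^ h b)\<^sup>2"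
    by (simp add: power2_eq_square algebra_simps)
  moreover have "2 * real d * (\<epsilon> ^ h b)\<^sup>2 > 0" using d2 eps by simp
  ultimately show ?thesis unfolding dform_sign(1)[OF vr] using 1 2 by linarith
qed

lemma scale_gap:
  assumes "\<epsilon> ^ h b \<le> \<epsilon> * t" "t \<ge> 0"
  shows "(real d + 1) * \<epsilon> ^ h b < t"
proof -
  have "(real d + 2) * \<epsilon> ^ h b \<le> (real d + 2) * (\<epsilon> * t)" using assms by (intro mult_left_mono) auto
  also have "\<dots> = (real d + 2) * \<epsilon> * t" by simp
  also have "\<dots> \<le> 1 * t" using eps assms by (intro mult_right_mono) auto
  finally have "(real d + 2) * \<epsilon> ^ h b \<le> t" by simp
  moreover have "(real d + 1) * \<epsilon> ^ h b < (real d + 2) * \<epsilon> ^ h b" using eps by (intro mult_strict_right_mono) auto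
  ultimately show ?thesis by linarith
qed

lemma scale_ancestor:
  assumes "b \<in> desc v" "v \<noteq> b"
  shows "\<epsilon> ^ h b \<le> \<epsilon> * \<epsilon> ^ h v"
proof -
  have "Suc (h v) \<le> h b" using height_desc[OF assms(1)] assms(2) by auto
  then have "\<epsilon> ^ h b \<le> \<epsilon> ^ Suc (h v)" using eps eps_half by (intro power_decreasing) auto
  then show ?thesis by simp
qed

lemma far_apart:
  assumes "b \<in> branch" "v \<in> V" "v \<noteq> r" "v \<notin> desc b" "b \<notin> desc v"
  shows "\<epsilon> ^ h b \<le> \<epsilon> * \<bar>xpos \<epsilon> (lo v) - xpos \<epsilon> (lo b)\<bar>"
proof -
  have "lo v \<notin> below b" using below_comparable[of "lo v" v b] lo_in[of v] assms by auto
  then show ?thesis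
    using eps eps_half assms(1,2) branchD lo_in[of b] lo_in[OF assms(2,3)] below_subset[of v]
    by (intro xpos_far[of \<epsilon> b]) auto
qed

text \<open>There are three reasons to be outside: the root is at infinity, a proper ancestor of
  \<open>b\<close> is too high, and a vertex unrelated to \<open>b\<close> is too far to the
  side.\<close>

lemma dform_outside:
  assumes b: "b \<in> branch" and v: "v \<in> V" "v \<notin> desc b"
  shows "dform b (emb v) < 0"
proof (cases "v = r")
  case True
  then show ?thesis by (simp add: emb_def dform_def hform_u)
next
  case False
  have sb: "0 \<le> (real d + 1) * \<epsilon> ^ h b" using eps by simp
  have "((real d + 1) * \<epsilon> ^ h b)\<^sup>2 < (Re (hpt v) - xpos \<epsilon> (lo b))\<^sup>2 + (Im (hpt v))\<^sup>2"
  proof (cases "b \<in> desc v")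
    case True
    have ne: "v \<noteq> b" using v desc_refl by auto
    have "v \<notin> leaves" using True desc_leaf ne by auto
    then have im: "Im (hpt v) = \<epsilon> ^ h v" using Im_hpt(3) v False by (auto simp: branch_def)
    have "(real d + 1) * \<epsilon> ^ h b < \<epsilon> ^ h v" using scale_gap scale_ancestor[OF True ne] eps by auto
    then have "((real d + 1) * \<epsilon> ^ h b)\<^sup>2 < (\<epsilon> ^ h v)\<^sup>2" using sb by (intro power_strict_mono) auto
    then show ?thesis unfolding im by (simp add: add_strict_increasing2)
  next
    case nb: False
    have "(real d + 1) * \<epsilon> ^ h b < \<bar>xpos \<epsilon> (lo v) - xpos \<epsilon> (lo b)\<bar>"
      using far_apart[OF b v(1) False v(2) nb] by (intro scale_gap) auto
    then have "((real d + 1) * \<epsilon> ^ h b)\<^sup>2 < \<bar>xpos \<epsilon> (lo v) - xpos \<epsilon> (lo b)\<bar>\<^sup>2"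
      using sb by (intro power_strict_mono) auto
    moreover have Re: "Re (hpt v) = xpos \<epsilon> (lo v)" by (simp add: hpt_def)
    ultimately show ?thesis using zero_le_power2[of "Im (hpt v)"] unfolding Re power2_abs by linarith
  qed
  then show ?thesis using dform_sign(2)[OF v(1) False, of b] by linarith
qed

text \<open>A coincidence that involves a branch point is excluded by its fence or by the norm, one
  between two ends on the line by the strict monotonicity of their positions.\<close>

lemma emb_inj: "inj_on emb V"
proof (rule inj_onI, rule ccontr)
  fix v w assume vw: "v \<in> V" "w \<in> V" "emb v = emb w" "v \<noteq> w"
  have key: "v \<notin> branch" if "v \<in> V" "w \<in> V" "emb v = emb w" "w \<notin> desc v" for v w
    using dform_inside[of v v] dform_outside[of v w] that desc_refl[of v] by fastforce
  have nb: "v \<notin> branch \<and> w \<notin> branch"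
  proof (cases "w \<in> desc v")
    case True
    then have "w \<notin> branch" using key[OF vw(2,1) vw(3)[symmetric]] desc_antisym vw(4) by blast
    then have "norm (emb v) = 1" using emb_end[of w] vw by (auto simp: branch_def)
    then show ?thesis using emb_branch(2)[of v] \<open>w \<notin> branch\<close> by auto
  next
    case False
    then have "v \<notin> branch" using key[OF vw(1-3)] by blast
    then have "norm (emb w) = 1" using emb_end[of v] vw by (auto simp: branch_def)
    then show ?thesis using emb_branch(2)[of w] \<open>v \<notin> branch\<close> by auto
  qed
  have au: "A (hpt x) \<noteq> u" for x using A_neq_u[OF Im_hpt(1)] .
  have "v \<in> leaves" "w \<in> leaves"
    using nb vw au[of v] au[of w] by (auto simp: branch_def emb_def split: if_splits)
  then have l: "v \<in> leaves" "w \<in> leaves" "hpt v = hpt w"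
    using vw(3) A_inj[OF Im_hpt(1) Im_hpt(1)] leaves_in by (auto simp: emb_def)
  then have "xpos \<epsilon> (lab v) = xpos \<epsilon> (lab w)" by (simp add: hpt_def lo_leaf)
  moreover have "lab v \<noteq> lab w" using leaf_lab(1) l vw(4) by metis
  moreover have "1 \<le> lab v" "1 \<le> lab w" using leaf_lab(2) l by auto
  ultimately show False
    using xpos_less[OF eps(1), of "lab v" "lab w"] xpos_less[OF eps(1), of "lab w" "lab v"] by linarith
qed

definition edges :: "'v set set" where
  "edges = (\<lambda>v. {p v, v}) ` (V - {r})"

lemma dform_geo:
  assumes b: "b \<in> branch" and a: "a \<in> branch" "c \<in> V" and z: "z \<in> geo_open (emb a) (emb c)"
  shows "a \<in> desc b \<Longrightarrow> c \<in> desc b \<Longrightarrow> dform b z > 0" "a \<notin> desc b \<Longrightarrow> c \<notin> desc b \<Longrightarrow> dform b z < 0"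
proof -
  note ab = emb_branch(2)[OF a(1)] emb_cball[of c]
  have aV: "a \<in> V" using branchD a by blast
  show "dform b z > 0" if "a \<in> desc b" "c \<in> desc b"
    using hform_geo(2)[OF ab z] dform_inside[OF b] that by (simp add: dform_def less_imp_le)
  show "dform b z < 0" if "a \<notin> desc b" "c \<notin> desc b"
  proof -
    let ?nf = "hform 1 (- (2 * xpos \<epsilon> (lo b))) (- (((real d + 1) * \<epsilon> ^ h b)\<^sup>2 - (xpos \<epsilon> (lo b))\<^sup>2))"
    have e: "?nf (emb v) = - dform b (emb v)" for v
      using Im_hpt(1)[of v] emb_cball[of v] by (intro dform_uminus[of _ "hpt v"]) (auto simp: emb_def)
    have nz: "norm z < 1" by (rule geo_open_in_ball[OF ab z])
    then obtain w where "Im w > 0" "A w = z" using A_surj by blast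
    then have ez: "?nf z = - dform b z" using nz by (intro dform_uminus[of _ w]) auto
    have "?nf (emb a) > 0" "?nf (emb c) > 0"
      unfolding e using dform_outside[OF b aV that(1)] dform_outside[OF b a(2) that(2)] by auto
    then have "?nf z > 0" using hform_geo(2)[OF ab z] by (meson less_imp_le)
    then show ?thesis unfolding ez by simp
  qed
qed

lemma edge_cases:
  assumes "{a, c} \<in> edges"
  obtains v where "v \<in> V" "v \<noteq> r" "{a, c} = {p v, v}" "p v \<noteq> v" "a \<in> V" "c \<in> V"
proof -
  obtain v where v: "v \<in> V - {r}" "{a, c} = {p v, v}" using assms by (auto simp: edges_def)
  then have "p v \<noteq> v" using height_parent[of v] by auto
  moreover have "a \<in> V" "c \<in> V" using v parent_in[of v] by (auto simp: doubleton_eq_iff)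
  ultimately show thesis using that v by blast
qed

text \<open>If the upper vertex \<open>p v\<close> of the edge belongs to the subtree of
  \<open>b\<close>, it is a proper descendant, and its own fence encloses the edge but not
  \<open>b\<close>. Otherwise the whole edge is outside the fence of \<open>b\<close>.\<close>

lemma branch_off_edge:
  assumes b: "b \<in> branch" and a: "a \<in> branch" "{a, c} \<in> edges" "b \<noteq> a" "b \<noteq> c"
  shows "emb b \<notin> geo_open (emb a) (emb c)"
proof
  assume z: "emb b \<in> geo_open (emb a) (emb c)"
  obtain v where v: "v \<in> V" "v \<noteq> r" "{a, c} = {p v, v}" "p v \<noteq> v" "a \<in> V" "c \<in> V"
    using edge_cases[OF a(2)] .
  have bv: "b \<noteq> v" "b \<noteq> p v" using v(3) a by (auto simp: doubleton_eq_iff)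
  have bV: "b \<in> V" using b branchD by blast
  have ac: "P a \<and> P c" if "P v" "P (p v)" for P using v(3) that by (auto simp: doubleton_eq_iff)
  show False
  proof (cases "p v \<in> desc b")
    case True
    then have "p v \<noteq> r" using desc_root_eq[of b] branchD(2)[OF b] by auto
    then have x: "p v \<in> branch" using parent_branch v by blast
    have "b \<notin> desc (p v)" using True desc_antisym bv by blast
    then have "dform (p v) (emb b) < 0" using dform_outside[OF x bV] by blast
    moreover have "a \<in> desc (p v) \<and> c \<in> desc (p v)"
      by (rule ac[of "\<lambda>w. w \<in> desc (p v)"]) (use parent_desc desc_refl v branchD(1)[OF x] in auto)
    then have "dform (p v) (emb b) > 0" using dform_geo(1)[OF x a(1) v(6) z] by blast
    ultimately show False by simp
  next
    case False
    then have "v \<notin> desc b" using desc_cases(2)[of v b] bv by auto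
    then have "a \<notin> desc b \<and> c \<notin> desc b" using False by (rule ac[of "\<lambda>w. w \<notin> desc b"])
    then have "dform b (emb b) < 0" using dform_geo(2)[OF b a(1) v(6) z] by blast
    moreover have "dform b (emb b) > 0" using dform_inside[OF b desc_refl[OF bV]] .
    ultimately show False by simp
  qed
qed

text \<open>Edges with a common vertex share a branch point; as rays from it they could only overlap
  with the end of one lying on the other. Edges without a common vertex are separated by a
  fence.\<close>

lemma edges_disjoint:
  assumes a: "a \<in> branch" "{a, c} \<in> edges" and a': "a' \<in> branch" "{a', c'} \<in> edges"
    and ne: "{a, c} \<noteq> {a', c'}"
  shows "geo_open (emb a) (emb c) \<inter> geo_open (emb a') (emb c') = {}"
proof (rule ccontr)
  assume "\<not> ?thesis"
  then obtain z where z: "z \<in> geo_open (emb a) (emb c)" "z \<in> geo_open (emb a') (emb c')" by auto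
  obtain v where v: "v \<in> V" "v \<noteq> r" "{a, c} = {p v, v}" "p v \<noteq> v" "a \<in> V" "c \<in> V"
    using edge_cases[OF a(2)] .
  obtain v' where v': "v' \<in> V" "v' \<noteq> r" "{a', c'} = {p v', v'}" "p v' \<noteq> v'" "a' \<in> V" "c' \<in> V"
    using edge_cases[OF a'(2)] .
  have vv: "v \<noteq> v'" using ne v(3) v'(3) by auto
  show False
  proof (cases "{a, c} \<inter> {a', c'} = {}")
    case False
    \<comment> \<open>Two edges with the same upper vertex do not start at the root, which has a
      single child.\<close>
    have pbr: "p v \<in> branch" if "p v = p v'"
    proof (rule parent_branch[OF v(1,2)])
      show "p v \<noteq> r"
      proof
        assume "p v = r"
        then have "{v, v'} \<subseteq> children r" using v v' that by (auto simp: children_def)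
        then have "card {v, v'} \<le> 1" using card_root_children card_mono[OF finite_children] by metis
        then show False using vv by simp
      qed
    qed
    have "\<exists>s\<in>branch. s \<in> {a, c} \<and> s \<in> {a', c'}"
    proof -
      have "p v = p v' \<or> v = p v' \<or> p v = v'" using False vv unfolding v(3) v'(3) by auto
      then show ?thesis
        unfolding v(3) v'(3) using pbr parent_branch[OF v'(1,2)] parent_branch[OF v(1,2)] v(2) v'(2) by auto
    qed
    then obtain s t t' where s: "s \<in> branch" "{a, c} = {s, t}" "{a', c'} = {s, t'}"
      by (metis insert_commute insertE singletonD)
    have orient: "z \<in> geo_open (emb s) (emb t)"
      if "z \<in> geo_open (emb a) (emb c)" "a \<in> branch" "{a, c} = {s, t}" for a c t
    proof (cases "a = s")
      case True
      then have "t = c" using that(3) by (auto simp: doubleton_eq_iff)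
      then show ?thesis using that True by simp
    next
      case False
      then have "a = t" "c = s" using that(3) by (auto simp: doubleton_eq_iff)
      then show ?thesis using geo_open_commute[of "emb a" "emb c"] emb_branch(2) s(1) that by blast
    qed
    have zs: "z \<in> geo_open (emb s) (emb t)" "z \<in> geo_open (emb s) (emb t')"
      using orient[OF z(1) a(1) s(2)] orient[OF z(2) a'(1) s(3)] by auto
    have tV: "t \<in> V" "t' \<in> V" using s v v' by (auto simp: doubleton_eq_iff)
    have st: "s \<noteq> t" "s \<noteq> t'" using s v(3,4) v'(3,4) by (auto simp: doubleton_eq_iff)
    have tt: "t \<noteq> t'" using ne s by auto
    have ed: "{s, t} \<in> edges" "{s, t'} \<in> edges" using a(2) a'(2) s by auto
    have br: "x \<in> branch" if "norm (emb x) < 1" "x \<in> V" for x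
      using emb_end[of x] that by (auto simp: branch_def)
    have "emb t \<noteq> emb t'" using inj_onD[OF emb_inj] tV tt by blast
    then show False
      using geo_open_same_ray[OF emb_branch(2)[OF s(1)] emb_cball emb_cball zs]
        branch_off_edge[OF br[OF _ tV(1)] s(1) ed(2)] branch_off_edge[OF br[OF _ tV(2)] s(1) ed(1)] st tt
      by metis
  next
    case True
    \<comment> \<open>The upper vertices differ, so one of them, here \<open>p v'\<close>, is not an
      ancestor of the other. Its fence encloses the edge of \<open>v'\<close> and excludes the edge
      of \<open>v\<close>.\<close>
    have sep: False
      if "v \<in> V" "v \<noteq> r" "{a, c} = {p v, v}" "{a', c'} = {p v', v'}" "v' \<in> V" "v' \<noteq> r" "a \<in> branch" "a' \<in> branch"
        "c \<in> V" "c' \<in> V" "z \<in> geo_open (emb a) (emb c)" "z \<in> geo_open (emb a') (emb c')"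
        "{a, c} \<inter> {a', c'} = {}" "p v \<notin> desc (p v')" for v v' a c a' c'
    proof -
      have "p v' \<noteq> r" using that(14) desc_root parent_in[OF that(1)] by auto
      then have x: "p v' \<in> branch" using parent_branch that by blast
      have "v \<noteq> p v'" using that(3,4,13) by auto
      then have "v \<notin> desc (p v')" using desc_cases(2)[of v "p v'"] that(14) by auto
      then have "a \<notin> desc (p v')" "c \<notin> desc (p v')" using that(3,14) by (auto simp: doubleton_eq_iff)
      then have "dform (p v') z < 0" using dform_geo(2)[OF x that(7,9,11)] by blast
      moreover have "a' \<in> desc (p v')" "c' \<in> desc (p v')"
        using that(4) parent_desc[OF that(5)] desc_refl[OF branchD(1)[OF x]] by (auto simp: doubleton_eq_iff)
      then have "dform (p v') z > 0" using dform_geo(1)[OF x that(8,10,12)] by blast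
      ultimately show False by simp
    qed
    have "p v \<noteq> p v'" using True v(3) v'(3) by auto
    then have "p v \<notin> desc (p v') \<or> p v' \<notin> desc (p v)" using desc_antisym by blast
    then show False
      using sep[OF v(1-3) v'(3,1,2) a(1) a'(1) v(6) v'(6) z True]
        sep[OF v'(1-3) v(3,1,2) a'(1) a(1) v'(6) v(6) z(2,1)] True by (metis Int_commute)
  qed
qed

text \<open>The edge above \<open>v\<close> is viewed from \<open>lo v\<close>, the first end below
  \<open>v\<close>: its lower vertex is on the vertical line of this end, and its upper vertex is
  offset by at most \<open>d\<close> times its height. The cone
  \<open>\<bar>Re w - x\<bar> \<le> d * Im w\<close> gives the constant \<open>2 / (d + 1)\<close>,
  since the norm is at most the sum of both coordinates.\<close>

lemma edge_cone:
  assumes a: "a \<in> branch" "{a, c} \<in> edges" and w: "Im w > 0" "A w \<in> geo_open (emb a) (emb c)"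
  shows "\<exists>j\<in>{1..d}. 2 * Im w \<ge> 2 / (real d + 1) * norm (w - of_real (xpos \<epsilon> j))"
proof -
  have fin: "2 * Im w \<ge> 2 / (real d + 1) * norm (w - of_real t)" if "\<bar>Re w - t\<bar> \<le> real d * Im w" for t
  proof -
    have "norm (w - of_real t) \<le> \<bar>Re (w - of_real t)\<bar> + \<bar>Im (w - of_real t)\<bar>" by (rule cmod_le)
    also have "\<dots> \<le> (real d + 1) * Im w" using that w(1) by (simp add: algebra_simps)
    finally have "2 / (real d + 1) * norm (w - of_real t) \<le> 2 / (real d + 1) * ((real d + 1) * Im w)"
      by (intro mult_left_mono) auto
    then show ?thesis by simp
  qed
  obtain v where v: "v \<in> V" "v \<noteq> r" "{a, c} = {p v, v}" "p v \<noteq> v" "a \<in> V" "c \<in> V"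
    using edge_cases[OF a(2)] .
  have lo: "lo v \<in> {1..d}" using lo_in[OF v(1,2)] below_subset by blast
  have "\<bar>Re w - xpos \<epsilon> (lo v)\<bar> \<le> real d * Im w"
  proof (cases "p v = r")
    case True
    then have "a = v" "c = r" using v(3) branchD(2)[OF a(1)] by (auto simp: doubleton_eq_iff)
    then have g: "A w \<in> geo_open (A (Complex (xpos \<epsilon> (lo v)) (\<epsilon> ^ h v))) u"
      using w(2) a(1) branchD[of v] by (auto simp: emb_def hpt_def)
    have "Re w = xpos \<epsilon> (lo v)" using geodesic_vertical[OF _ w(1) g] eps by simp
    then show ?thesis using w(1) by simp
  next
    case False
    have pb: "p v \<in> branch" using parent_branch v False by blast
    have g: "A w \<in> geo_open (emb (p v)) (emb v)"
    proof (cases "a = p v")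
      case True
      then show ?thesis using v(3) w(2) by (auto simp: doubleton_eq_iff)
    next
      case False
      then have "a = v" "c = p v" using v(3) by (auto simp: doubleton_eq_iff)
      then show ?thesis using geo_open_commute[of "emb a" "emb c"] emb_branch(2) pb a(1) w(2) by blast
    qed
    have vp: "v \<in> desc (p v)" using parent_desc v by blast
    have l: "lo v \<in> below (p v)" "lo (p v) \<in> below (p v)"
      using below_mono[OF vp] lo_in[OF v(1,2)] lo_in[of "p v"] branchD[OF pb] by auto
    have "lo (p v) \<le> lo v" using lo_le[OF l(1)] .
    then have "xpos \<epsilon> (lo (p v)) \<le> xpos \<epsilon> (lo v)"
      using xpos_less[OF eps(1), of "lo (p v)" "lo v"] below_le(1)[OF l(2)] by (cases "lo (p v) = lo v") auto
    moreover have "xpos \<epsilon> (lo v) - xpos \<epsilon> (lo (p v)) \<le> real d * \<epsilon> ^ h (p v)"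
      using xpos_near[of \<epsilon> "p v" "lo (p v)" "lo v"] eps eps_half branchD(1)[OF pb] l by linarith
    moreover have "emb (p v) = A (Complex (xpos \<epsilon> (lo (p v))) (\<epsilon> ^ h (p v)))"
      using branchD[OF pb] by (simp add: emb_def hpt_def)
    moreover have "emb v = A (Complex (xpos \<epsilon> (lo v)) (Im (hpt v)))"
      using v by (simp add: emb_def hpt_def)
    moreover have "\<epsilon> ^ h (p v) > 0" using eps by simp
    ultimately show ?thesis
      using geodesic_in_cone[OF _ _ _ Im_hpt(1)[of v] w(1)] g by metis
  qed
  then show ?thesis using fin lo by blast
qed

lemma vertex_cone:
  assumes "v \<in> branch"
  shows "\<exists>j\<in>{1..d}. 2 * Im (hpt v) \<ge> 2 / (real d + 1) * norm (hpt v - of_real (xpos \<epsilon> j))"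
proof -
  have "hpt v - of_real (xpos \<epsilon> (lo v)) = \<i> * of_real (Im (hpt v))"
    by (simp add: hpt_def complex_eq_iff)
  then have n: "norm (hpt v - of_real (xpos \<epsilon> (lo v))) = Im (hpt v)"
    using Im_hpt(1)[of v] by (simp add: norm_mult)
  have "2 / (real d + 1) * Im (hpt v) \<le> 2 * Im (hpt v)"
    using Im_hpt(1)[of v] by (intro mult_right_mono) (auto simp: divide_le_eq)
  moreover have "lo v \<in> {1..d}" using lo_in[of v] branchD assms below_subset by blast
  ultimately show ?thesis using n by (intro bexI[of _ "lo v"]) (simp_all only:)
qed

text \<open>With \<open>D\<close> the squared Euclidean distance and \<open>Y\<close> the product of
  the heights, \<open>1 - r\<^sup>2\<close> is \<open>4 * Y / (D + 4 * Y)\<close>, and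
  \<open>(1 + r) / (1 - r) \<ge> 1 / (1 - r\<^sup>2)\<close>. A bound for \<open>D / Y\<close> of
  order \<open>1 / \<epsilon>\<close> therefore suffices. It comes from the difference of heights
  when one vertex is an ancestor of the other, and from the horizontal distance otherwise.\<close>

lemma hdist_branch:
  assumes v: "v \<in> branch" and w: "w \<in> branch" and ne: "v \<noteq> w"
  shows "hdist (emb v) (emb w) \<ge> ln (1 / (16 * \<epsilon>))"
proof -
  define D where "D = (norm (hpt v - hpt w))\<^sup>2"
  define Y where "Y = \<epsilon> ^ h v * \<epsilon> ^ h w"
  have Y0: "Y > 0" using eps by (simp add: Y_def)
  have Re: "Re (hpt v) = xpos \<epsilon> (lo v)" for v by (simp add: hpt_def)
  have D: "D = (xpos \<epsilon> (lo v) - xpos \<epsilon> (lo w))\<^sup>2 + (\<epsilon> ^ h v - \<epsilon> ^ h w)\<^sup>2"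
    unfolding D_def cmod_power2 using Im_hpt(3) v w by (simp add: Re)
  have anc: "\<epsilon> ^ h a * \<epsilon> ^ h b / (4 * \<epsilon>) \<le> (\<epsilon> ^ h a - \<epsilon> ^ h b)\<^sup>2"
    if "b \<in> desc a" "a \<noteq> b" for a b
  proof -
    define A B where "A = \<epsilon> ^ h a" and "B = \<epsilon> ^ h b"
    have BA: "B \<le> \<epsilon> * A" using scale_ancestor[OF that(1)] that(2) by (simp add: A_def B_def)
    have A0: "A > 0" using eps by (simp add: A_def)
    have "\<epsilon> * A \<le> 1 / 2 * A" using eps_half A0 by (intro mult_right_mono) auto
    then have "A / 2 \<le> A - B" using BA by simp
    then have "(A / 2)\<^sup>2 \<le> (A - B)\<^sup>2" using A0 by (intro power_mono) auto
    moreover have "A * B / (4 * \<epsilon>) \<le> A * (\<epsilon> * A) / (4 * \<epsilon>)"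
      using BA A0 eps by (intro divide_right_mono mult_left_mono) auto
    moreover have "A * (\<epsilon> * A) / (4 * \<epsilon>) = (A / 2)\<^sup>2" using eps by (simp add: power2_eq_square)
    ultimately show ?thesis unfolding A_def B_def by linarith
  qed
  have "Y / (4 * \<epsilon>) \<le> D"
  proof -
    consider "w \<in> desc v" | "v \<in> desc w" | "v \<notin> desc w" "w \<notin> desc v" by blast
    then show ?thesis
    proof cases
      case 1
      then have "Y / (4 * \<epsilon>) \<le> (\<epsilon> ^ h v - \<epsilon> ^ h w)\<^sup>2" using anc[OF 1] ne by (simp add: Y_def)
      then show ?thesis unfolding D by (simp add: add_increasing)
    next
      case 2
      then have "Y / (4 * \<epsilon>) \<le> (\<epsilon> ^ h w - \<epsilon> ^ h v)\<^sup>2" using anc[OF 2] ne by (simp add: Y_def mult.commute)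
      then show ?thesis unfolding D by (simp add: add_increasing power2_commute)
    next
      case 3
      define t where "t = \<bar>xpos \<epsilon> (lo v) - xpos \<epsilon> (lo w)\<bar>"
      have 1: "\<epsilon> ^ h w \<le> \<epsilon> * t" unfolding t_def
        using far_apart[OF w] branchD[OF v] 3 by auto
      have 2: "\<epsilon> ^ h v \<le> \<epsilon> * t" unfolding t_def abs_minus_commute[of "xpos \<epsilon> (lo v)"]
        using far_apart[OF v] branchD[OF w] 3 by auto
      have "Y \<le> \<epsilon> * t * (\<epsilon> * t)" unfolding Y_def using 1 2 eps by (intro mult_mono) (auto simp: t_def)
      then have "Y / (4 * \<epsilon>) \<le> \<epsilon> * t * (\<epsilon> * t) / (4 * \<epsilon>)" using eps by (intro divide_right_mono) auto
      also have "\<dots> = (\<epsilon> / 4) * t\<^sup>2" using eps by (simp add: power2_eq_square)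
      also have "\<dots> \<le> 1 * t\<^sup>2" using eps_half by (intro mult_right_mono) auto
      also have "\<dots> \<le> D" unfolding D t_def by simp
      finally show ?thesis .
    qed
  qed
  then have DY: "1 / (4 * \<epsilon>) \<le> D / Y" using Y0 eps by (simp add: field_simps)
  define r where "r = norm (hpt v - hpt w) / norm (hpt v - cnj (hpt w))"
  have den: "(norm (hpt v - cnj (hpt w)))\<^sup>2 = D + 4 * Y"
    unfolding D_def Y_def cmod_power2 using Im_hpt(3)[OF v] Im_hpt(3)[OF w]
    by (simp add: power2_eq_square algebra_simps)
  have D0: "D \<ge> 0" by (simp add: D_def)
  have r2: "r\<^sup>2 = D / (D + 4 * Y)" unfolding r_def power_divide den by (simp add: D_def)
  have r0: "r \<ge> 0" by (simp add: r_def)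
  have om: "1 - r\<^sup>2 = 4 * Y / (D + 4 * Y)" unfolding r2 using D0 Y0 by (simp add: field_simps)
  then have "1 - r\<^sup>2 > 0" using D0 Y0 by simp
  then have r1: "r < 1" using r0 by (simp add: abs_square_less_1)
  have "1 / (16 * \<epsilon>) \<le> D / (4 * Y)" using DY by simp
  also have "\<dots> \<le> (D + 4 * Y) / (4 * Y)" using Y0 by (intro divide_right_mono) auto
  also have "\<dots> = 1 / (1 - r\<^sup>2)" unfolding om by simp
  also have "\<dots> \<le> (1 + r)\<^sup>2 / (1 - r\<^sup>2)"
    using \<open>1 - r\<^sup>2 > 0\<close> r0 by (intro divide_right_mono) (auto simp: power2_eq_square algebra_simps)
  also have "\<dots> = (1 + r) / (1 - r)"
  proof -
    have "1 - r\<^sup>2 = (1 + r) * (1 - r)" by (simp add: power2_eq_square algebra_simps)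
    then show ?thesis using r0 r1 by (simp add: power2_eq_square)
  qed
  finally have "ln (1 / (16 * \<epsilon>)) \<le> ln ((1 + r) / (1 - r))" using eps by (intro ln_mono) auto
  moreover have "hdist (emb v) (emb w) = ln ((1 + r) / (1 - r))"
    unfolding hdist_def Let_def emb_branch(1)[OF v] emb_branch(1)[OF w] hdist_A[OF Im_hpt(1) Im_hpt(1)] r_def ..
  ultimately show ?thesis by simp
qed

end

section \<open>Cyclic order of the ends and images of the edges\<close>

lemma cayley_circ:
  assumes "Im q > 0"
  shows "cayley (circ t0) q (of_real x) = circ (t0 + 1 / 2 + arctan ((x - Re q) / Im q) / pi)"
proof -
  define t where "t = (x - Re q) / Im q"
  define a where "a = arctan t"
  have c: "cis a = (1 + \<i> * of_real t) * of_real (cos a)"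
    using tan_arctan[of t] cos_arctan_not_zero[of t]
    by (simp add: a_def complex_eq_iff tan_def nonzero_divide_eq_eq mult.commute)
  have ca: "cos a \<noteq> 0" by (simp add: a_def)
  have "circ (1 / 2 + a / pi) = - cis (2 * a)"
    by (simp add: circ_def distrib_left cis_mult[symmetric] cis_pi)
  also have "cis (2 * a) = cis a / cis (- a)" by (simp add: cis_divide)
  also have "cis (- a) = cnj (cis a)" by (simp add: cis_cnj)
  also have "cis a / cnj (cis a) = (1 + \<i> * of_real t) / (1 - \<i> * of_real t)"
    unfolding c using ca by simp
  finally have 1: "circ (1 / 2 + a / pi) = - ((1 + \<i> * of_real t) / (1 - \<i> * of_real t))" .
  have q: "of_real x - q = of_real (Im q) * (of_real t - \<i>)" "of_real x - cnj q = of_real (Im q) * (of_real t + \<i>)"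
    using assms by (simp_all add: t_def complex_eq_iff)
  have nz: "of_real t + \<i> \<noteq> 0" "1 - \<i> * of_real t \<noteq> 0" by (auto simp: complex_eq_iff)
  have 2: "(of_real t - \<i>) / (of_real t + \<i>) = - ((1 + \<i> * of_real t) / (1 - \<i> * of_real t))"
    using nz by (simp add: divide_simps) (simp add: algebra_simps)
  have "cayley (circ t0) q (of_real x) = circ t0 * ((of_real t - \<i>) / (of_real t + \<i>))"
    unfolding cayley_def q using assms by simp
  also have "\<dots> = circ t0 * circ (1 / 2 + a / pi)" unfolding 1 2 ..
  also have "\<dots> = circ (t0 + (1 / 2 + a / pi))" by (rule circ_add[symmetric])
  finally show ?thesis unfolding a_def t_def add.assoc .
qed

context tree_embedding
begin

lemma emb_circle_point:
  assumes "lab r = 0" "v = r \<or> v \<in> leaves"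
  shows "emb v = circle_point u q (xpos \<epsilon>) (lab v)"
proof (cases "v = r")
  case True
  then show ?thesis using assms(1) by (simp add: emb_def circle_point_def)
next
  case False
  then have v: "v \<in> leaves" using assms(2) by simp
  then have "hpt v = of_real (xpos \<epsilon> (lab v))" by (simp add: hpt_def lo_leaf complex_eq_iff)
  moreover have "lab v \<noteq> 0" using leaf_lab(2)[OF v] by simp
  ultimately show ?thesis using False by (simp add: emb_def circle_point_def)
qed

text \<open>The chart runs along the real line counterclockwise from the marked point and back to
  it, with \<open>arctan\<close> as angle, so increasing positions have increasing angles within one
  turn.\<close>

lemma circle_point_angles:
  obtains \<theta> where "strict_mono_on {..d} \<theta>" "\<theta> d < \<theta> 0 + 1" "\<And>j. circle_point u q (xpos \<epsilon>) j = circ (\<theta> j)"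
proof -
  have "u \<noteq> 0" using u_nz .
  then have "u = cis (Arg u)" using norm_u by (simp add: cis_Arg sgn_div_norm)
  then have u: "u = circ (Arg u / (2 * pi))" by (simp add: circ_def)
  define t0 where "t0 = Arg u / (2 * pi)"
  define ang where "ang j = arctan ((xpos \<epsilon> j - Re q) / Im q) / pi" for j
  define \<theta> where "\<theta> j = (if j = 0 then t0 else t0 + 1 / 2 + ang j)" for j
  have ang: "- 1 / 2 < ang j" "ang j < 1 / 2" for j
    using arctan_lbound[of "(xpos \<epsilon> j - Re q) / Im q"] arctan_ubound[of "(xpos \<epsilon> j - Re q) / Im q"]
    unfolding ang_def by (simp_all add: pos_less_divide_eq pos_divide_less_eq)
  have mono: "ang j < ang k" if "1 \<le> j" "j < k" for j k
    using xpos_less[OF eps(1) that] Im_p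
    unfolding ang_def by (intro divide_strict_right_mono arctan_monotone) (auto intro: divide_strict_right_mono)
  have "strict_mono_on {..d} \<theta>"
  proof (rule strict_mono_onI)
    fix j k :: nat assume "j < k"
    then show "\<theta> j < \<theta> k" using ang(1)[of k] mono[of j k] by (cases "j = 0") (auto simp: \<theta>_def)
  qed
  moreover have "\<theta> d < \<theta> 0 + 1" using ang(2)[of d] d2 by (simp add: \<theta>_def)
  moreover have "circle_point u q (xpos \<epsilon>) j = circ (\<theta> j)" for j
    using cayley_circ[OF Im_p, of t0 "xpos \<epsilon> j"] u
    by (simp add: circle_point_def \<theta>_def ang_def t0_def[symmetric])
  ultimately show thesis using that by blast
qed

text \<open>An edge between two branch points enters \<open>edge_img\<close> in both directions;
  statements about edges are accordingly made for an arbitrary branch endpoint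
  \<open>a\<close>.\<close>

lemma edge_imgE:
  assumes e: "e \<in> edges" and z: "z \<in> edge_img V edges emb e" and br: "tree_branch V edges = branch"
  obtains a c where "e = {a, c}" "a \<in> branch" "{a, c} \<in> edges" "z \<in> geo_open (emb a) (emb c)"
  using assms unfolding edge_img_def by blast

lemma edge_imgs_disjoint:
  assumes br: "tree_branch V edges = branch" and e: "e \<in> edges" "e' \<in> edges" "e \<noteq> e'"
  shows "edge_img V edges emb e \<inter> edge_img V edges emb e' = {}"
proof (rule ccontr)
  assume "\<not> ?thesis"
  then obtain z where z: "z \<in> edge_img V edges emb e" "z \<in> edge_img V edges emb e'" by auto
  obtain a c where a: "e = {a, c}" "a \<in> branch" "{a, c} \<in> edges" "z \<in> geo_open (emb a) (emb c)"
    using edge_imgE[OF e(1) z(1) br] .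
  obtain a' c' where a': "e' = {a', c'}" "a' \<in> branch" "{a', c'} \<in> edges" "z \<in> geo_open (emb a') (emb c')"
    using edge_imgE[OF e(2) z(2) br] .
  show False using edges_disjoint[OF a(2,3) a'(2,3)] a a' e(3) by auto
qed

lemma branch_off_edges:
  assumes br: "tree_branch V edges = branch" and b: "b \<in> branch" and e: "e \<in> edges"
  shows "emb b \<notin> edge_img V edges emb e"
proof
  assume "emb b \<in> edge_img V edges emb e"
  then obtain a c where a: "e = {a, c}" "a \<in> branch" "{a, c} \<in> edges" "emb b \<in> geo_open (emb a) (emb c)"
    using edge_imgE[OF e _ br] by metis
  obtain v where v: "{a, c} = {p v, v}" "p v \<noteq> v" "a \<in> V" "c \<in> V"
    using edge_cases[OF a(3)] by metis
  have "a \<noteq> c" using v by (auto simp: doubleton_eq_iff)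
  then have ne: "emb a \<noteq> emb c" using inj_onD[OF emb_inj] v by blast
  show False
    using branch_off_edge[OF b a(2,3)] a(4) geo_open_endpoints[OF emb_branch(2)[OF a(2)] emb_cball ne] by metis
qed

lemma int_img_cone:
  assumes br: "tree_branch V edges = branch" and z: "z \<in> int_img V edges emb"
  obtains w j where "Im w > 0" "A w = z" "j \<in> {1..d}"
    "2 * Im w \<ge> 2 / (real d + 1) * norm (w - of_real (xpos \<epsilon> j))"
proof -
  have "(\<exists>v\<in>branch. z = emb v) \<or> (\<exists>e\<in>edges. z \<in> edge_img V edges emb e)"
    using z unfolding int_img_def br by blast
  then show thesis
  proof (elim disjE bexE)
    fix v assume v: "v \<in> branch" "z = emb v"
    then show thesis using that vertex_cone[OF v(1)] Im_hpt(2)[OF v(1)] emb_branch(1)[OF v(1)] by metis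
  next
    fix e assume e: "e \<in> edges" "z \<in> edge_img V edges emb e"
    obtain a c where a: "e = {a, c}" "a \<in> branch" "{a, c} \<in> edges" "z \<in> geo_open (emb a) (emb c)"
      using edge_imgE[OF e br] .
    have "norm z < 1" using geo_open_in_ball[OF emb_branch(2)[OF a(2)] emb_cball a(4)] .
    then obtain w where w: "Im w > 0" "A w = z" using A_surj by blast
    then show thesis using that edge_cone[OF a(2,3) w(1)] a(4) by metis
  qed
qed

end

section \<open>Choice of the sequence and assembly\<close>

theorem theorem3p1:
  fixes d :: nat and eta :: "(complex \<Rightarrow> complex) \<Rightarrow> real \<Rightarrow> real"
    and V :: "'v set" and E :: "'v set set" and lab :: "'v \<Rightarrow> nat"
  assumes "d \<ge> 2"
    and "conjugacy_family d eta"
    and "marked_ribbon_tree d V E lab"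
  shows "realizable d eta V E lab"
proof -
  note d = assms(1) and eta = assms(2)
  obtain r p h where PT: "planar_tree V r p h d lab" and E: "E = (\<lambda>v. {p v, v}) ` (V - {r})"
    and lab_r: "lab r = 0" and r_end: "r \<in> tree_ends V E"
    and ends: "tree_ends V E = insert r (rooted_tree.leaves V r p)"
    and branch: "tree_branch V E = V - {r} - rooted_tree.leaves V r p"
    and val: "\<And>v. v \<in> tree_branch V E \<Longrightarrow> valence E v = card (rooted_tree.children V r p v) + 1"
    by (rule marked_ribbon_tree_planar[OF assms(3)]) (rule that)
  have lab_ends: "bij_betw lab (tree_ends V E) {..d}" using assms(3) by (simp add: marked_ribbon_tree_def)
  interpret planar_tree V r p h d lab by fact
  \<comment> \<open>The reciprocal is at least \<open>d + 2\<close>, as the fences require, and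
    tends to infinity.\<close>
  define \<epsilon> where "\<epsilon> n = 1 / (real d + 2 + real n)" for n
  have eps: "\<epsilon> n > 0" "(real d + 2) * \<epsilon> n \<le> 1" "\<epsilon> n \<le> 1" for n
    by (auto simp: \<epsilon>_def divide_simps)
  have eps0: "\<epsilon> \<longlonglongrightarrow> 0"
    unfolding \<epsilon>_def by (intro tendsto_divide_0[OF tendsto_const] filterlim_at_top_imp_at_infinity
        filterlim_tendsto_add_at_top[OF tendsto_const] filterlim_real_sequentially)
  have inj: "inj_on (xpos (\<epsilon> n)) {1..d}" for n
    using xpos_less[OF eps(1)[of n]] by (intro linorder_inj_onI) (force, auto)
  have "\<exists>u q f. half_plane_chart u q \<and> unit_points d (circle_point u q (xpos (\<epsilon> n))) \<and> f \<in> Bminus d \<and>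
    (\<forall>z. f z = unit_points.num d (circle_point u q (xpos (\<epsilon> n))) (cnj z) /
      unit_points.den d (circle_point u q (xpos (\<epsilon> n))) (cnj z)) \<and> circ (eta f 0) = u" for n
    using marked_configuration[OF d inj eta] by metis
  then obtain u q f where cfg: "\<And>n. half_plane_chart (u n) (q n)"
    "\<And>n. unit_points d (circle_point (u n) (q n) (xpos (\<epsilon> n)))" "\<And>n. f n \<in> Bminus d"
    "\<And>n z. f n z = unit_points.num d (circle_point (u n) (q n) (xpos (\<epsilon> n))) (cnj z) /
      unit_points.den d (circle_point (u n) (q n) (xpos (\<epsilon> n))) (cnj z)"
    "\<And>n. circ (eta (f n) 0) = u n"
    by metis
  have PC: "point_config (u n) (q n) d (xpos (\<epsilon> n)) (f n)" for n
    using cfg(1,2,4)[of n] d by (intro point_config.intro point_config_axioms.intro)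
  have TE: "tree_embedding V r p h d lab (u n) (q n) (\<epsilon> n)" for n
    using PT cfg(1)[of n] eps[of n] d by (intro tree_embedding.intro tree_embedding_axioms.intro)
  define phi where "phi n = tree_embedding.emb V r p h lab (u n) (q n) (\<epsilon> n)" for n
  have EE: "tree_embedding.edges V r p = E" and BB: "tree_embedding.branch V r p = tree_branch V E"
    using tree_embedding.edges_def[OF TE] tree_embedding.branch_def[OF TE] E branch by auto
  note TB = BB[symmetric, folded EE]
  have bs: "v \<in> V" "v \<noteq> r" "v \<notin> leaves" if "v \<in> tree_branch V E" for v using that branch by auto
  have fin_b: "finite (tree_branch V E)" using finite_V by (auto simp: branch)

  have "\<exists>R. \<forall>\<^sub>F n in sequentially. crit_count_near (f n) (phi n v) R = valence E v - 2"
    if v: "v \<in> tree_branch V E" for v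
  proof -
    \<comment> \<open>Positions of the ends at the scale of \<open>v\<close>: those below
      \<open>v\<close> converge to their clusters, the others escape.\<close>
    define X where "X n j = (xpos (\<epsilon> n) j - xpos (\<epsilon> n) (lo v)) / \<epsilon> n ^ h v" for n j
    have conv: "(\<lambda>n. X n j) \<longlonglongrightarrow> real (cluster v j)" if "j \<in> below v" for j
      unfolding X_def using cluster_tendsto[OF bs(1,2)[OF v] that eps0] eps by simp
    have esc: "filterlim (\<lambda>n. \<bar>X n j\<bar>) at_top sequentially" if j: "j \<in> {1..d} - below v" for j
    proof (rule filterlim_at_top_mono)
      show "filterlim (\<lambda>n. real n) at_top sequentially" by (rule filterlim_real_sequentially)
      show "\<forall>\<^sub>F n in sequentially. real n \<le> \<bar>X n j\<bar>"
      proof (intro always_eventually allI)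
        fix n
        have "\<epsilon> n ^ h v \<le> \<epsilon> n * \<bar>xpos (\<epsilon> n) j - xpos (\<epsilon> n) (lo v)\<bar>"
          using xpos_far[OF eps(1,3) bs(1)[OF v] lo_in[OF bs(1,2)[OF v]] j] .
        then have "1 \<le> \<epsilon> n * \<bar>X n j\<bar>" using eps(1)[of n] by (simp add: X_def abs_divide field_simps)
        then have "1 / \<epsilon> n \<le> \<bar>X n j\<bar>" using eps(1)[of n] by (simp add: field_simps)
        moreover have "1 / \<epsilon> n = real d + 2 + real n" by (simp add: \<epsilon>_def)
        ultimately show "real n \<le> \<bar>X n j\<bar>" by simp
      qed
    qed
    have bn: "below v \<noteq> {}" using lo_in[OF bs(1,2)[OF v]] by auto
    \<comment> \<open>The coefficient of the critical form counts the marked end as well and exceeds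
      the number of finite ends; it stays \<open>d + 1\<close> in the limit.\<close>
    have cd: "real (card {1..d}) < real (d + 1)" by simp
    obtain \<rho> where \<rho>: "0 < \<rho>" "\<rho> < 1"
      "\<forall>\<^sub>F n in sequentially. (\<Sum>w | Im w < 0 \<and> norm (w + \<i>) \<le> \<rho> * norm (w - \<i>) \<and>
          crit_form (real (d + 1)) {1..d} (X n) w = 0. zorder (crit_form (real (d + 1)) {1..d} (X n)) w) =
        int (card ((\<lambda>j. real (cluster v j)) ` below v) - 1)"
      using crit_form_count_eventually[where X = X and Y = "\<lambda>j. real (cluster v j)",
          OF finite_atLeastAtMost below_subset bn cd conv esc] by blast
    have "card ((\<lambda>j. real (cluster v j)) ` below v) = card (cluster v ` below v)"
    proof -
      have "(\<lambda>j. real (cluster v j)) ` below v = real ` (cluster v ` below v)" by (simp add: image_image)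
      then show ?thesis by (simp only: card_image[OF inj_on_of_nat])
    qed
    \<comment> \<open>The limit points are as many as the children, which is the valence minus 1,
      and the number of zeros is one less again.\<close>
    then have cc: "card ((\<lambda>j. real (cluster v j)) ` below v) - 1 = valence E v - 2"
      using card_cluster[OF bs[OF v]] val[OF v] by simp
    have "\<forall>\<^sub>F n in sequentially. crit_count_near (f n) (phi n v) (ln ((1 + \<rho>) / (1 - \<rho>))) = valence E v - 2"
      using \<rho>(3)
    proof eventually_elim
      case (elim n)
      interpret T: tree_embedding V r p h d lab "u n" "q n" "\<epsilon> n" by (rule TE)
      interpret P: point_config "u n" "q n" d "xpos (\<epsilon> n)" "f n" by (rule PC)
      have s: "\<epsilon> n ^ h v > 0" using eps by simp
      have "phi n v = cayley (u n) (q n) (Complex (xpos (\<epsilon> n) (lo v)) (\<epsilon> n ^ h v))"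
        using bs[OF v] by (simp add: phi_def T.emb_def T.hpt_def)
      then have "int (crit_count_near (f n) (phi n v) (ln ((1 + \<rho>) / (1 - \<rho>)))) = int (valence E v - 2)"
        using P.crit_count_eq[OF s \<rho>(1,2), of "xpos (\<epsilon> n) (lo v)"] elim cc unfolding X_def by simp
      then show ?case by simp
    qed
    then show ?thesis by blast
  qed
  then obtain R where R: "\<And>v. v \<in> tree_branch V E \<Longrightarrow>
      \<forall>\<^sub>F n in sequentially. crit_count_near (f n) (phi n v) (R v) = valence E v - 2"
    by metis
  have "\<forall>\<^sub>F n in sequentially. \<forall>v\<in>tree_branch V E. crit_count_near (f n) (phi n v) (R v) = valence E v - 2"
    using R fin_b by (intro eventually_ball_finite) auto
  then obtain N where N: "\<And>n v. n \<ge> N \<Longrightarrow> v \<in> tree_branch V E \<Longrightarrow>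
      crit_count_near (f n) (phi n v) (R v) = valence E v - 2"
    by (auto simp: eventually_sequentially)

  \<comment> \<open>The constant of \<open>edge_cone\<close> and \<open>vertex_cone\<close>; \<rho>
    is the corresponding ratio in \<open>displacement_bound\<close>, and the maximum with 1 makes
    \<open>K'\<close> positive.\<close>
  define \<delta> where "\<delta> = 2 / (real d + 1)"
  define \<rho> where "\<rho> = (real d - 1 + sqrt (4 - \<delta>\<^sup>2)) / real (d + 1)"
  define K' where "K' = max 1 (ln ((1 + \<rho>) / (1 - \<rho>)))"
  have \<delta>: "\<delta> > 0" by (simp add: \<delta>_def)

  have 1: "f n \<in> BminusK d eta (ln (real d))" for n
    using point_config.in_BminusK[OF PC eta cfg(3)] .
  have 2: "phi n v \<in> ball 0 1" if "v \<in> tree_branch V E" for n v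
    using tree_embedding.emb_branch(2)[OF TE] that by (simp add: phi_def BB)
  have phi_end: "phi n v = circle_point (u n) (q n) (xpos (\<epsilon> n)) (lab v)" if "v \<in> tree_ends V E" for n v
    using tree_embedding.emb_circle_point[OF TE lab_r] that by (auto simp: phi_def ends)
  have 3: "bij_betw (phi n) (tree_ends V E) (rep_fix (f n))" for n
  proof -
    interpret P: point_config "u n" "q n" d "xpos (\<epsilon> n)" "f n" by (rule PC)
    have "bij_betw P.Z {..d} (rep_fix (f n))"
      unfolding P.rep_fix_eq using P.inj_\<zeta> by (rule inj_on_imp_bij_betw)
    then have "bij_betw (P.Z \<circ> lab) (tree_ends V E) (rep_fix (f n))"
      by (rule bij_betw_trans[OF lab_ends])
    then show ?thesis by (subst bij_betw_cong[of _ _ "P.Z \<circ> lab"]) (simp_all add: phi_end)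
  qed
  have 4: "phi n v = circ (eta (f n) 0)" if "v \<in> tree_ends V E" "lab v = 0" for n v
    using phi_end[OF that(1)] that(2) cfg(5) by (simp add: circle_point_def)
  have 5: "\<exists>\<theta> :: nat \<Rightarrow> real. strict_mono_on {..d} \<theta> \<and> \<theta> d < \<theta> 0 + 1 \<and>
             (\<forall>v \<in> tree_ends V E. phi n v = circ (\<theta> (lab v)))" for n
    using tree_embedding.circle_point_angles[OF TE, of n] phi_end by metis
  have 6: "inj_on (phi n) V \<and>
      (\<forall>e \<in> E. \<forall>e' \<in> E. e \<noteq> e' \<longrightarrow> edge_img V E (phi n) e \<inter> edge_img V E (phi n) e' = {}) \<and>
      (\<forall>v \<in> tree_branch V E. \<forall>e \<in> E. phi n v \<notin> edge_img V E (phi n) e)" for n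
  proof (intro conjI ballI impI)
    show "inj_on (phi n) V" unfolding phi_def by (rule tree_embedding.emb_inj[OF TE])
    show "edge_img V E (phi n) e \<inter> edge_img V E (phi n) e' = {}" if "e \<in> E" "e' \<in> E" "e \<noteq> e'" for e e'
      using tree_embedding.edge_imgs_disjoint[OF TE TB, unfolded EE, OF that] by (simp add: phi_def)
    show "phi n v \<notin> edge_img V E (phi n) e" if "v \<in> tree_branch V E" "e \<in> E" for v e
      using tree_embedding.branch_off_edges[OF TE TB, unfolded EE BB, OF that] by (simp add: phi_def)
  qed
  have lim: "filterlim (\<lambda>n. ln (1 / (16 * \<epsilon> n))) at_top sequentially"
  proof -
    have "filterlim (\<lambda>n. (real d + 2) / 16 + 1 / 16 * real n) at_top sequentially"
      by (intro filterlim_tendsto_add_at_top[OF tendsto_const]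
          filterlim_tendsto_pos_mult_at_top[OF tendsto_const] filterlim_real_sequentially) simp
    then have "filterlim (\<lambda>n. 1 / (16 * \<epsilon> n)) at_top sequentially"
      by (simp add: \<epsilon>_def add_divide_distrib)
    then show ?thesis by (rule filterlim_compose[OF ln_at_top])
  qed
  have 7: "filterlim (\<lambda>n. hdist (phi n v) (phi n w)) at_top sequentially"
    if "v \<in> tree_branch V E" "w \<in> tree_branch V E" "v \<noteq> w" for v w
    using tree_embedding.hdist_branch[OF TE, unfolded BB, OF that]
    by (intro filterlim_at_top_mono[OF lim]) (simp add: phi_def)
  have 8: "hdist (f n z) z \<le> K'" if z: "z \<in> int_img V E (phi n)" for n z
  proof -
    obtain w j where w: "Im w > 0" "cayley (u n) (q n) w = z" "j \<in> {1..d}"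
      "2 * Im w \<ge> \<delta> * norm (w - of_real (xpos (\<epsilon> n) j))"
      using tree_embedding.int_img_cone[OF TE TB, of z n] z unfolding EE phi_def \<delta>_def by metis
    then show ?thesis
      using point_config.displacement_bound(1)[OF PC w(1,3) \<delta> w(4)] unfolding K'_def \<rho>_def by force
  qed
  \<comment> \<open>Rouche's theorem gives the count from an index \<open>N\<close> on, whereas
    \<open>realizable\<close> asks for it at every index with one radius; so the sequence starts at
    \<open>N\<close>.\<close>
  have shift: "filterlim (\<lambda>n. g (n + N)) at_top sequentially" if "filterlim g at_top sequentially" for g :: "nat \<Rightarrow> real"
    using that by (rule filterlim_compose) (rule filterlim_add_const_nat_at_top)
  have 9: "\<exists>R. \<forall>n. crit_count_near (f (n + N)) (phi (n + N) v) R = valence E v - 2"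
    if "v \<in> tree_branch V E" for v
    using N[OF _ that] by (intro exI[of _ "R v"]) simp
  have pos: "ln (real d) > 0" "K' > 0" using d by (auto simp: K'_def)
  show ?thesis
    unfolding realizable_def
  proof (rule exI[of _ "ln (real d)"], rule conjI[OF pos(1)], rule exI[of _ "\<lambda>n. f (n + N)"],
      rule conjI, simp add: 1, rule exI[of _ K'], rule conjI[OF pos(2)], rule exI[of _ "\<lambda>n. phi (n + N)"],
      intro conjI)
    show "\<forall>n. inj_on (phi (n + N)) V \<and>
      (\<forall>e\<in>E. \<forall>e'\<in>E. e \<noteq> e' \<longrightarrow> edge_img V E (phi (n + N)) e \<inter> edge_img V E (phi (n + N)) e' = {}) \<and>
      (\<forall>v\<in>tree_branch V E. \<forall>e\<in>E. phi (n + N) v \<notin> edge_img V E (phi (n + N)) e)"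
      using 6 by blast
  qed (intro allI ballI impI 2 3 4 5 8 9 shift[OF 7]; assumption)+
qed

end
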